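(* For any $n\in\mathbb N$ there exists a closed hyperbolic $3$-manifold $M$ such that $\pi_1(M)$ has at least $n$ distinct Nielsen classes of generating pairs.
   Context: Nielsen equivalence: for a group $G$, two $k$-tuples $(g_1,\ldots,g_k)$ and $(h_1,\ldots,h_k)$ of elements of $G$ are elementarily equivalent if one of the following holds: (1) $h_i=g_{\sigma(i)}$ for all $i$ and some permutation $\sigma\in S_k$; (2) $h_i=g_i^{-1}$ for some $i$ and $h_j=g_j$ for all $j\ne i$; (3) $h_i=g_ig_j^{\varepsilon}$ for some $i\ne j$ and $\varepsilon\in\{-1,1\}$, and $h_l=g_l$ for all $l\neq i$. Two tuples are Nielsen equivalent if one can be transformed into the other by a finite sequence of elementary equivalences. A generating pair of $G$ is a pair $(x,y)$ of elements with $G=\langle x,y\rangle$; a Nielsen class of generating pairs is a Nielsen equivalence class of generating pairs. *)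

theory Defs
  imports
    "HOL-Analysis.Analysis"
    "HOL-Algebra.Generated_Groups"
    "HOL-Combinatorics.Permutations"
begin

section \<open>Closed hyperbolic 3-manifolds\<close>

text \<open>
  Hyperbolic 3-space in the upper half-space model, with
  \<open>cosh d(p,q) = 1 + |p - q|\<^sup>2 / (2 s t)\<close>, where \<open>s\<close>, \<open>t\<close> are the heights of \<open>p\<close>, \<open>q\<close>.
\<close>

definition hyp3 :: "(complex \<times> real) set" where
  "hyp3 = {p. 0 < snd p}"

definition hyp3_dist :: "complex \<times> real \<Rightarrow> complex \<times> real \<Rightarrow> real" where
  "hyp3_dist p q = arcosh (1 + (dist p q)\<^sup>2 / (2 * snd p * snd q))"

definition hyp3_ball :: "complex \<times> real \<Rightarrow> real \<Rightarrow> (complex \<times> real) set" where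
  "hyp3_ball p r = {q \<in> hyp3. hyp3_dist p q < r}"

text \<open>
  A hyperbolic 3-manifold is a nonempty connected metric space in which every point is the centre
  of a ball isometric to a ball of hyperbolic 3-space. In particular it is Hausdorff, locally
  Euclidean of dimension 3 and without boundary. It is closed if it is compact. Orientability is
  not required. The metric need not be the path metric: near each point both agree, so they
  determine the same hyperbolic structure. Up to isometry every such manifold (it has continuum many
  points) lives on any given point type with at least that many elements, for instance on
  \<open>(complex \<times> real) set\<close>, the type of the orbits of a group acting on hyperbolic 3-space.
\<close>

definition hyperbolic_3_manifold :: "'a metric \<Rightarrow> bool" where
  "hyperbolic_3_manifold M \<longleftrightarrow>
     mspace M \<noteq> {} \<and>
     connected_space (mtopology_of M) \<and>
     (\<forall>x \<in> mspace M. \<exists>r > 0. \<exists>p \<in> hyp3. \<exists>f.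
        bij_betw f (mball_of M x r) (hyp3_ball p r) \<and>
        (\<forall>y \<in> mball_of M x r. \<forall>z \<in> mball_of M x r. hyp3_dist (f y) (f z) = mdist M y z))"

definition closed_hyperbolic_3_manifold :: "'a metric \<Rightarrow> bool" where
  "closed_hyperbolic_3_manifold M \<longleftrightarrow>
     hyperbolic_3_manifold M \<and> compact_space (mtopology_of M)"

section \<open>The fundamental group\<close>

text \<open>
  The library's \<open>homotopic_paths\<close> and \<open>+++\<close> need a topological type class; these are their
  counterparts for loops in an abstract topology.
\<close>

definition loops :: "'a topology \<Rightarrow> 'a \<Rightarrow> (real \<Rightarrow> 'a) set" where
  "loops X x = {p. pathin X p \<and> p 0 = x \<and> p 1 = x}"

definition join_loops :: "(real \<Rightarrow> 'a) \<Rightarrow> (real \<Rightarrow> 'a) \<Rightarrow> real \<Rightarrow> 'a" where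
  "join_loops p q = (\<lambda>t. if t \<le> 1/2 then p (2 * t) else q (2 * t - 1))"

definition homotopic_loops_at :: "'a topology \<Rightarrow> 'a \<Rightarrow> (real \<Rightarrow> 'a) \<Rightarrow> (real \<Rightarrow> 'a) \<Rightarrow> bool" where
  "homotopic_loops_at X x p q \<longleftrightarrow>
     homotopic_with (\<lambda>r. r 0 = x \<and> r 1 = x) (top_of_set {0..1}) X p q"

definition loop_class :: "'a topology \<Rightarrow> 'a \<Rightarrow> (real \<Rightarrow> 'a) \<Rightarrow> (real \<Rightarrow> 'a) set" where
  "loop_class X x p = {q \<in> loops X x. homotopic_loops_at X x p q}"

definition fundamental_group :: "'a topology \<Rightarrow> 'a \<Rightarrow> (real \<Rightarrow> 'a) set monoid" where
  "fundamental_group X x =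
     \<lparr> carrier = loop_class X x ` loops X x,
       mult = (\<lambda>A B. \<Union>p\<in>A. \<Union>q\<in>B. loop_class X x (join_loops p q)),
       one = loop_class X x (\<lambda>_. x) \<rparr>"

section \<open>Nielsen equivalence\<close>

text \<open>A \<open>k\<close>-tuple is a list of length \<open>k\<close>; indices start at 0.\<close>

inductive elementary_equivalent :: "('a, 'b) monoid_scheme \<Rightarrow> 'a list \<Rightarrow> 'a list \<Rightarrow> bool"
  for G (structure) where
  permute: "\<sigma> permutes {..<length g} \<Longrightarrow>
      elementary_equivalent G g (map (\<lambda>i. g ! \<sigma> i) [0..<length g])"
| invert: "i < length g \<Longrightarrow> elementary_equivalent G g (g[i := inv (g ! i)])"
| multiply: "\<lbrakk>i < length g; j < length g; i \<noteq> j; \<epsilon> \<in> {-1, 1 :: int}\<rbrakk> \<Longrightarrow>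
      elementary_equivalent G g (g[i := g ! i \<otimes> (g ! j) [^] \<epsilon>])"

definition nielsen_equivalent :: "('a, 'b) monoid_scheme \<Rightarrow> 'a list \<Rightarrow> 'a list \<Rightarrow> bool" where
  "nielsen_equivalent G = (elementary_equivalent G)\<^sup>*\<^sup>*"

definition generating_pairs :: "('a, 'b) monoid_scheme \<Rightarrow> 'a list set" where
  "generating_pairs G =
     {[x, y] | x y. x \<in> carrier G \<and> y \<in> carrier G \<and> generate G {x, y} = carrier G}"

text \<open>
  Elementary equivalences preserve the generated subgroup, so the class of a generating pair
  consists of generating pairs.
\<close>

definition nielsen_classes_of_generating_pairs :: "('a, 'b) monoid_scheme \<Rightarrow> 'a list set set" where
  "nielsen_classes_of_generating_pairs G =
     (\<lambda>g. {h. nielsen_equivalent G g h}) ` generating_pairs G"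

end

theory Submission
  imports Defs
begin

text \<open>
  The manifolds are the \<open>-1/N\<close> Dehn fillings of the figure-eight knot complement, for large \<open>N\<close>. The knot
  group is generated by two conjugate elements, or by the meridian \<open>x\<close> and an element \<open>y\<close> conjugating
  it to the other generator, and the longitude \<open>l\<close> is a word in \<open>x\<close> and \<open>y\<close>. The filling makes
  \<open>l\<^sup>N x\<close> trivial, so \<open>x\<close> is a power of \<open>l\<^sup>k\<close> for every divisor \<open>k\<close> of \<open>N\<close> and each pair \<open>(l\<^sup>k, y)\<close>
  generates. The trace in \<open>SL(2,C)\<close> of the commutator of a pair does not change under elementary
  equivalences. For \<open>(l\<^sup>k, y)\<close> it is a nonconstant polynomial of degree one in \<open>(L\<^sup>k - L\<^sup>-\<^sup>k)\<^sup>2\<close>, where \<open>L\<close>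
  is an eigenvalue of \<open>l\<close>, and \<open>\<bar>L\<bar> \<noteq> 1\<close>; so different divisors give different Nielsen classes. Taking
  for \<open>N\<close> a power of 2 gives as many divisors as desired.

  The hyperbolic structure is found by deforming the cusp of the knot complement into a tube around
  the common axis of \<open>x\<close> and \<open>l\<close>. Seen from this axis, the logarithms of the ends of the neighbouring
  translates of the axis lie near the points of a hexagonal lattice, so a tube of suitable radius and
  its neighbours overlap and cover a uniform neighbourhood of the tube. As hyperbolic space is
  simply connected, the translates of the tube then cover it with the expected overlaps only. This
  makes the group discrete, free of fixed points and cocompact. Lifting paths identifies it with
  the fundamental group of the quotient.
\<close>


section \<open>The action of SL(2,C) on hyperbolic 3-space\<close>

text \<open>Divided by \<open>u\<close>, the logarithms of the ends are close to the Eisenstein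
  integers, and in this scale the tubes are close to horoballs: the region above height 1/sqrt 2,
  and a ball of radius 1/sqrt 2 resting on each lattice point. This radius, the source of the 2 in
  \<open>kap\<close>, exceeds the covering radius 1/sqrt 3, so the boundary of a tube is covered by
  its neighbours; it is below sqrt 3 / 2, so neighbours meet only if their lattice points are
  adjacent. The room on both sides absorbs errors of one percent, uniformly in \<open>N\<close>.
  That overlaps are as expected then amounts to twelve relations of the knot group. Covering and
  overlap alone do not exclude elements of finite order. For these, the double cosets of
  \<open>s 0\<close> and \<open>s 1\<close> count as positive, those of their inverses as negative.
  A positive element with a fixed point has only positive powers, while the finiteness of the set of
  tubes through the point forces some power into the peripheral group, which is not positive.
  Matrices are not taken up to sign. The sign of \<open>M\<close> is therefore chosen with
  \<open>L ^ N * M = 1\<close>, and -1 must be kept out of the peripheral group.\<close>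

datatype m2 = M2 (m11: complex) (m12: complex) (m21: complex) (m22: complex)

instantiation m2 :: monoid_mult
begin

definition one_m2 :: m2 where "1 = M2 1 0 0 1"

definition times_m2 :: "m2 \<Rightarrow> m2 \<Rightarrow> m2" where
  "A * B = M2 (m11 A * m11 B + m12 A * m21 B) (m11 A * m12 B + m12 A * m22 B)
              (m21 A * m11 B + m22 A * m21 B) (m21 A * m12 B + m22 A * m22 B)"

instance
  by standard (auto simp: one_m2_def times_m2_def algebra_simps)

end

lemma M2_mult [simp]:
  "M2 a b c d * M2 a' b' c' d' = M2 (a*a' + b*c') (a*b' + b*d') (c*a' + d*c') (c*b' + d*d')"
  by (simp add: times_m2_def)

definition det2 :: "m2 \<Rightarrow> complex" where "det2 A = m11 A * m22 A - m12 A * m21 A"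
definition tr2 :: "m2 \<Rightarrow> complex" where "tr2 A = m11 A + m22 A"
definition adj2 :: "m2 \<Rightarrow> m2" where "adj2 A = M2 (m22 A) (- m12 A) (- m21 A) (m11 A)"

lemma det2_M2 [simp]: "det2 (M2 a b c d) = a * d - b * c" by (simp add: det2_def)
lemma tr2_M2 [simp]: "tr2 (M2 a b c d) = a + d" by (simp add: tr2_def)
lemma adj2_M2 [simp]: "adj2 (M2 a b c d) = M2 d (-b) (-c) a" by (simp add: adj2_def)

lemma det2_one [simp]: "det2 1 = 1" by (simp add: one_m2_def)
lemma adj2_one [simp]: "adj2 1 = 1" by (simp add: one_m2_def)
lemma adj2_adj2 [simp]: "adj2 (adj2 A) = A" by (cases A) simp
lemma det2_adj2 [simp]: "det2 (adj2 A) = det2 A" by (cases A) (simp add: algebra_simps)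
lemma tr2_adj2 [simp]: "tr2 (adj2 A) = tr2 A" by (cases A) simp
lemma det2_mult: "det2 (A * B) = det2 A * det2 B"
  by (cases A; cases B) (simp add: algebra_simps)
lemma adj2_mult: "adj2 (A * B) = adj2 B * adj2 A"
  by (cases A; cases B) (simp add: algebra_simps)
lemma tr2_mult_commute: "tr2 (A * B) = tr2 (B * A)"
  by (cases A; cases B) (simp add: algebra_simps)

lemma adj2_left: "det2 A = 1 \<Longrightarrow> adj2 A * A = 1"
  by (cases A) (simp add: one_m2_def algebra_simps)
lemma adj2_right: "det2 A = 1 \<Longrightarrow> A * adj2 A = 1"
  by (cases A) (simp add: one_m2_def algebra_simps)
lemma adj2_left_assoc: "det2 A = 1 \<Longrightarrow> adj2 A * (A * B) = B"
  by (metis adj2_left mult.assoc mult_1)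
lemma adj2_right_assoc: "det2 A = 1 \<Longrightarrow> A * (adj2 A * B) = B"
  by (metis adj2_right mult.assoc mult_1)

text \<open>A point of hyperbolic space stands for a positive definite Hermitian form; this is its
  value at the row vector (c, d). If (c, d) is the bottom row of a matrix of determinant 1, it is
  the reciprocal of the height of the image point.\<close>

definition hform :: "complex \<Rightarrow> complex \<Rightarrow> complex \<times> real \<Rightarrow> real" where
  "hform c d p = ((cmod (c * fst p + d))\<^sup>2 + (cmod c)\<^sup>2 * (snd p)\<^sup>2) / snd p"

definition mob :: "m2 \<Rightarrow> complex \<times> real \<Rightarrow> complex \<times> real" where
  "mob A p = (let z = fst p; t = snd p;
      n = (cmod (m21 A * z + m22 A))\<^sup>2 + (cmod (m21 A))\<^sup>2 * t\<^sup>2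
    in (((m11 A * z + m12 A) * cnj (m21 A * z + m22 A) + m11 A * cnj (m21 A) * of_real (t\<^sup>2)) / of_real n,
        t / n))"

text \<open>Lagrange's identity: the inner product and the determinant of two vectors of C^2
  together account for the product of their squared lengths.\<close>

lemma lagrange_complex:
  "(cmod (p * cnj e2 + r * cnj f2))\<^sup>2 + (cmod (p * f2 - r * e2))\<^sup>2 =
   ((cmod p)\<^sup>2 + (cmod r)\<^sup>2) * ((cmod e2)\<^sup>2 + (cmod f2)\<^sup>2)"
  unfolding cmod_power2 by (simp add: power2_eq_square algebra_simps)

lemma mob_den_pos:
  assumes "a * d - b * c = (1::complex)" "t > (0::real)"
  shows "(cmod (c * z + d))\<^sup>2 + (cmod c)\<^sup>2 * t\<^sup>2 > 0"
proof (cases "c = 0")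
  case True
  then have "d \<noteq> 0" using assms by auto
  then show ?thesis using True by simp
next
  case False
  then show ?thesis using assms(2) by (simp add: add_nonneg_pos)
qed

lemma mob_hyp3: assumes "det2 A = 1" "p \<in> hyp3" shows "mob A p \<in> hyp3"
proof (cases A)
  case (M2 a b c d)
  then show ?thesis using mob_den_pos[of a d b c "snd p" "fst p"] assms
    by (auto simp: mob_def hyp3_def Let_def)
qed

text \<open>Moving the point by a matrix amounts to multiplying the row vector by it. The
  composition law of \<open>mob\<close> thus comes from associativity of matrix products.\<close>

lemma hform_mob:
  assumes "det2 A = 1" "p \<in> hyp3"
  shows "hform c' d' (mob A p) = hform (c' * m11 A + d' * m21 A) (c' * m12 A + d' * m22 A) p"
proof (cases A)
  case (M2 a b c d)
  define z t where "z = fst p" and "t = snd p"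
  have t: "t > 0" using assms(2) by (simp add: hyp3_def t_def)
  have det: "a * d - b * c = 1" using assms(1) M2 by simp
  \<comment> \<open>(e1, e2) and (f1, f2) are the images under \<open>A\<close> of the columns (z,
    1) and (t, 0); the new point is built from their inner products.\<close>
  define e1 e2 f1 f2 where "e1 = a*z+b" and "e2 = c*z+d" and "f1 = a * of_real t" and "f2 = c * of_real t"
  define n where "n = (cmod e2)\<^sup>2 + (cmod f2)\<^sup>2"
  have n0: "n > 0" using mob_den_pos[OF det t, of z] t by (simp add: n_def e2_def f2_def norm_mult power_mult_distrib)
  have neq: "(cmod (c * z + d))\<^sup>2 + (cmod c)\<^sup>2 * t\<^sup>2 = n"
    by (simp add: n_def e2_def f2_def norm_mult power_mult_distrib)
  define P R where "P = c'*e1+d'*e2" and "R = c'*f1+d'*f2"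
  have nc: "complex_of_real n = e2 * cnj e2 + f2 * cnj f2"
    by (simp add: n_def complex_norm_square[symmetric])
  have y: "(a*z+b) * cnj (c*z+d) + a * cnj c * of_real (t\<^sup>2) = e1 * cnj e2 + f1 * cnj f2"
    by (simp add: e1_def e2_def f1_def f2_def power2_eq_square)
  have m: "mob A p = ((e1 * cnj e2 + f1 * cnj f2) / of_real n, t / n)"
    using M2 by (simp add: mob_def Let_def neq[symmetric] y[symmetric] z_def t_def)
  have dd: "e1 * f2 - e2 * f1 = - of_real t"
    using det by (simp add: e1_def e2_def f1_def f2_def) algebra
  have 1: "c' * ((e1 * cnj e2 + f1 * cnj f2) / of_real n) + d' = (P * cnj e2 + R * cnj f2) / of_real n"
  proof -
    have "c' * ((e1 * cnj e2 + f1 * cnj f2) / of_real n) + d' = (c' * (e1 * cnj e2 + f1 * cnj f2) + d' * of_real n) / of_real n"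
      using n0 by (simp add: divide_simps)
    also have "c' * (e1 * cnj e2 + f1 * cnj f2) + d' * of_real n = P * cnj e2 + R * cnj f2"
      by (simp add: nc P_def R_def algebra_simps)
    finally show ?thesis .
  qed
  have 2: "P * f2 - R * e2 = - c' * of_real t"
    using dd by (simp add: P_def R_def) algebra
  have 3: "(cmod (P * f2 - R * e2))\<^sup>2 = (cmod c')\<^sup>2 * t\<^sup>2"
    by (simp add: 2 norm_mult power_mult_distrib)
  have "hform c' d' (mob A p) = ((cmod (P * cnj e2 + R * cnj f2))\<^sup>2 / n\<^sup>2 + (cmod c')\<^sup>2 * t\<^sup>2 / n\<^sup>2) / (t / n)"
    using n0 unfolding hform_def m fst_conv snd_conv 1 by (simp add: norm_divide power_divide)
  also have "\<dots> = ((cmod (P * cnj e2 + R * cnj f2))\<^sup>2 + (cmod (P * f2 - R * e2))\<^sup>2) / (n * t)"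
    unfolding 3 using n0 t by (simp add: field_simps power2_eq_square)
  also have "\<dots> = ((cmod P)\<^sup>2 + (cmod R)\<^sup>2) / t"
    using n0 t by (simp add: lagrange_complex n_def[symmetric])
  also have "R = (c' * a + d' * c) * of_real t"
    by (simp add: R_def f1_def f2_def algebra_simps)
  also have "P = (c' * a + d' * c) * z + (c' * b + d' * d)"
    by (simp add: P_def e1_def e2_def algebra_simps)
  finally show ?thesis
    using M2 by (simp add: hform_def z_def t_def norm_mult power_mult_distrib)
qed

text \<open>The value at (0, 1) recovers the height, and the value at (1, -z) the horizontal
  distance from z.\<close>

lemma hform_inject:
  assumes "p \<in> hyp3" "q \<in> hyp3" and eq: "\<And>c d. hform c d p = hform c d q"
  shows "p = q"
proof -
  obtain z t w s where p: "p = (z,t)" "q = (w,s)" by (cases p; cases q) auto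
  have t: "t > 0" "s > 0" using assms p by (auto simp: hyp3_def)
  have ts: "t = s" using eq[of 0 1] t by (simp add: hform_def p field_simps)
  have "(cmod (z - z))\<^sup>2 = (cmod (w - z))\<^sup>2" using eq[of 1 "-z"] t by (simp add: hform_def p ts)
  then show ?thesis by (simp add: p ts)
qed

lemma mob_mult:
  assumes "det2 A = 1" "det2 B = 1" "p \<in> hyp3"
  shows "mob (A * B) p = mob A (mob B p)"
proof (rule hform_inject)
  show "mob (A * B) p \<in> hyp3" "mob A (mob B p) \<in> hyp3"
    using assms by (auto intro!: mob_hyp3 simp: det2_mult)
  fix c d
  show "hform c d (mob (A * B) p) = hform c d (mob A (mob B p))"
    using assms by (simp add: hform_mob mob_hyp3 det2_mult) (simp add: times_m2_def algebra_simps)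
qed

lemma mob_one [simp]: "mob 1 p = p"
  by (simp add: mob_def one_m2_def)

lemma mob_adj2 [simp]:
  assumes "det2 A = 1" "p \<in> hyp3"
  shows "mob (adj2 A) (mob A p) = p" "mob A (mob (adj2 A) p) = p"
  using assms by (auto simp: mob_mult[symmetric] adj2_left adj2_right)

section \<open>The hyperbolic metric\<close>

text \<open>The hyperbolic cosine of the distance. Being rational in squares of the coordinates, it
  keeps \<open>arcosh\<close> out of the computations.\<close>

definition chd :: "complex \<times> real \<Rightarrow> complex \<times> real \<Rightarrow> real" where
  "chd p q = ((cmod (fst p - fst q))\<^sup>2 + (snd p)\<^sup>2 + (snd q)\<^sup>2) / (2 * snd p * snd q)"

lemma chd_eq:
  assumes "p \<in> hyp3" "q \<in> hyp3"
  shows "1 + (dist p q)\<^sup>2 / (2 * snd p * snd q) = chd p q"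
proof -
  have "(dist p q)\<^sup>2 = (cmod (fst p - fst q))\<^sup>2 + (snd p - snd q)\<^sup>2"
    by (simp add: dist_prod_def dist_norm)
  then show ?thesis using assms
    by (simp add: chd_def hyp3_def field_simps) (simp add: power2_eq_square algebra_simps)
qed

lemma hyp3_dist_chd: "p \<in> hyp3 \<Longrightarrow> q \<in> hyp3 \<Longrightarrow> hyp3_dist p q = arcosh (chd p q)"
  by (simp add: hyp3_dist_def chd_eq)

lemma chd_ge_1: "p \<in> hyp3 \<Longrightarrow> q \<in> hyp3 \<Longrightarrow> chd p q \<ge> 1"
  by (simp add: chd_eq[symmetric]) (simp add: hyp3_def)

lemma cosh_hyp3_dist: "p \<in> hyp3 \<Longrightarrow> q \<in> hyp3 \<Longrightarrow> cosh (hyp3_dist p q) = chd p q"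
  by (simp add: hyp3_dist_chd chd_ge_1)

lemma hyp3_dist_nonneg: "p \<in> hyp3 \<Longrightarrow> q \<in> hyp3 \<Longrightarrow> hyp3_dist p q \<ge> 0"
  by (simp add: hyp3_dist_chd chd_ge_1)

lemma hyp3_dist_sym: "hyp3_dist p q = hyp3_dist q p"
  by (simp add: hyp3_dist_def dist_commute mult.commute mult.left_commute)

lemma hyp3_dist_0_iff: 
  assumes "p \<in> hyp3" "q \<in> hyp3" shows "hyp3_dist p q = 0 \<longleftrightarrow> p = q"
proof
  assume "hyp3_dist p q = 0"
  then have "chd p q = 1" using cosh_hyp3_dist[OF assms] by simp
  then have "(dist p q)\<^sup>2 / (2 * snd p * snd q) = 0" using chd_eq[OF assms] by simp
  then show "p = q" using assms by (auto simp: hyp3_def)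
qed (simp add: hyp3_dist_def)

lemma hyp3_dist_le_iff:
  assumes "p \<in> hyp3" "q \<in> hyp3" "r \<ge> 0"
  shows "hyp3_dist p q \<le> r \<longleftrightarrow> chd p q \<le> cosh r"
  using cosh_real_nonneg_le_iff[OF hyp3_dist_nonneg[OF assms(1,2)] assms(3)] cosh_hyp3_dist[OF assms(1,2)]
  by simp

lemma hyp3_dist_le:
  assumes "p \<in> hyp3" "q \<in> hyp3" "p' \<in> hyp3" "q' \<in> hyp3" "chd p q \<le> chd p' q'"
  shows "hyp3_dist p q \<le> hyp3_dist p' q'"
  using hyp3_dist_le_iff[OF assms(1,2) hyp3_dist_nonneg[OF assms(3,4)]] assms cosh_hyp3_dist[of p' q']
  by simp

lemma chd_translate: "chd (mob (M2 1 b 0 1) p) (mob (M2 1 b 0 1) q) = chd p q"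
  by (simp add: mob_def chd_def)

lemma mob_diag:
  assumes "a \<noteq> 0"
  shows "mob (M2 a 0 0 (1/a)) p = (a\<^sup>2 * fst p, (cmod a)\<^sup>2 * snd p)"
proof -
  have "a * cnj a = of_real ((cmod a)\<^sup>2)" by (metis complex_norm_square)
  then show ?thesis using assms
    by (simp add: mob_def Let_def norm_divide power_divide divide_simps power2_eq_square)
qed

lemma chd_diag:
  assumes "a \<noteq> 0" 
  shows "chd (mob (M2 a 0 0 (1/a)) p) (mob (M2 a 0 0 (1/a)) q) = chd p q"
proof -
  have "(cmod (a\<^sup>2 * fst p - a\<^sup>2 * fst q))\<^sup>2 = (cmod a)^4 * (cmod (fst p - fst q))\<^sup>2"
    by (simp add: right_diff_distrib[symmetric] norm_mult norm_power power_mult_distrib)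
  then show ?thesis using assms
    by (simp add: mob_diag chd_def power_mult_distrib)
       (simp add: divide_simps, simp add: power2_eq_square power4_eq_xxxx algebra_simps)
qed

lemma chd_inversion:
  assumes "p \<in> hyp3" "q \<in> hyp3"
  shows "chd (mob (M2 0 (-1) 1 0) p) (mob (M2 0 (-1) 1 0) q) = chd p q"
proof -
  obtain x y t where p: "p = (Complex x y, t)" by (metis complex.exhaust surj_pair)
  obtain x' y' s where q: "q = (Complex x' y', s)" by (metis complex.exhaust surj_pair)
  have t: "t > 0" "s > 0" using assms p q by (auto simp: hyp3_def)
  define n m where "n = x\<^sup>2+y\<^sup>2+t\<^sup>2" and "m = x'\<^sup>2+y'\<^sup>2+s\<^sup>2"
  have nm: "n > 0" "m > 0" using t by (auto simp: n_def m_def add_nonneg_pos)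
  have mp: "mob (M2 0 (-1) 1 0) p = (Complex (-x/n) (y/n), t/n)"
    by (simp add: mob_def p cmod_power2 n_def complex_eq_iff)
  have mq: "mob (M2 0 (-1) 1 0) q = (Complex (-x'/m) (y'/m), s/m)"
    by (simp add: mob_def q cmod_power2 m_def complex_eq_iff)
  have "(x/n - x'/m)\<^sup>2 + (y/n - y'/m)\<^sup>2 + (t/n)\<^sup>2 + (s/m)\<^sup>2 = 
     (n * m\<^sup>2 + m * n\<^sup>2 - 2 * (x*x'+y*y') * n * m) / (n\<^sup>2 * m\<^sup>2)"
    using nm by (simp add: divide_simps) (simp add: n_def m_def power2_eq_square algebra_simps)
  also have "\<dots> = (n + m - 2 * (x*x'+y*y')) / (n * m)"
    using nm by (simp add: divide_simps) (simp add: power2_eq_square algebra_simps)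
  finally have e: "(x/n - x'/m)\<^sup>2 + (y/n - y'/m)\<^sup>2 + (t/n)\<^sup>2 + (s/m)\<^sup>2 = (n + m - 2 * (x*x'+y*y')) / (n * m)" .
  have "chd (mob (M2 0 (-1) 1 0) p) (mob (M2 0 (-1) 1 0) q) = 
     ((x/n - x'/m)\<^sup>2 + (y/n - y'/m)\<^sup>2 + (t/n)\<^sup>2 + (s/m)\<^sup>2) / (2 * (t/n) * (s/m))"
    by (simp add: mp mq chd_def cmod_power2) (simp add: power2_commute)
  also have "\<dots> = (n + m - 2 * (x*x'+y*y')) / (2 * t * s)"
    unfolding e using nm t by (simp add: divide_simps)
  also have "\<dots> = chd p q"
  proof -
    have "(cmod (fst p - fst q))\<^sup>2 = (x - x')\<^sup>2 + (y - y')\<^sup>2"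
      by (simp add: p q cmod_power2)
    then show ?thesis unfolding chd_def by (simp add: p q n_def m_def power2_eq_square algebra_simps)
  qed
  finally show ?thesis .
qed

text \<open>Bruhat decomposition: an upper triangular matrix is a dilation followed by a
  translation, and every other matrix has exactly one inversion between upper triangular
  ones.\<close>

lemma chd_mob:
  assumes "det2 A = 1" "p \<in> hyp3" "q \<in> hyp3"
  shows "chd (mob A p) (mob A q) = chd p q"
proof (cases A)
  case (M2 a b c d)
  have det: "a * d - b * c = 1" using assms M2 by simp
  show ?thesis
  proof (cases "c = 0")
    case True
    then have a: "a \<noteq> 0" "d = 1/a" using det True by (auto simp: eq_divide_eq mult.commute)
    have A: "A = M2 1 (a*b) 0 1 * M2 a 0 0 (1/a)" using a M2 True by simp
    have "det2 (M2 a 0 0 (1/a)) = 1" using a by simp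
    then show ?thesis unfolding A using assms a by (simp add: mob_mult chd_translate chd_diag del: M2_mult)
  next
    case False
    have A: "A = M2 1 (a/c) 0 1 * (M2 0 (-1) 1 0 * (M2 c 0 0 (1/c) * M2 1 (d/c) 0 1))" 
      using False M2 det by (simp add: field_simps)
    have "det2 (M2 c 0 0 (1/c)) = 1" using False by simp
    then show ?thesis unfolding A using assms False 
      by (simp add: mob_mult det2_mult mob_hyp3 chd_translate chd_diag chd_inversion del: M2_mult)
  qed
qed

lemma hyp3_dist_mob:
  "det2 A = 1 \<Longrightarrow> p \<in> hyp3 \<Longrightarrow> q \<in> hyp3 \<Longrightarrow> hyp3_dist (mob A p) (mob A q) = hyp3_dist p q"
  by (simp add: hyp3_dist_chd mob_hyp3 chd_mob)

text \<open>The triangle inequality through the centre (0, 1), with the hyperbolic cosine of a sum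
  expanded; the square roots are hyperbolic sines. It rests on the Cauchy-Schwarz inequality in the
  plane.\<close>

lemma chd_centre:
  assumes "s > 0" "t > 0"
  shows "chd (z,s) (w,t) \<le> chd (z,s) (0,1) * chd (w,t) (0,1) 
    + sqrt ((chd (z,s) (0,1))\<^sup>2 - 1) * sqrt ((chd (w,t) (0,1))\<^sup>2 - 1)"
proof -
  define P Q where "P = (cmod z)\<^sup>2 + s\<^sup>2" and "Q = (cmod w)\<^sup>2 + t\<^sup>2"
  have a: "sqrt ((chd (z,s) (0,1))\<^sup>2 - 1) = sqrt ((P-1)\<^sup>2 + (2 * cmod z)\<^sup>2) / (2 * s)" 
  proof -
    have "(chd (z,s) (0,1))\<^sup>2 - 1 = ((P-1)\<^sup>2 + (2 * cmod z)\<^sup>2) / (2 * s)\<^sup>2"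
      using assms by (simp add: chd_def P_def field_simps) (simp add: power2_eq_square algebra_simps)
    then show ?thesis using assms by (simp only: real_sqrt_divide real_sqrt_abs)
  qed
  have b: "sqrt ((chd (w,t) (0,1))\<^sup>2 - 1) = sqrt ((Q-1)\<^sup>2 + (2 * cmod w)\<^sup>2) / (2 * t)" 
  proof -
    have "(chd (w,t) (0,1))\<^sup>2 - 1 = ((Q-1)\<^sup>2 + (2 * cmod w)\<^sup>2) / (2 * t)\<^sup>2"
      using assms by (simp add: chd_def Q_def field_simps) (simp add: power2_eq_square algebra_simps)
    then show ?thesis using assms by (simp only: real_sqrt_divide real_sqrt_abs)
  qed
  define R where "R = Re (z * cnj w)"
  have R: "\<bar>R\<bar> \<le> cmod z * cmod w" unfolding R_def using abs_Re_le_cmod[of "z * cnj w"] by (simp add: norm_mult)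
  have cs: "\<bar>(P-1)*(Q-1) + (2 * cmod z) * (2 * cmod w)\<bar> \<le> sqrt ((P-1)\<^sup>2 + (2 * cmod z)\<^sup>2) * sqrt ((Q-1)\<^sup>2 + (2 * cmod w)\<^sup>2)"
    if "True" for P Q :: real
  proof -
    have "((P-1)*(Q-1) + (2 * cmod z) * (2 * cmod w))\<^sup>2 \<le> ((P-1)\<^sup>2 + (2 * cmod z)\<^sup>2) * ((Q-1)\<^sup>2 + (2 * cmod w)\<^sup>2)"
      using zero_le_power2[of "(P-1) * (2 * cmod w) - (Q-1) * (2 * cmod z)"]
      by (simp add: power2_eq_square algebra_simps)
    then show ?thesis
      by (metis real_sqrt_abs real_sqrt_le_iff real_sqrt_mult)
  qed
  \<comment> \<open>Replacing \<open>Q\<close> by \<open>2 - Q\<close> reverses the sign of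
    \<open>Q - 1\<close> and keeps its square.\<close>
  have cs2: "- (P-1)*(Q-1) + 4 * (cmod z * cmod w) \<le> sqrt ((P-1)\<^sup>2 + (2 * cmod z)\<^sup>2) * sqrt ((Q-1)\<^sup>2 + (2 * cmod w)\<^sup>2)"
    using cs[of P "2-Q"] power2_commute[of "1" Q] by (simp add: algebra_simps)
  have w: "(cmod (z - w))\<^sup>2 = (cmod z)\<^sup>2 + (cmod w)\<^sup>2 - 2 * R"
    unfolding cmod_power2 by (simp add: R_def power2_eq_square algebra_simps)
  have "2 * (P + Q - 2 * R) \<le> (P+1)*(Q+1) + sqrt ((P-1)\<^sup>2 + (2 * cmod z)\<^sup>2) * sqrt ((Q-1)\<^sup>2 + (2 * cmod w)\<^sup>2)"
    using cs2 R by (simp add: algebra_simps)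
  moreover have "chd (z,s) (w,t) = 2 * (P + Q - 2 * R) / (4 * s * t)"
    using assms by (simp add: chd_def w P_def Q_def field_simps)
  moreover have "chd (z,s) (0,1) * chd (w,t) (0,1) = (P+1)*(Q+1) / (4 * s * t)"
    using assms by (simp add: chd_def P_def Q_def field_simps)
  ultimately show ?thesis unfolding a b using assms
    by (simp add: divide_simps)
qed

lemma hyp3_dist_triangle:
  assumes "p \<in> hyp3" "q \<in> hyp3" "r \<in> hyp3"
  shows "hyp3_dist p r \<le> hyp3_dist p q + hyp3_dist q r"
proof -
  obtain z t where q: "q = (z,t)" by (cases q)
  have t: "t > 0" using assms q by (auto simp: hyp3_def)
  \<comment> \<open>A translation and a dilation that carry the middle point \<open>q\<close> to the
    centre (0, 1).\<close>
  define A where "A = M2 (1 / of_real (sqrt t)) (- z / of_real (sqrt t)) 0 (of_real (sqrt t))"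
  have A: "det2 A = 1" using t by (simp add: A_def)
  have q': "mob A q = (0,1)"
    using t by (simp add: mob_def A_def q norm_divide power_divide)
  have main: "hyp3_dist p r \<le> hyp3_dist p (0,1) + hyp3_dist (0,1) r" if "p \<in> hyp3" "r \<in> hyp3" for p r
  proof -
    have o: "(0,1) \<in> hyp3" by (simp add: hyp3_def)
    have pos: "snd p > 0" "snd r > 0" using that by (auto simp: hyp3_def)
    have sh: "sqrt ((chd p (0,1))\<^sup>2 - 1) = sinh (hyp3_dist p (0,1))" if "p \<in> hyp3" for p
    proof -
      have "(chd p (0,1))\<^sup>2 - 1 = (sinh (hyp3_dist p (0,1)))\<^sup>2"
        using cosh_square_eq[of "hyp3_dist p (0,1)"] unfolding cosh_hyp3_dist[OF that o] by simp
      then show ?thesis using hyp3_dist_nonneg[OF that o] by simp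
    qed
    have "chd p r \<le> cosh (hyp3_dist p (0,1)) * cosh (hyp3_dist r (0,1)) + sinh (hyp3_dist p (0,1)) * sinh (hyp3_dist r (0,1))"
      using chd_centre[OF pos, of "fst p" "fst r"] that o
      by (simp add: cosh_hyp3_dist sh)
    then have "chd p r \<le> cosh (hyp3_dist p (0,1) + hyp3_dist r (0,1))"
      by (simp add: cosh_add)
    then show ?thesis
      using hyp3_dist_le_iff[OF that, of "hyp3_dist p (0,1) + hyp3_dist r (0,1)"] that o
      by (simp add: hyp3_dist_nonneg hyp3_dist_sym[of "(0,1)"])
  qed
  show ?thesis
    using main[of "mob A p" "mob A r"] assms A q'
    by (metis hyp3_dist_mob mob_hyp3)
qed


section \<open>Topology of the upper half-space and vertical translations\<close>

lemma convex_hyp3: "convex hyp3"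
proof -
  have "hyp3 = UNIV \<times> {0<..}" by (auto simp: hyp3_def)
  then show ?thesis by (metis convex_Times convex_UNIV convex_real_interval(3))
qed

lemma continuous_on_hyp3_dist:
  "continuous_on (hyp3 \<times> hyp3) (\<lambda>(p,q). hyp3_dist p q)"
proof -
  have "continuous_on (hyp3 \<times> hyp3) (\<lambda>x. arcosh (1 + (dist (fst x) (snd x))\<^sup>2 / (2 * snd (fst x) * snd (snd x))))"
  proof (rule continuous_on_compose2[OF continuous_on_arcosh[OF order.refl]])
    show "continuous_on (hyp3 \<times> hyp3) (\<lambda>x. 1 + (dist (fst x) (snd x))\<^sup>2 / (2 * snd (fst x) * snd (snd x)))"
      by (intro continuous_on_add continuous_on_const continuous_on_divide continuous_on_power continuous_on_dist
           continuous_on_mult continuous_on_fst continuous_on_snd continuous_on_id) (auto simp: hyp3_def)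
  qed (auto simp: hyp3_def)
  then show ?thesis by (simp add: hyp3_dist_def case_prod_beta')
qed

lemma hyp3_dist_small:
  assumes "p \<in> hyp3" "e > 0"
  obtains d where "d > 0" "\<And>q. q \<in> hyp3 \<Longrightarrow> dist p q < d \<Longrightarrow> hyp3_dist p q < e"
proof -
  have "continuous_on hyp3 (\<lambda>q. (case (p,q) of (p,q) \<Rightarrow> hyp3_dist p q))"
    by (rule continuous_on_compose2[OF continuous_on_hyp3_dist])
       (use assms in \<open>auto intro: continuous_on_Pair continuous_on_const continuous_on_id\<close>)
  then have "continuous_on hyp3 (hyp3_dist p)" by simp
  then obtain d where "d > 0" "\<forall>q\<in>hyp3. dist q p < d \<longrightarrow> dist (hyp3_dist p q) (hyp3_dist p p) < e"
    using assms unfolding continuous_on_iff by metis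
  moreover have "hyp3_dist p p = 0" using hyp3_dist_0_iff assms by auto
  ultimately show thesis by (intro that[of d]) (auto simp: dist_commute dist_real_def)
qed

text \<open>Not an isometry: Euclidean distances stay while heights grow. It supplies the
  null-homotopies of closed chains.\<close>

definition raise :: "real \<Rightarrow> complex \<times> real \<Rightarrow> complex \<times> real" where
  "raise s p = (fst p, snd p + s)"

lemma raise_hyp3: "p \<in> hyp3 \<Longrightarrow> s \<ge> 0 \<Longrightarrow> raise s p \<in> hyp3"
  by (auto simp: raise_def hyp3_def)

lemma hyp3_dist_raise:
  assumes "p \<in> hyp3" "q \<in> hyp3" "s \<ge> 0"
  shows "hyp3_dist (raise s p) (raise s q) \<le> hyp3_dist p q"
proof (rule hyp3_dist_le)
  have "1 + (dist (raise s p) (raise s q))\<^sup>2 / (2 * snd (raise s p) * snd (raise s q))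
      \<le> 1 + (dist p q)\<^sup>2 / (2 * snd p * snd q)"
    using assms
    by (auto simp: raise_def dist_prod_def dist_real_def hyp3_def intro!: divide_left_mono mult_mono add_nonneg_nonneg mult_pos_pos)
  then show "chd (raise s p) (raise s q) \<le> chd p q"
    using assms by (simp only: chd_eq raise_hyp3)
qed (use assms raise_hyp3 in auto)


section \<open>From local to global tilings\<close>

text \<open>Words grow on the right only, which suits inductions over chains of tiles; closure under
  inverses is \<open>mgen_adj2\<close>.\<close>

inductive_set mgen :: "m2 set \<Rightarrow> m2 set" for S where
  one: "1 \<in> mgen S"
| step: "g \<in> mgen S \<Longrightarrow> t \<in> S \<Longrightarrow> g * t \<in> mgen S"

lemma mgen_base: "t \<in> S \<Longrightarrow> t \<in> mgen S"
  using mgen.step[OF mgen.one, of t S] by simp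

lemma mgen_mult: "h \<in> mgen S \<Longrightarrow> g \<in> mgen S \<Longrightarrow> g * h \<in> mgen S"
  by (induction rule: mgen.induct) (auto simp: mult.assoc[symmetric] intro: mgen.step)

lemma mgen_det: "g \<in> mgen S \<Longrightarrow> (\<And>t. t \<in> S \<Longrightarrow> det2 t = 1) \<Longrightarrow> det2 g = 1"
  by (induction rule: mgen.induct) (auto simp: det2_mult)

lemma mgen_adj2: "g \<in> mgen S \<Longrightarrow> (\<And>t. t \<in> S \<Longrightarrow> adj2 t \<in> mgen S) \<Longrightarrow> adj2 g \<in> mgen S"
  by (induction rule: mgen.induct) (auto simp: adj2_mult intro: mgen.one mgen_mult)

text \<open>The assumptions are local: they concern \<open>V\<close> and its translates by elements of \<open>T\<close>.
  Closed chains of overlapping translates have no holonomy because hyperbolic space is simply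
  connected, so every translate that meets \<open>V\<close> is one of these.\<close>

locale tiling =
  fixes S T :: "m2 set" and V :: "(complex \<times> real) set" and \<epsilon> :: real
  assumes det_S: "t \<in> S \<Longrightarrow> det2 t = 1"
    and adj_S: "t \<in> S \<Longrightarrow> adj2 t \<in> S"
    and S_T: "S \<subseteq> T"
    and T_mgen: "T \<subseteq> mgen S"
    and one_T: "1 \<in> T"
    and adj_T: "t \<in> T \<Longrightarrow> adj2 t \<in> T"
    and V_hyp3: "V \<subseteq> hyp3"
    and V_ne: "V \<noteq> {}"
    and V_conn: "connected V"
    and overlap: "t \<in> S \<Longrightarrow> \<exists>x\<in>V. mob (adj2 t) x \<in> V"
    and cocycle: "\<lbrakk>g \<in> T; h \<in> T; x \<in> V; mob (adj2 g) x \<in> V; mob (adj2 h) x \<in> V\<rbrakk> \<Longrightarrow> adj2 g * h \<in> T"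
    and eps: "\<epsilon> > 0"
    and cover: "x \<in> V \<Longrightarrow> \<exists>t\<in>T. \<forall>q\<in>hyp3. hyp3_dist x q < \<epsilon> \<longrightarrow> mob (adj2 t) q \<in> V"
begin

abbreviation "\<Gamma> \<equiv> mgen S"

lemma det [simp]: "g \<in> \<Gamma> \<Longrightarrow> det2 g = 1"
  using mgen_det det_S by blast

lemma adj_Gamma: "g \<in> \<Gamma> \<Longrightarrow> adj2 g \<in> \<Gamma>"
  using mgen_adj2 adj_S mgen_base by blast

definition inV :: "m2 \<Rightarrow> complex \<times> real \<Rightarrow> bool" where
  "inV g p \<longleftrightarrow> p \<in> hyp3 \<and> mob (adj2 g) p \<in> V"

text \<open>Two tiles through \<open>p\<close> are identified if \<open>T\<close> lists their
  relative position. The classes are the points over \<open>p\<close> of the space glued from the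
  tiles, and the aim is to show that this covering of hyperbolic space has a single sheet.\<close>

definition sim :: "m2 \<Rightarrow> m2 \<Rightarrow> complex \<times> real \<Rightarrow> bool" where
  "sim g h p \<longleftrightarrow> g \<in> \<Gamma> \<and> h \<in> \<Gamma> \<and> inV g p \<and> inV h p \<and> adj2 g * h \<in> T"

lemma sim_sym: "sim g h p \<Longrightarrow> sim h g p"
  using adj_T[of "adj2 g * h"] by (auto simp: sim_def adj2_mult)

lemma sim_refl: "g \<in> \<Gamma> \<Longrightarrow> inV g p \<Longrightarrow> sim g g p"
  by (simp add: sim_def adj2_left one_T)

text \<open>This is the assumption \<open>cocycle\<close>, seen from the middle tile after
  \<open>p\<close> has been moved into \<open>V\<close>.\<close>

lemma sim_trans: 
  assumes "sim g h p" "sim h k p" shows "sim g k p"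
proof -
  have G: "g \<in> \<Gamma>" "h \<in> \<Gamma>" "k \<in> \<Gamma>" and p: "p \<in> hyp3" using assms by (auto simp: sim_def inV_def)
  define x where "x = mob (adj2 h) p"
  have x: "x \<in> V" using assms by (simp add: x_def sim_def inV_def)
  have 1: "adj2 h * g \<in> T" using sim_sym[OF assms(1)] by (simp add: sim_def)
  have 2: "adj2 h * k \<in> T" using assms(2) by (simp add: sim_def)
  have e: "mob (adj2 (adj2 h * f)) x = mob (adj2 f) p" if "f \<in> \<Gamma>" for f
  proof -
    have "mob (adj2 (adj2 h * f)) x = mob (adj2 f * h) x" by (simp add: adj2_mult)
    also have "\<dots> = mob (adj2 f) (mob h x)" using that G x V_hyp3 by (subst mob_mult) auto
    also have "mob h x = p" using G p by (simp add: x_def)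
    finally show ?thesis .
  qed
  have "adj2 (adj2 h * g) * (adj2 h * k) \<in> T"
    using assms by (intro cocycle[OF 1 2 x]) (auto simp: e G sim_def inV_def)
  also have "adj2 (adj2 h * g) * (adj2 h * k) = adj2 g * k"
    using G by (simp add: adj2_mult mult.assoc adj2_right_assoc)
  finally show ?thesis using assms by (auto simp: sim_def)
qed

text \<open>The analogue of a Lebesgue number: every class at \<open>p\<close> has a member that
  contains the whole \<open>\<epsilon>\<close>-ball, so sheets extend over balls of uniform
  size.\<close>

lemma good_rep:
  assumes "g \<in> \<Gamma>" "inV g p"
  obtains k where "sim g k p" "\<And>q. q \<in> hyp3 \<Longrightarrow> hyp3_dist p q < \<epsilon> \<Longrightarrow> inV k q"
proof -
  have p: "p \<in> hyp3" and x: "mob (adj2 g) p \<in> V" using assms by (auto simp: inV_def)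
  obtain t where t: "t \<in> T" "\<And>q. q \<in> hyp3 \<Longrightarrow> hyp3_dist (mob (adj2 g) p) q < \<epsilon> \<Longrightarrow> mob (adj2 t) q \<in> V"
    using cover[OF x] by blast
  have tG: "t \<in> \<Gamma>" using t T_mgen by auto
  have k: "inV (g * t) q" if "q \<in> hyp3" "hyp3_dist p q < \<epsilon>" for q
  proof -
    have "mob (adj2 (g * t)) q = mob (adj2 t) (mob (adj2 g) q)"
      using that assms tG by (simp add: adj2_mult mob_mult)
    moreover have "hyp3_dist (mob (adj2 g) p) (mob (adj2 g) q) < \<epsilon>"
      using that assms p by (simp add: hyp3_dist_mob)
    ultimately show ?thesis using that t(2)[of "mob (adj2 g) q"] assms by (simp add: inV_def mob_hyp3)
  qed
  have "inV (g * t) p" using k[OF p] hyp3_dist_0_iff[OF p p] eps by simp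
  moreover have "adj2 g * (g * t) = t" using assms by (simp add: adj2_left_assoc)
  ultimately have "sim g (g * t) p" using assms tG t by (simp add: sim_def mgen_mult)
  then show thesis using k that by blast
qed

text \<open>Transport of a sheet from \<open>p\<close> to \<open>q\<close> inside a single tile
  \<open>k\<close> that contains both points.\<close>

definition R :: "complex \<times> real \<Rightarrow> complex \<times> real \<Rightarrow> m2 \<Rightarrow> m2 \<Rightarrow> bool" where
  "R p q g h \<longleftrightarrow> (\<exists>k. sim g k p \<and> sim k h q)"

lemma R_sym: "R p q g h \<Longrightarrow> R q p h g"
  unfolding R_def using sim_sym by blast

lemma R_exists:
  assumes "g \<in> \<Gamma>" "inV g p" "q \<in> hyp3" "hyp3_dist p q < \<epsilon>"
  obtains h where "R p q g h" "h \<in> \<Gamma>" "inV h q"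
proof -
  obtain k where k: "sim g k p" "inV k q" using good_rep[OF assms(1,2)] assms(3,4) by metis
  have "k \<in> \<Gamma>" using k by (simp add: sim_def)
  then show thesis using that[of k] k sim_refl unfolding R_def by blast
qed

text \<open>Whether \<open>adj2 k * k'\<close> is in \<open>T\<close> does not depend on the point,
  so tiles identified at \<open>p\<close> are also identified at \<open>q\<close> when both contain
  \<open>q\<close>.\<close>

lemma R_unique: 
  assumes "R p q g h" "R p q g' h'" "sim g g' p" 
  shows "sim h h' q"
proof -
  obtain k k' where k: "sim g k p" "sim k h q" "sim g' k' p" "sim k' h' q" using assms by (auto simp: R_def)
  have "sim k k' p" using k assms(3) sim_trans sim_sym by blast
  then have "sim k k' q" using k by (auto simp: sim_def)
  then show ?thesis using k sim_trans sim_sym by blast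
qed

text \<open>The three points lie in one tile, namely the good representative at \<open>p\<close>, so
  transport around the triangle is trivial.\<close>

lemma R_trans:
  assumes "R p q g h" "R q r h f" "hyp3_dist p q < \<epsilon>" "hyp3_dist p r < \<epsilon>" 
  shows "R p r g f"
proof -
  obtain k1 k2 where k: "sim g k1 p" "sim k1 h q" "sim h k2 q" "sim k2 f r" using assms by (auto simp: R_def)
  have G: "g \<in> \<Gamma>" "inV g p" "q \<in> hyp3" "r \<in> hyp3" using k by (auto simp: sim_def inV_def)
  obtain k where k0: "sim g k p" "inV k q" "inV k r" using good_rep[OF G(1,2)] G assms(3,4) by metis
  have "k \<in> \<Gamma>" using k0 by (simp add: sim_def)
  then have "R p q g k" "R p q g h" using k0 k sim_refl unfolding R_def by blast+
  then have "sim k h q" using R_unique sim_refl G by blast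
  then have "sim k k2 q" using k sim_trans by blast
  then have "sim k k2 r" using k0 k by (auto simp: sim_def)
  then have "sim k f r" using k sim_trans by blast
  then show ?thesis using k0 by (auto simp: R_def)
qed

lemma R_inV: "R p q g h \<Longrightarrow> g \<in> \<Gamma> \<and> h \<in> \<Gamma> \<and> inV g p \<and> inV h q"
  by (auto simp: R_def sim_def)

lemma R_square:
  assumes "R p q g h" "R p p' g g'" "R q q' h h'"
    "hyp3_dist p p' < \<epsilon>" "hyp3_dist p' q < \<epsilon>" "hyp3_dist p' q' < \<epsilon>"
  shows "R p' q' g' h'"
proof -
  have "hyp3_dist p' p < \<epsilon>" using assms by (simp add: hyp3_dist_sym)
  from R_trans[OF R_sym[OF assms(2)] assms(1) this assms(5)]
  show ?thesis using R_trans assms by blast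
qed

text \<open>A discrete lifted path. The steps are shorter than \<open>\<epsilon> / 2\<close>, so
  that the diagonals of the squares between two levels stay below \<open>\<epsilon>\<close>.\<close>

definition flat :: "nat \<Rightarrow> (nat \<Rightarrow> complex \<times> real) \<Rightarrow> (nat \<Rightarrow> m2) \<Rightarrow> bool" where
  "flat n y g \<longleftrightarrow> (\<forall>j<n. R (y j) (y (Suc j)) (g j) (g (Suc j)) \<and> hyp3_dist (y j) (y (Suc j)) < \<epsilon> / 2)"

lemma flat_inV:
  assumes "flat n y g" "0 < n" "j \<le> n"
  shows "g j \<in> \<Gamma>" "inV (g j) (y j)" "y j \<in> hyp3"
proof -
  have *: "g j \<in> \<Gamma> \<and> inV (g j) (y j)"
  proof (cases "j < n")
    case True
    then have "R (y j) (y (Suc j)) (g j) (g (Suc j))" using assms by (simp add: flat_def)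
    then show ?thesis using R_inV by blast
  next
    case False
    then obtain m where m: "j = Suc m" "m < n" using assms by (cases j) auto
    then have "R (y m) (y j) (g m) (g j)" using assms by (simp add: flat_def)
    then show ?thesis using R_inV by blast
  qed
  then show "g j \<in> \<Gamma>" "inV (g j) (y j)" "y j \<in> hyp3" by (simp_all add: inV_def)
qed

lemma flat_small:
  assumes "flat n y g" "0 < n" "\<And>j. j \<le> n \<Longrightarrow> hyp3_dist (y 0) (y j) < \<epsilon>"
  shows "R (y 0) (y n) (g 0) (g n)"
  using assms
proof (induction n)
  case (Suc n)
  show ?case
  proof (cases "n = 0")
    case True then show ?thesis using Suc.prems by (simp add: flat_def)
  next
    case False
    have "R (y 0) (y n) (g 0) (g n)" using Suc False by (simp add: flat_def)
    moreover have "R (y n) (y (Suc n)) (g n) (g (Suc n))" using Suc.prems by (simp add: flat_def)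
    ultimately show ?thesis using R_trans Suc.prems(3)[of n] Suc.prems(3)[of "Suc n"] by simp
  qed
qed simp

lemma R_same: "R p p g h \<Longrightarrow> sim g h p"
  unfolding R_def using sim_trans by blast

text \<open>Raising contracts hyperbolic distances, so every loop shrinks to a small one.\<close>

lemma flat_loop:
  assumes "flat n y g" "0 < n" "y n = y 0" "\<delta> > 0"
    "\<And>j i. j \<le> n \<Longrightarrow> hyp3_dist (raise (real i * \<delta>) (y j)) (raise (real (Suc i) * \<delta>) (y j)) < \<epsilon> / 2"
    "\<And>j. j \<le> n \<Longrightarrow> hyp3_dist (raise (real M * \<delta>) (y 0)) (raise (real M * \<delta>) (y j)) < \<epsilon>"
  shows "sim (g 0) (g n) (y 0)"
  using assms
proof (induction M arbitrary: y g)
  case 0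
  have "hyp3_dist (y 0) (y j) < \<epsilon>" if "j \<le> n" for j
    using 0(6)[OF that] by (simp add: raise_def)
  then have "R (y 0) (y n) (g 0) (g n)"
    using flat_small[OF 0(1,2)] by blast
  then show ?case using R_same 0 by simp
next
  case (Suc M)
  define y' where "y' = (\<lambda>j. raise \<delta> (y j))"
  note yh = flat_inV(3,1,2)[OF Suc.prems(1,2)]
  have up: "hyp3_dist (y j) (y' j) < \<epsilon> / 2" if "j \<le> n" for j
    using Suc.prems(5)[OF that, of 0] by (simp add: y'_def raise_def)
  have y'h: "y' j \<in> hyp3" if "j \<le> n" for j using yh[OF that] \<open>\<delta> > 0\<close> by (simp add: y'_def raise_hyp3)
  have ry: "raise (real i * \<delta>) (y' j) = raise (real (Suc i) * \<delta>) (y j)" for i j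
    by (simp add: y'_def raise_def algebra_simps)
  \<comment> \<open>Every sheet is transported one level up. The squares between the two levels
    close by \<open>R_square\<close>, which makes the raised chain flat again.\<close>
  have "\<exists>h. R (y j) (y' j) (g j) h" if "j \<le> n" for j
  proof -
    have "hyp3_dist (y j) (y' j) < \<epsilon>" using up[OF that] eps by simp
    then show ?thesis using R_exists[of "g j" "y j" "y' j"] yh[OF that] y'h[OF that] by metis
  qed
  then obtain g' where g': "\<And>j. j \<le> n \<Longrightarrow> R (y j) (y' j) (g j) (g' j)" by metis
  have step: "hyp3_dist (y' j) (y' (Suc j)) < \<epsilon> / 2" if "j < n" for j
  proof -
    have "hyp3_dist (y' j) (y' (Suc j)) \<le> hyp3_dist (y j) (y (Suc j))"
      unfolding y'_def using that yh(1) \<open>\<delta> > 0\<close> by (intro hyp3_dist_raise) auto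
    also have "\<dots> < \<epsilon> / 2" using Suc.prems(1) that by (simp add: flat_def)
    finally show ?thesis .
  qed
  have F: "flat n y' g'"
    unfolding flat_def
  proof (intro allI impI conjI)
    fix j assume j: "j < n"
    show "hyp3_dist (y' j) (y' (Suc j)) < \<epsilon> / 2" using step[OF j] .
    have d1: "hyp3_dist (y j) (y (Suc j)) < \<epsilon> / 2" using Suc.prems(1) j by (simp add: flat_def)
    have "hyp3_dist (y' j) (y (Suc j)) \<le> hyp3_dist (y' j) (y j) + hyp3_dist (y j) (y (Suc j))"
      using j by (intro hyp3_dist_triangle) (auto simp: yh y'h)
    then have "hyp3_dist (y' j) (y (Suc j)) < \<epsilon>" 
      using d1 up[of j] j by (simp add: hyp3_dist_sym[of "y' j" "y j"])
    moreover have "R (y j) (y (Suc j)) (g j) (g (Suc j))" using Suc.prems(1) j by (simp add: flat_def)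
    moreover have "R (y j) (y' j) (g j) (g' j)" "R (y (Suc j)) (y' (Suc j)) (g (Suc j)) (g' (Suc j))"
      using g' j by auto
    moreover have "hyp3_dist (y j) (y' j) < \<epsilon>" "hyp3_dist (y' j) (y' (Suc j)) < \<epsilon>"
      using up[of j] step[OF j] j eps by auto
    ultimately show "R (y' j) (y' (Suc j)) (g' j) (g' (Suc j))" using R_square by blast
  qed
  have "sim (g' 0) (g' n) (y' 0)"
  proof (rule Suc.IH)
    show "flat n y' g'" by (rule F)
    show "0 < n" "0 < \<delta>" "y' n = y' 0" using Suc.prems by (auto simp: y'_def)
    show "hyp3_dist (raise (real i * \<delta>) (y' j)) (raise (real (Suc i) * \<delta>) (y' j)) < \<epsilon> / 2" if "j \<le> n" for j i
      unfolding ry using Suc.prems(5)[OF that] .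
    show "hyp3_dist (raise (real M * \<delta>) (y' 0)) (raise (real M * \<delta>) (y' j)) < \<epsilon>" if "j \<le> n" for j
      unfolding ry using Suc.prems(6)[OF that] .
  qed
  \<comment> \<open>The result at the upper level is carried down the vertical edge over the base
    point, which both ends of the chain share.\<close>
  moreover have "R (y' 0) (y 0) (g' 0) (g 0)" using R_sym[OF g'[of 0]] by simp
  moreover have "R (y' 0) (y 0) (g' n) (g n)" using R_sym[OF g'[of n]] Suc.prems(3) by (simp add: y'_def)
  ultimately show ?case using R_unique by blast
qed

lemma raise_step:
  assumes "p \<in> hyp3" "\<delta> > 0" "i \<ge> 0" "e > 0" "\<delta> \<le> snd p * e"
  shows "chd (raise (real i * \<delta>) p) (raise (real (Suc i) * \<delta>) p) \<le> 1 + e\<^sup>2 / 2"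
proof -
  define t where "t = snd p + real i * \<delta>"
  have p: "snd p > 0" using assms by (simp add: hyp3_def)
  have t: "t > 0" "snd p \<le> t" using p assms by (auto simp: t_def intro: add_pos_nonneg)
  have "chd (raise (real i * \<delta>) p) (raise (real (Suc i) * \<delta>) p) = 1 + \<delta>\<^sup>2 / (2 * t * (t + \<delta>))"
  proof -
    have "snd (raise (real (Suc i) * \<delta>) p) = t + \<delta>" "snd (raise (real i * \<delta>) p) = t" 
         "fst (raise (real (Suc i) * \<delta>) p) = fst (raise (real i * \<delta>) p)"
      by (auto simp: raise_def t_def algebra_simps)
    moreover have "(t\<^sup>2 + (t + \<delta>)\<^sup>2) / (2 * t * (t + \<delta>)) = 1 + \<delta>\<^sup>2 / (2 * t * (t + \<delta>))"
      using t \<open>\<delta> > 0\<close> by (simp add: divide_simps) (simp add: power2_eq_square algebra_simps)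
    ultimately show ?thesis by (simp only: chd_def) simp
  qed
  also have "\<delta>\<^sup>2 / (2 * t * (t + \<delta>)) \<le> (t * e)\<^sup>2 / (2 * t * t)"
  proof (rule frac_le)
    have "snd p * e \<le> t * e" using t assms by simp
    then have "\<delta> \<le> t * e" using assms by linarith
    then show "\<delta>\<^sup>2 \<le> (t * e)\<^sup>2" using assms by (intro power_mono) auto
  qed (use t assms in auto)
  also have "(t * e)\<^sup>2 / (2 * t * t) = e\<^sup>2 / 2" using t by (simp add: power2_eq_square)
  finally show ?thesis by simp
qed

lemma chd_raise:
  assumes "p \<in> hyp3" "q \<in> hyp3" "s > 0"
  shows "chd (raise s p) (raise s q) \<le> 1 + (dist p q)\<^sup>2 / (2 * s * s)"
proof -
  have "chd (raise s p) (raise s q) = 1 + (dist (raise s p) (raise s q))\<^sup>2 / (2 * snd (raise s p) * snd (raise s q))"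
    using assms by (simp add: chd_eq raise_hyp3)
  also have "\<dots> = 1 + (dist p q)\<^sup>2 / (2 * (snd p + s) * (snd q + s))"
    by (simp add: raise_def dist_prod_def dist_real_def)
  also have "\<dots> \<le> 1 + (dist p q)\<^sup>2 / (2 * s * s)"
    using assms by (intro add_left_mono divide_left_mono mult_mono mult_pos_pos) (auto simp: hyp3_def)
  finally show ?thesis .
qed

lemma flat_loop':
  assumes "flat n y g" "y n = y 0" "g 0 = 1"
  shows "g n \<in> T"
proof (cases "n = 0")
  case True
  then show ?thesis using assms one_T by simp
next
  case False
  then have n: "0 < n" by simp
  note yh = flat_inV(3)[OF assms(1) n]
  \<comment> \<open>The relative size of a vertical step: by \<open>raise_step\<close>, steps of at
    most \<open>e\<close> times the height have \<open>chd\<close> at most 1 + e^2 / 2, which is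
    less than cosh (\<epsilon> / 2).\<close>
  define e where "e = sqrt (cosh (\<epsilon> / 2) - 1)"
  have c: "cosh (\<epsilon> / 2) > 1" "cosh \<epsilon> > 1"
    using eps cosh_real_strict_mono[of 0 "\<epsilon> / 2"] cosh_real_strict_mono[of 0 "\<epsilon>"] by auto
  have e: "e > 0" "1 + e\<^sup>2 / 2 < cosh (\<epsilon> / 2)" using c by (auto simp: e_def field_simps)
  define m where "m = Min ((\<lambda>j. snd (y j)) ` {..n})"
  have m: "m > 0" using yh by (auto simp: m_def hyp3_def)
  have m_le: "m \<le> snd (y j)" if "j \<le> n" for j using that by (auto simp: m_def)
  define \<delta> where "\<delta> = m * e"
  have \<delta>: "\<delta> > 0" using m e by (simp add: \<delta>_def)
  define D where "D = Max ((\<lambda>j. dist (y 0) (y j)) ` {..n})"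
  have D: "dist (y 0) (y j) \<le> D" if "j \<le> n" for j using that by (auto simp: D_def)
  \<comment> \<open>After raising by \<open>s\<close>, points at Euclidean distance at most
    \<open>D\<close> are less than \<open>\<epsilon>\<close> apart. The summand 1 keeps
    \<open>s\<close> positive when \<open>D\<close> is 0.\<close>
  define s where "s = sqrt (1 + D\<^sup>2 / (cosh \<epsilon> - 1))"
  have s1: "s \<ge> 1" using c by (simp add: s_def)
  have s: "D\<^sup>2 / (2 * s * s) < cosh \<epsilon> - 1"
  proof -
    have ss: "s * s = 1 + D\<^sup>2 / (cosh \<epsilon> - 1)" using c by (simp add: s_def)
    have "D\<^sup>2 < (cosh \<epsilon> - 1) * (s * s)"
    proof -
      have "(cosh \<epsilon> - 1) * (1 + D\<^sup>2 / (cosh \<epsilon> - 1)) = (cosh \<epsilon> - 1) + D\<^sup>2"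
        using c eps by (simp add: distrib_left)
      moreover have "(cosh \<epsilon> - 1) + D\<^sup>2 > D\<^sup>2" using c by linarith
      ultimately show ?thesis unfolding ss by linarith
    qed
    also have "\<dots> \<le> (cosh \<epsilon> - 1) * (2 * s * s)" using c s1 by (intro mult_left_mono) auto
    finally show ?thesis using s1 by (simp add: divide_less_eq)
  qed
  obtain M where M: "s < real M * \<delta>" using \<delta> by (metis reals_Archimedean3)
  have small: "hyp3_dist p q < r" if "chd p q < cosh r" "p \<in> hyp3" "q \<in> hyp3" "r > 0" for p q r
    using that cosh_hyp3_dist[of p q] cosh_real_nonneg_less_iff[of "hyp3_dist p q" r] hyp3_dist_nonneg by simp
  have "sim (g 0) (g n) (y 0)"
  proof (rule flat_loop[where M = M and \<delta> = \<delta>])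
    fix j i assume j: "j \<le> n"
    have "m * e \<le> snd (y j) * e" using m_le[OF j] e by simp
    then have "chd (raise (real i * \<delta>) (y j)) (raise (real (Suc i) * \<delta>) (y j)) \<le> 1 + e\<^sup>2 / 2"
      using yh[OF j] \<delta> e by (intro raise_step) (auto simp: \<delta>_def)
    then show "hyp3_dist (raise (real i * \<delta>) (y j)) (raise (real (Suc i) * \<delta>) (y j)) < \<epsilon> / 2"
      using e yh[OF j] \<delta> eps by (intro small raise_hyp3) auto
  next
    fix j assume j: "j \<le> n"
    have Mp: "real M * \<delta> > 0" using M s1 by linarith
    have "chd (raise (real M * \<delta>) (y 0)) (raise (real M * \<delta>) (y j)) 
        \<le> 1 + (dist (y 0) (y j))\<^sup>2 / (2 * (real M * \<delta>) * (real M * \<delta>))"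
      using yh[OF j] yh[of 0] Mp by (intro chd_raise) auto
    also have "\<dots> \<le> 1 + D\<^sup>2 / (2 * s * s)"
      using D[OF j] M s1 by (intro add_left_mono frac_le power_mono mult_mono) auto
    also have "\<dots> < cosh \<epsilon>" using s by simp
    finally show "hyp3_dist (raise (real M * \<delta>) (y 0)) (raise (real M * \<delta>) (y j)) < \<epsilon>"
      using yh[OF j] yh[of 0] Mp eps by (intro small raise_hyp3) auto
  qed (use assms n \<delta> in auto)
  then show ?thesis using assms by (simp add: sim_def)
qed

definition St :: "(complex \<times> real) \<times> m2 \<Rightarrow> (complex \<times> real) \<times> m2 \<Rightarrow> bool" where
  "St = (\<lambda>(p,g) (q,h). R p q g h \<and> hyp3_dist p q < \<epsilon> / 2)"

lemma St_same: "\<lbrakk>g \<in> \<Gamma>; inV g p; inV g q; hyp3_dist p q < \<epsilon> / 2\<rbrakk> \<Longrightarrow> St (p,g) (q,g)"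
  unfolding St_def R_def using sim_refl by blast

lemma inV_1: "x \<in> V \<Longrightarrow> inV 1 x" using V_hyp3 by (auto simp: inV_def)

lemma V_chain:
  assumes "x \<in> V" "x' \<in> V" shows "St\<^sup>*\<^sup>* (x,1) (x',1)"
proof (rule connected_induction_simple[OF V_conn assms])
  fix a assume a: "a \<in> V"
  then have ah: "a \<in> hyp3" using V_hyp3 by auto
  obtain d where d: "d > 0" "\<And>q. q \<in> hyp3 \<Longrightarrow> dist a q < d \<Longrightarrow> hyp3_dist a q < \<epsilon> / 4"
    using hyp3_dist_small[OF ah, of "\<epsilon> / 4"] eps by auto
  show "\<exists>U. openin (top_of_set V) U \<and> a \<in> U \<and> (\<forall>p\<in>U. \<forall>q\<in>U. St\<^sup>*\<^sup>* (x,1) (p,1) \<longrightarrow> St\<^sup>*\<^sup>* (x,1) (q,1))"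
  proof (intro exI[of _ "V \<inter> ball a d"] conjI ballI impI)
    fix p q assume pq: "p \<in> V \<inter> ball a d" "q \<in> V \<inter> ball a d" and x: "St\<^sup>*\<^sup>* (x,1) (p,1)"
    have h: "p \<in> hyp3" "q \<in> hyp3" using pq V_hyp3 by auto
    have "hyp3_dist p q \<le> hyp3_dist p a + hyp3_dist a q" using h ah by (intro hyp3_dist_triangle)
    then have "hyp3_dist p q < \<epsilon> / 2" using d(2)[of p] d(2)[of q] h pq by (simp add: hyp3_dist_sym[of p a])
    then have "St (p,1) (q,1)" using pq by (intro St_same mgen.one inV_1) auto
    then show "St\<^sup>*\<^sup>* (x,1) (q,1)" using x by simp
  qed (use a d in \<open>auto simp: openin_open_Int\<close>)
qed simp

lemma inV_translate: 
  assumes "g \<in> \<Gamma>" "h \<in> \<Gamma>" "p \<in> hyp3"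
  shows "inV (g * h) (mob g p) \<longleftrightarrow> inV h p"
proof -
  have "mob (adj2 (g * h)) (mob g p) = mob (adj2 (g * h) * g) p" using assms by (simp add: mob_mult det2_mult)
  also have "adj2 (g * h) * g = adj2 h" using assms by (simp add: adj2_mult mult.assoc adj2_left)
  finally show ?thesis using assms by (simp add: inV_def mob_hyp3)
qed

lemma St_translate:
  assumes "St (p,h) (q,k)" "g \<in> \<Gamma>"
  shows "St (mob g p, g * h) (mob g q, g * k)"
proof -
  have s: "sim (g * a) (g * b) (mob g x)" if "sim a b x" for a b x
    using that assms(2) inV_translate[of g a x] inV_translate[of g b x] 
    by (auto simp: sim_def mgen_mult adj2_mult mult.assoc adj2_left_assoc inV_def)
  obtain m where m: "sim h m p" "sim m k q" using assms(1) by (auto simp: St_def R_def)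
  have "p \<in> hyp3" "q \<in> hyp3" using m by (auto simp: sim_def inV_def)
  then have "hyp3_dist (mob g p) (mob g q) < \<epsilon> / 2" using assms by (simp add: St_def hyp3_dist_mob)
  then show ?thesis using s[OF m(1)] s[OF m(2)] by (auto simp: St_def R_def)
qed

lemma St_translate_rtrancl:
  assumes "St\<^sup>*\<^sup>* (p,h) (q,k)" "g \<in> \<Gamma>"
  shows "St\<^sup>*\<^sup>* (mob g p, g * h) (mob g q, g * k)"
  using assms
proof (induction "(q,k)" arbitrary: q k rule: rtranclp_induct)
  case (step y)
  then show ?case using St_translate by (cases y) (metis rtranclp.rtrancl_into_rtrancl)
qed simp

text \<open>A word in the generators is a chain of tiles in which consecutive tiles overlap, and
  inside each tile points are joined by short steps because \<open>V\<close> is connected.\<close>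

lemma St_reach:
  assumes "g \<in> \<Gamma>" "x \<in> V" "inV g x'"
  shows "St\<^sup>*\<^sup>* (x,1) (x',g)"
  using assms
proof (induction arbitrary: x' rule: mgen.induct)
  case one
  then show ?case using V_chain by (simp add: inV_def)
next
  case (step g t)
  have t: "t \<in> \<Gamma>" "t \<in> T" using step mgen_base S_T by auto
  obtain w where w: "w \<in> V" "mob (adj2 t) w \<in> V" using overlap step by blast
  have wh: "w \<in> hyp3" using w V_hyp3 by auto
  have i1: "inV g (mob g w)" using inV_translate[of g 1 w] step wh w inV_1 mgen.one by auto
  have i2: "inV (g * t) (mob g w)" using inV_translate[of g t w] step wh w t by (auto simp: inV_def)
  have 1: "St\<^sup>*\<^sup>* (x,1) (mob g w, g)" using step i1 by blast
  have "sim g (g * t) (mob g w)" using step t i1 i2 by (auto simp: sim_def mgen_mult adj2_left_assoc)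
  then have "R (mob g w) (mob g w) g (g * t)" using sim_refl step(1) i1 unfolding R_def by blast
  moreover have "hyp3_dist (mob g w) (mob g w) < \<epsilon> / 2"
    using eps hyp3_dist_0_iff[of "mob g w" "mob g w"] wh step by (simp add: mob_hyp3)
  ultimately have 2: "St (mob g w, g) (mob g w, g * t)" by (simp add: St_def)
  have gt: "g * t \<in> \<Gamma>" using step t by (simp add: mgen_mult)
  have "St\<^sup>*\<^sup>* (mob (adj2 (g * t)) (mob g w), 1) (mob (adj2 (g * t)) x', 1)"
    using i2 step by (intro V_chain) (auto simp: inV_def)
  from St_translate_rtrancl[OF this gt]
  have 3: "St\<^sup>*\<^sup>* (mob g w, g * t) (x', g * t)"
    using gt i2 step by (simp add: inV_def)
  show ?case using 1 2 3 by (meson rtranclp.rtrancl_into_rtrancl rtranclp_trans)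
qed

text \<open>A chain from \<open>(x, 1)\<close> to \<open>(x, g)\<close> is closed in hyperbolic
  space. Its holonomy is trivial, so \<open>1\<close> and \<open>g\<close> belong to the same sheet
  at \<open>x\<close>, which is the assertion.\<close>

theorem tile_overlap:
  assumes "g \<in> \<Gamma>" "x \<in> V" "mob (adj2 g) x \<in> V"
  shows "g \<in> T"
proof -
  have "inV g x" using assms V_hyp3 by (auto simp: inV_def)
  then have "St\<^sup>*\<^sup>* (x,1) (x,g)" using St_reach assms by blast
  then obtain n where "(St ^^ n) (x,1) (x,g)" by (meson rtranclp_imp_relpowp)
  then obtain f where f: "f 0 = (x,1)" "f n = (x,g)" "\<And>i. i < n \<Longrightarrow> St (f i) (f (Suc i))"
    by (auto simp: relpowp_fun_conv)
  have "flat n (fst \<circ> f) (snd \<circ> f)" using f(3) by (auto simp: flat_def St_def case_prod_beta')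
  from flat_loop'[OF this] show ?thesis using f by simp
qed

text \<open>With each of its points the union of the tiles contains a ball of radius
  \<open>\<epsilon>\<close>, hence it is open and closed.\<close>

theorem tile_cover:
  assumes "p \<in> hyp3" shows "\<exists>g\<in>\<Gamma>. mob (adj2 g) p \<in> V"
proof -
  obtain v where v: "v \<in> V" using V_ne by auto
  then have vh: "v \<in> hyp3" using V_hyp3 by auto
  have "\<exists>g\<in>\<Gamma>. inV g p"
  proof (rule connected_induction_simple[OF convex_connected[OF convex_hyp3] vh assms])
    show "\<exists>g\<in>\<Gamma>. inV g v" using v inV_1 mgen.one by blast
    fix a assume a: "a \<in> hyp3"
    obtain d where d: "d > 0" "\<And>q. q \<in> hyp3 \<Longrightarrow> dist a q < d \<Longrightarrow> hyp3_dist a q < \<epsilon> / 2"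
      using hyp3_dist_small[OF a, of "\<epsilon> / 2"] eps by auto
    show "\<exists>U. openin (top_of_set hyp3) U \<and> a \<in> U \<and> 
       (\<forall>p\<in>U. \<forall>q\<in>U. (\<exists>g\<in>\<Gamma>. inV g p) \<longrightarrow> (\<exists>g\<in>\<Gamma>. inV g q))"
    proof (intro exI[of _ "hyp3 \<inter> ball a d"] conjI ballI impI)
      fix p q assume pq: "p \<in> hyp3 \<inter> ball a d" "q \<in> hyp3 \<inter> ball a d" and x: "\<exists>g\<in>\<Gamma>. inV g p"
      have h: "p \<in> hyp3" "q \<in> hyp3" using pq by auto
      have "hyp3_dist p q \<le> hyp3_dist p a + hyp3_dist a q" using h a by (intro hyp3_dist_triangle)
      then have pq': "hyp3_dist p q < \<epsilon>" using d(2)[of p] d(2)[of q] h pq by (simp add: hyp3_dist_sym[of p a])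
      obtain g where g: "g \<in> \<Gamma>" "inV g p" using x by blast
      obtain k where "sim g k p" "inV k q" using good_rep[OF g] pq' h by metis
      then show "\<exists>g\<in>\<Gamma>. inV g q" by (auto simp: sim_def)
    qed (use a d in \<open>auto simp: openin_open_Int\<close>)
  qed
  then show ?thesis by (auto simp: inV_def)
qed

end


section \<open>Nearly hexagonal lattices\<close>

text \<open>A primitive cube root of unity; 1 and \<open>om\<close> span the hexagonal lattice of
  minimal distance 1.\<close>

definition om :: complex where "om = Complex (-1/2) (sqrt 3 / 2)"

lemma cmod_om: "(cmod (of_real x + of_real y * om))\<^sup>2 = x\<^sup>2 - x * y + y\<^sup>2"
  by (simp add: cmod_power2 om_def) (simp add: power2_eq_square algebra_simps)

lemma cmod_om_ge: "cmod (of_real x + of_real y * om) \<ge> 86/100 * \<bar>y\<bar>"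
proof (rule power2_le_imp_le)
  have "x\<^sup>2 - x * y + y\<^sup>2 = (x - y/2)\<^sup>2 + 3/4 * y\<^sup>2" by (simp add: power2_eq_square algebra_simps)
  then have "(cmod (of_real x + of_real y * om))\<^sup>2 \<ge> 3/4 * y\<^sup>2" by (simp add: cmod_om)
  moreover have "(86/100 * \<bar>y\<bar>)\<^sup>2 \<le> 3/4 * y\<^sup>2" by (simp add: power_mult_distrib power2_eq_square)
  ultimately show "(86/100 * \<bar>y\<bar>)\<^sup>2 \<le> (cmod (of_real x + of_real y * om))\<^sup>2" by linarith
qed simp

text \<open>The covering radius is 1/sqrt 3. Weighted by the barycentric coordinates of a point in a
  unit triangle, the mean of its squared distances to the corners is the sum of the pairwise
  products of the weights, hence at most 1/3; so some corner is that close.\<close>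

lemma eisenstein_covering:
  fixes x y :: real
  obtains m k :: int where "cmod (of_real (x - of_int m) + of_real (y - of_int k) * om) \<le> 578/1000"
proof -
  have third: "a*b + a*c + b*c \<le> 1/3" if "a + b + c = 1" for a b c :: real
  proof -
    have "1 = (a+b+c)\<^sup>2" using that by simp
    then have "1 = a\<^sup>2 + b\<^sup>2 + c\<^sup>2 + 2 * (a*b + a*c + b*c)" by (simp add: power2_eq_square algebra_simps)
    moreover have "0 \<le> (a-b)\<^sup>2 + (a-c)\<^sup>2 + (b-c)\<^sup>2" by simp
    then have "a*b + a*c + b*c \<le> a\<^sup>2 + b\<^sup>2 + c\<^sup>2" by (simp add: power2_eq_square algebra_simps)
    ultimately have "3 * (a*b + a*c + b*c) \<le> 1" by argo
    then show ?thesis by (simp add: field_simps)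
  qed
  have key: "\<exists>i j::int. (x - of_int i)\<^sup>2 - (x - of_int i) * (y - of_int j) + (y - of_int j)\<^sup>2 \<le> 1/3"
    if "0 \<le> y" "y \<le> x" "x \<le> 1" for x y :: real
  proof -
    define q where "q = (\<lambda>(i::int) (j::int). (x - of_int i)\<^sup>2 - (x - of_int i) * (y - of_int j) + (y - of_int j)\<^sup>2)"
    have "(1 - x) * q 0 0 + (x - y) * q 1 0 + y * q 1 1 = (1-x)*(x-y) + (1-x)*y + (x-y)*y"
      by (simp add: q_def power2_eq_square algebra_simps)
    also have "\<dots> \<le> 1/3" by (rule third) simp
    finally have le: "(1 - x) * q 0 0 + (x - y) * q 1 0 + y * q 1 1 \<le> 1/3" .
    have "q 0 0 \<le> 1/3 \<or> q 1 0 \<le> 1/3 \<or> q 1 1 \<le> 1/3"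
    proof (rule ccontr)
      assume n: "\<not> ?thesis"
      define r where "r = min (q 0 0) (min (q 1 0) (q 1 1))"
      have r: "r > 1/3" using n by (auto simp: r_def)
      have "(1 - x) * r + (x - y) * r + y * r \<le> (1 - x) * q 0 0 + (x - y) * q 1 0 + y * q 1 1"
        using that by (intro add_mono mult_left_mono) (auto simp: r_def)
      then show False using le r by (simp add: algebra_simps)
    qed
    then show ?thesis unfolding q_def by blast
  qed
  define x' y' where "x' = frac x" and "y' = frac y"
  have r: "0 \<le> x'" "x' \<le> 1" "0 \<le> y'" "y' \<le> 1" by (auto simp: x'_def y'_def frac_lt_1 less_imp_le)
  have "\<exists>i j::int. (x' - of_int i)\<^sup>2 - (x' - of_int i) * (y' - of_int j) + (y' - of_int j)\<^sup>2 \<le> 1/3"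
  proof (cases "y' \<le> x'")
    case True then show ?thesis using key r by blast
  next
    case False
    then obtain i j :: int where "(y' - of_int i)\<^sup>2 - (y' - of_int i) * (x' - of_int j) + (x' - of_int j)\<^sup>2 \<le> 1/3"
      using key[of x' y'] r by auto
    then show ?thesis by (intro exI[of _ j] exI[of _ i]) (simp add: algebra_simps)
  qed
  then obtain i j :: int where ij: "(x' - of_int i)\<^sup>2 - (x' - of_int i) * (y' - of_int j) + (y' - of_int j)\<^sup>2 \<le> 1/3" by blast
  have e: "x - of_int (\<lfloor>x\<rfloor> + i) = x' - of_int i" "y - of_int (\<lfloor>y\<rfloor> + j) = y' - of_int j"
    by (auto simp: x'_def y'_def frac_def)
  have "(cmod (of_real (x - of_int (\<lfloor>x\<rfloor> + i)) + of_real (y - of_int (\<lfloor>y\<rfloor> + j)) * om))\<^sup>2 \<le> (578/1000)\<^sup>2"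
    unfolding cmod_om e using ij by (simp add: power2_eq_square)
  then have "cmod (of_real (x - of_int (\<lfloor>x\<rfloor> + i)) + of_real (y - of_int (\<lfloor>y\<rfloor> + j)) * om) \<le> 578/1000"
    by (rule power2_le_imp_le) simp
  then show thesis using that by blast
qed

text \<open>The squared length is an integer, and 158/100 is below sqrt 3, the second smallest
  distance in the lattice.\<close>

lemma eisenstein_short:
  fixes m k :: int
  assumes "cmod (of_int m + of_int k * om) \<le> 158/100"
  shows "(m,k) \<in> {(0,0),(1,0),(-1,0),(0,1),(0,-1),(1,1),(-1,-1)}"
proof -
  have "(cmod (of_real (of_int m) + of_real (of_int k) * om))\<^sup>2 \<le> (158/100)\<^sup>2"
    using assms by (intro power_mono) auto
  then have "real_of_int (m\<^sup>2 - m*k + k\<^sup>2) < 3" unfolding cmod_om by (simp add: power2_eq_square)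
  then have q: "m\<^sup>2 - m*k + k\<^sup>2 < 3" by linarith
  have "(2*m - k)\<^sup>2 + 3 * k\<^sup>2 < 12" "(2*k - m)\<^sup>2 + 3 * m\<^sup>2 < 12"
    using q by (simp_all add: power2_eq_square algebra_simps)
  moreover have "0 \<le> (2*m - k)\<^sup>2" "0 \<le> (2*k - m)\<^sup>2" by simp_all
  ultimately have "3 * k\<^sup>2 < 12" "3 * m\<^sup>2 < 12" by linarith+
  then have "k\<^sup>2 < 2\<^sup>2" "m\<^sup>2 < 2\<^sup>2" by simp_all
  then have "\<bar>k\<bar> < 2" "\<bar>m\<bar> < 2" by (metis abs_numeral power2_less_imp_less abs_ge_zero power2_abs zero_le_numeral)+
  then have "k \<in> {-1,0,1}" "m \<in> {-1,0,1}" by auto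
  then show ?thesis using q by (auto simp: power2_eq_square)
qed

text \<open>Four rows make up one period \<open>v - 2 * u\<close>. The offset by one is due to the
  choice of row 1 as the row that passes near 0.\<close>

locale hex_lattice =
  fixes u v :: complex and b :: "nat \<Rightarrow> complex"
  assumes u: "u \<noteq> 0"
    and v: "cmod ((v - 2 * u) / u - 4 * om) \<le> 1/100"
    and b: "j < 4 \<Longrightarrow> cmod (b j / u - (of_nat j - 1) * om) \<le> 1/100"
begin

definition lam :: "int \<Rightarrow> int \<Rightarrow> complex" where
  "lam m k = of_int m * u + of_int (k div 4) * (v - 2 * u) + b (nat (k mod 4))"

text \<open>The deviation from the ideal lattice accumulates with the number of periods, so it is
  bounded for differences of nearby rows, wherever they are, and not for positions.\<close>

lemma lam_diff:
  "cmod ((lam m' k' - lam m k) / u - (of_int (m' - m) + of_int (k' - k) * om))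
     \<le> 1/100 * (\<bar>of_int (k' div 4 - k div 4)\<bar> + 2)"
proof -
  define n n' j j' where "n = k div 4" and "n' = k' div 4" and "j = nat (k mod 4)" and "j' = nat (k' mod 4)"
  have j: "j < 4" "j' < 4" and k: "k = 4 * n + int j" "k' = 4 * n' + int j'"
    by (auto simp: j_def j'_def n_def n'_def nat_less_iff)
  define dv db db' where "dv = (v - 2 * u) / u - 4 * om" and "db = b j / u - (of_nat j - 1) * om"
    and "db' = b j' / u - (of_nat j' - 1) * om"
  have "(lam m' k' - lam m k) / u - (of_int (m' - m) + of_int (k' - k) * om)
      = of_int (n' - n) * dv + (db' - db)"
    unfolding lam_def n_def[symmetric] n'_def[symmetric] j_def[symmetric] j'_def[symmetric]
    using u by (simp add: k dv_def db_def db'_def field_simps)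
  also have "cmod \<dots> \<le> \<bar>of_int (n' - n)\<bar> * cmod dv + (cmod db' + cmod db)"
    by (metis norm_triangle_mono norm_mult norm_of_int norm_triangle_ineq4 order_refl)
  also have "\<dots> \<le> \<bar>of_int (n' - n)\<bar> * (1/100) + (1/100 + 1/100)"
    using v b[OF j(1)] b[OF j(2)] unfolding dv_def db_def db'_def by (intro add_mono mult_left_mono) auto
  finally show ?thesis by (simp add: n_def n'_def)
qed

lemma lam_near:
  assumes "cmod ((lam m' k' - lam m k) / u) \<le> 155/100"
  shows "(m' - m, k' - k) \<in> {(0,0),(1,0),(-1,0),(0,1),(0,-1),(1,1),(-1,-1)}"
proof -
  define E where "E = complex_of_int (m' - m) + of_int (k' - k) * om"
  define K where "K = \<bar>real_of_int (k' - k)\<bar>"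
  have aux: "4 * \<bar>n' - n\<bar> \<le> \<bar>l' - l\<bar> + 3"
    if "l = 4 * n + r" "l' = 4 * n' + r'" "0 \<le> r" "r < 4" "0 \<le> r'" "r' < 4" for n n' r r' l l' :: int
  proof -
    have r: "\<bar>r' - r\<bar> \<le> 3" using that by (simp add: abs_le_iff)
    have "4 * \<bar>n' - n\<bar> = \<bar>4 * (n' - n)\<bar>" by (simp only: abs_mult abs_numeral)
    also have "4 * (n' - n) = (l' - l) - (r' - r)" using that by simp
    also have "\<bar>\<dots>\<bar> \<le> \<bar>l' - l\<bar> + \<bar>r' - r\<bar>" by (rule abs_triangle_ineq4)
    finally show ?thesis using r by simp
  qed
  have "4 * \<bar>k' div 4 - k div 4\<bar> \<le> \<bar>k' - k\<bar> + 3"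
    by (rule aux[of _ _ "k mod 4" _ _ "k' mod 4"]) simp_all
  then have "real_of_int (4 * \<bar>k' div 4 - k div 4\<bar>) \<le> real_of_int (\<bar>k' - k\<bar> + 3)" 
    by (simp only: of_int_le_iff)
  then have n: "\<bar>real_of_int (k' div 4 - k div 4)\<bar> \<le> (K + 3) / 4" unfolding K_def by simp
  have "cmod E \<le> cmod ((lam m' k' - lam m k) / u) + cmod ((lam m' k' - lam m k) / u - E)"
    by (metis norm_triangle_sub norm_minus_commute add.commute)
  also have "\<dots> \<le> 155/100 + 1/100 * ((K + 3) / 4 + 2)"
  proof -
    have "cmod ((lam m' k' - lam m k) / u - E) \<le> 1/100 * (\<bar>of_int (k' div 4 - k div 4)\<bar> + 2)"
      unfolding E_def by (rule lam_diff)
    also have "\<dots> \<le> 1/100 * ((K + 3) / 4 + 2)" using n by (intro mult_left_mono add_right_mono) auto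
    finally show ?thesis using assms by (intro add_mono)
  qed
  finally have E1: "cmod E \<le> 155/100 + 1/100 * ((K + 3) / 4 + 2)" .
  moreover have "86/100 * K \<le> cmod E"
    using cmod_om_ge[of "of_int (k' - k)" "of_int (m' - m)"] by (simp add: E_def K_def)
  \<comment> \<open>The imaginary part alone bounds the difference of rows; this bounds the
    accumulated error and only then the whole vector \<open>E\<close>.\<close>
  ultimately have "86/100 * K \<le> 155/100 + 1/100 * ((K + 3) / 4 + 2)" by (rule order_trans[rotated])
  then have "K < 2" by (simp add: field_simps)
  then have "real_of_int \<bar>k' - k\<bar> < real_of_int 2" by (simp add: K_def)
  then have "\<bar>k' - k\<bar> < 2" by (simp only: of_int_less_iff)
  then have "real_of_int \<bar>k' - k\<bar> \<le> real_of_int 1" by (simp only: of_int_le_iff)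
  then have "K \<le> 1" by (simp add: K_def)
  then have "cmod E \<le> 158/100" using E1 by (simp add: field_simps)
  then show ?thesis unfolding E_def by (rule eisenstein_short)
qed

lemma lam_cover: obtains m k where "cmod ((lam m k - w) / u) \<le> 62/100"
proof -
  define \<tau> where "\<tau> = (v - 2 * u) / u"
  have \<tau>: "cmod (\<tau> - 4 * om) \<le> 1/100" using v by (simp add: \<tau>_def)
  have "\<bar>Im (\<tau> - 4 * om)\<bar> \<le> 1/100" using \<tau> abs_Im_le_cmod order_trans by blast
  moreover have "Im (\<tau> - 4 * om) = Im \<tau> - 2 * sqrt 3" by (simp add: om_def)
  moreover have "sqrt 3 > 1" by simp
  ultimately have It: "Im \<tau> > 0" by linarith
  \<comment> \<open>Coordinates with respect to the true periods \<open>u\<close> and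
    \<open>\<tau> * u\<close>. Only the fractional part of \<open>Y\<close> is compared with the
    ideal lattice, so no error accumulates.\<close>
  define Y where "Y = Im (w / u) / Im \<tau>"
  define X where "X = Re (w / u) - Y * Re \<tau>"
  have w: "w / u = of_real X + of_real Y * \<tau>"
    using It by (simp add: complex_eq_iff X_def Y_def)
  define n y where "n = \<lfloor>Y\<rfloor>" and "y = frac Y"
  have y: "0 \<le> y" "y < 1" "Y = of_int n + y" by (simp_all add: n_def y_def frac_lt_1) (simp add: frac_def)
  obtain m K :: int where mK: "cmod (of_real (X - of_int m) + of_real (4 * y - of_int K) * om) \<le> 578/1000"
    using eisenstein_covering by blast
  have "86/100 * \<bar>4 * y - of_int K\<bar> \<le> 578/1000" using cmod_om_ge mK order_trans by blast
  then have "\<bar>4 * y - of_int K\<bar> < 1" by simp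
  then have "real_of_int K > -1" "real_of_int K < 5" using y by linarith+
  then have K: "0 \<le> K" "K \<le> 4" by linarith+
  \<comment> \<open>\<open>K + 1\<close> undoes the offset of the rows; \<open>c\<close> is 1 when
    the nearest row already belongs to the next period.\<close>
  define c j where "c = (K + 1) div 4" and "j = nat ((K + 1) mod 4)"
  have cj: "K + 1 = 4 * c + int j" "j < 4" "0 \<le> c" "c \<le> 1" using K by (auto simp: c_def j_def nat_less_iff)
  define k where "k = 4 * n + (K + 1)"
  have k: "k div 4 = n + c" "nat (k mod 4) = j" by (auto simp: k_def c_def j_def)
  have cK: "of_int K = 4 * complex_of_int c + of_nat j - 1"
    using arg_cong[OF cj(1), of complex_of_int] by (simp add: algebra_simps)
  define db where "db = b j / u - (of_nat j - 1) * om"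
  have "(lam m k - w) / u = of_int m + of_int (n + c) * \<tau> + b j / u - w / u"
    using u by (simp add: lam_def k \<tau>_def field_simps)
  also have "\<dots> = - (of_real (X - of_int m) + of_real (4 * y - of_int K) * om) + (of_real (of_int c - y) * (\<tau> - 4 * om) + db)"
    by (simp add: w y(3) cK db_def algebra_simps)
  also have "cmod \<dots> \<le> 578/1000 + (\<bar>of_int c - y\<bar> * cmod (\<tau> - 4 * om) + cmod db)"
  proof -
    have "cmod (- A + (of_real r * T + D)) \<le> cmod A + (\<bar>r\<bar> * cmod T + cmod D)" for A T D :: complex and r
      using norm_triangle_ineq[of "- A" "of_real r * T + D"] norm_triangle_ineq[of "of_real r * T" D]
      by (simp add: norm_mult)
    from this[of "of_real (X - of_int m) + of_real (4 * y - of_int K) * om" "of_int c - y" "\<tau> - 4 * om" db]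
    show ?thesis using mK by linarith
  qed
  also have "\<dots> \<le> 578/1000 + (1 * (1/100) + 1/100)"
    using \<tau> b[OF cj(2)] cj y by (intro add_mono mult_mono) (auto simp: db_def)
  finally show thesis by (intro that[of m k]) simp
qed

end

section \<open>Overlaps of tubes\<close>

text \<open>A tube whose axis runs from \<open>\<alpha>\<close> to \<open>\<alpha> (1 - \<theta>)\<close>, with the radius fixed by \<open>\<kappa> = 2 / e\<^sup>2\<close>,
  is close to a horoball of Euclidean diameter \<open>\<surd>2 e \<bar>\<alpha>\<bar>\<close> based at \<open>\<alpha>\<close>.\<close>

lemma tube_near:
  fixes z \<alpha> \<theta> :: complex and t e :: real
  assumes e: "0 < e" "e \<le> 1/100" and t: "t > 0" and \<alpha>: "\<alpha> \<noteq> 0" and \<theta>: "cmod \<theta> \<le> 101/100 * e\<^sup>2"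
    and lt: "((cmod (z - \<alpha>))\<^sup>2 + t\<^sup>2) * ((cmod (z - \<alpha> * (1 - \<theta>)))\<^sup>2 + t\<^sup>2) < 2 / e\<^sup>2 * t\<^sup>2 * (cmod \<alpha>)\<^sup>2 * (cmod \<theta>)\<^sup>2"
  shows "cmod (z - \<alpha>) < 73/100 * e * cmod \<alpha>"
proof -
  define r where "r = e * cmod \<alpha>"
  have r: "r > 0" using e \<alpha> by (simp add: r_def)
  define A where "A = min (cmod (z - \<alpha>)) (cmod (z - \<alpha> * (1 - \<theta>)))"
  have A0: "A \<ge> 0" by (simp add: A_def)
  have "(A\<^sup>2 + t\<^sup>2) * (A\<^sup>2 + t\<^sup>2) \<le> ((cmod (z - \<alpha>))\<^sup>2 + t\<^sup>2) * ((cmod (z - \<alpha> * (1 - \<theta>)))\<^sup>2 + t\<^sup>2)"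
    using A0 t by (intro mult_mono add_mono power_mono) (auto simp: A_def)
  also note lt
  also have "2 / e\<^sup>2 * t\<^sup>2 * (cmod \<alpha>)\<^sup>2 * (cmod \<theta>)\<^sup>2 \<le> 2 / e\<^sup>2 * t\<^sup>2 * (cmod \<alpha>)\<^sup>2 * (101/100 * e\<^sup>2)\<^sup>2"
    using \<theta> by (intro mult_left_mono power_mono) auto
  also have "\<dots> = 2 * (101/100)\<^sup>2 * r\<^sup>2 * t\<^sup>2"
    using e by (simp add: r_def power2_eq_square field_simps)
  \<comment> \<open>1429/1000 is slightly more than 101/100 times sqrt 2.\<close>
  also have "\<dots> \<le> (1429/1000)\<^sup>2 * r\<^sup>2 * t\<^sup>2" 
    by (intro mult_right_mono) (auto simp: power2_eq_square)
  also have "\<dots> = (1429/1000 * r * t)\<^sup>2" by (simp only: power_mult_distrib)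
  finally have "(A\<^sup>2 + t\<^sup>2)\<^sup>2 < (1429/1000 * r * t)\<^sup>2" by (simp add: power2_eq_square)
  then have "A\<^sup>2 + t\<^sup>2 < 1429/1000 * r * t" 
    by (rule power_less_imp_less_base) (use r t in auto)
  \<comment> \<open>Completing the square: the inequality for \<open>A\<close> and \<open>t\<close>
    describes a ball that touches the boundary plane, and half of 1429/1000 is its relative
    radius.\<close>
  moreover have "0 \<le> (t - 7145/10000 * r)\<^sup>2" by simp
  ultimately have "A\<^sup>2 < (7145/10000 * r)\<^sup>2" by (simp add: power2_eq_square algebra_simps)
  then have A1: "A < 7145/10000 * r" by (rule power_less_imp_less_base) (use r in auto)
  have "cmod (z - \<alpha>) \<le> cmod (z - \<alpha> * (1 - \<theta>)) + cmod (\<alpha> * \<theta>)"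
    using norm_triangle_ineq4[of "z - \<alpha> * (1 - \<theta>)" "\<alpha> * \<theta>"] by (simp add: algebra_simps)
  then have "cmod (z - \<alpha>) \<le> A + cmod (\<alpha> * \<theta>)" by (simp add: A_def min_def)
  also have "cmod (\<alpha> * \<theta>) \<le> cmod \<alpha> * (101/100 * e\<^sup>2)" unfolding norm_mult using \<theta> by (intro mult_left_mono) auto
  also have "\<dots> = 101/100 * e * r" by (simp add: r_def power2_eq_square)
  also have "\<dots> \<le> 101/10000 * r" using e r by simp
  finally show ?thesis using A1 r by (simp add: r_def)
qed

text \<open>Between the tubes of sizes 95/100 and 1 about the vertical axis the height is about r /
  sqrt 2. This is the height of the centre of the neighbouring horoball, whose horizontal radius
  there is about r / sqrt 2, clearly above 654/1000 r. The factor 95/100 in the conclusion is the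
  margin that later yields a uniform \<open>\<epsilon>\<close>.\<close>

lemma tube_cover:
  fixes z \<alpha> \<theta> :: complex and t e :: real
  assumes e: "0 < e" "e \<le> 1/100" and t: "t > 0" and \<alpha>: "\<alpha> \<noteq> 0" and \<theta>: "99/100 * e\<^sup>2 \<le> cmod \<theta>" "cmod \<theta> \<le> 101/100 * e\<^sup>2"
    and V: "(cmod z)\<^sup>2 + t\<^sup>2 < 2 / e\<^sup>2 * t\<^sup>2" and not: "(cmod z)\<^sup>2 + t\<^sup>2 \<ge> 95/100 * (2 / e\<^sup>2) * t\<^sup>2"
    and near: "cmod (z - \<alpha>) \<le> 654/1000 * e * cmod \<alpha>"
  shows "((cmod (z - \<alpha>))\<^sup>2 + t\<^sup>2) * ((cmod (z - \<alpha> * (1 - \<theta>)))\<^sup>2 + t\<^sup>2) \<le> 95/100 * (2 / e\<^sup>2) * t\<^sup>2 * (cmod \<alpha>)\<^sup>2 * (cmod \<theta>)\<^sup>2"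
proof -
  define r where "r = e * cmod \<alpha>"
  have r: "r > 0" using e \<alpha> by (simp add: r_def)
  define s where "s = (t / r)\<^sup>2"
  have ts: "t\<^sup>2 = s * r\<^sup>2" using r by (simp add: s_def power_divide)
  have s0: "s > 0" using t r by (simp add: s_def)
  have W: "cmod (z - \<alpha> * (1 - \<theta>)) \<le> 6645/10000 * r"
  proof -
    have "cmod (z - \<alpha> * (1 - \<theta>)) \<le> cmod (z - \<alpha>) + cmod (\<alpha> * \<theta>)"
      using norm_triangle_ineq[of "z - \<alpha>" "\<alpha> * \<theta>"] by (simp add: algebra_simps)
    also have "cmod (\<alpha> * \<theta>) \<le> cmod \<alpha> * (101/100 * e\<^sup>2)" unfolding norm_mult using \<theta> by (intro mult_left_mono) auto
    also have "\<dots> = 101/100 * e * r" by (simp add: r_def power2_eq_square)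
    also have "\<dots> \<le> 101/10000 * r" using e r by simp
    finally show ?thesis using near r by (simp add: r_def)
  qed
  have za: "\<bar>cmod z - cmod \<alpha>\<bar> \<le> 654/100000 * cmod \<alpha>"
  proof -
    have "\<bar>cmod z - cmod \<alpha>\<bar> \<le> cmod (z - \<alpha>)" by (rule norm_triangle_ineq3)
    also have "\<dots> \<le> 654/1000 * e * cmod \<alpha>" by (rule near)
    also have "\<dots> \<le> 654/1000 * (1/100) * cmod \<alpha>" using e by (intro mult_right_mono mult_left_mono) auto
    finally show ?thesis by simp
  qed
  define Q where "Q = (cmod z / cmod \<alpha>)\<^sup>2"
  have zQ: "(cmod z)\<^sup>2 = Q * (cmod \<alpha>)\<^sup>2" using \<alpha> by (simp add: Q_def power_divide)
  have q: "99346/100000 \<le> cmod z / cmod \<alpha>" "cmod z / cmod \<alpha> \<le> 100654/100000"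
  proof -
    have "99346/100000 * cmod \<alpha> \<le> cmod z" "cmod z \<le> 100654/100000 * cmod \<alpha>"
      using za by linarith+
    then show "99346/100000 \<le> cmod z / cmod \<alpha>" "cmod z / cmod \<alpha> \<le> 100654/100000" 
      using \<alpha> by (simp_all add: pos_le_divide_eq pos_divide_le_eq)
  qed
  have Q1: "98696/100000 \<le> Q"
  proof -
    have "98696/100000 \<le> (99346/100000 :: real)\<^sup>2" by (simp add: power2_eq_square)
    also have "\<dots> \<le> Q" unfolding Q_def using q by (intro power_mono) auto
    finally show ?thesis .
  qed
  have Q2: "Q \<le> 10132/10000"
  proof -
    have "Q \<le> (100654/100000 :: real)\<^sup>2" unfolding Q_def using q by (intro power_mono) auto
    also have "\<dots> \<le> 10132/10000" by (simp add: power2_eq_square)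
    finally show ?thesis .
  qed
  have rr: "r\<^sup>2 = e\<^sup>2 * (cmod \<alpha>)\<^sup>2" by (simp add: r_def power_mult_distrib)
  have a2: "(cmod \<alpha>)\<^sup>2 > 0" using \<alpha> by simp
  have e2: "e\<^sup>2 > 0" "e\<^sup>2 \<le> 1/10000" using e power_mono[of e "1/100" 2] by (auto simp: power2_eq_square)
  have "Q * (cmod \<alpha>)\<^sup>2 + s * e\<^sup>2 * (cmod \<alpha>)\<^sup>2 < 2 * s * (cmod \<alpha>)\<^sup>2"
    using V e2 unfolding zQ ts rr by simp
  then have "(cmod \<alpha>)\<^sup>2 * (Q + s * e\<^sup>2) < (cmod \<alpha>)\<^sup>2 * (2 * s)" by (simp add: algebra_simps)
  then have "Q + s * e\<^sup>2 < 2 * s" using a2 by simp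
  then have "Q < 2 * s" using s0 e2 by (smt (verit) mult_nonneg_nonneg)
  then have s1: "4934/10000 \<le> s" using Q1 by simp
  have "19/10 * s * (cmod \<alpha>)\<^sup>2 \<le> Q * (cmod \<alpha>)\<^sup>2 + s * e\<^sup>2 * (cmod \<alpha>)\<^sup>2"
    using not e2 unfolding zQ ts rr by simp
  then have "(cmod \<alpha>)\<^sup>2 * (19/10 * s) \<le> (cmod \<alpha>)\<^sup>2 * (Q + s * e\<^sup>2)" by (simp add: algebra_simps)
  then have "19/10 * s \<le> Q + s * e\<^sup>2" using a2 by simp
  also have "\<dots> \<le> 10132/10000 + s * (1/10000)" using Q2 e2 s0 by (intro add_mono mult_left_mono) auto
  finally have s2: "s \<le> 5334/10000" by simp
  have "((cmod (z - \<alpha>))\<^sup>2 + t\<^sup>2) * ((cmod (z - \<alpha> * (1 - \<theta>)))\<^sup>2 + t\<^sup>2) 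
      \<le> ((6645/10000 * r)\<^sup>2 + s * r\<^sup>2) * ((6645/10000 * r)\<^sup>2 + s * r\<^sup>2)"
    unfolding ts using near W r s0 by (intro mult_mono add_mono power_mono add_nonneg_nonneg) (auto simp: r_def)
  also have "\<dots> = r^4 * ((6645/10000)\<^sup>2 + s)\<^sup>2" by (simp add: power2_eq_square power4_eq_xxxx algebra_simps)
  also have "\<dots> \<le> r^4 * (19/10 * (99/100)\<^sup>2 * s)"
  proof (rule mult_left_mono)
    \<comment> \<open>On the interval of possible \<open>s\<close> the square is below its chord,
      which leaves a linear inequality.\<close>
    have "(s - 4934/10000) * (5334/10000 - s) \<ge> 0" using s1 s2 by simp
    then have "s * s \<le> (4934/10000 + 5334/10000) * s - 4934/10000 * (5334/10000)" by (simp add: algebra_simps)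
    then show "((6645/10000)\<^sup>2 + s)\<^sup>2 \<le> 19/10 * (99/100)\<^sup>2 * s"
      using s1 s2 by (simp add: power2_eq_square algebra_simps)
  qed (use r in simp)
  also have "\<dots> = 95/100 * (2 / e\<^sup>2) * t\<^sup>2 * (cmod \<alpha>)\<^sup>2 * (99/100 * e\<^sup>2)\<^sup>2"
    unfolding ts r_def using e by (simp add: power2_eq_square power4_eq_xxxx field_simps)
  also have "\<dots> \<le> 95/100 * (2 / e\<^sup>2) * t\<^sup>2 * (cmod \<alpha>)\<^sup>2 * (cmod \<theta>)\<^sup>2"
    using \<theta> e by (intro mult_left_mono power_mono) auto
  finally show ?thesis .
qed

lemma exp_near:
  assumes "cmod w \<le> 1/30" shows "cmod (exp w - 1 - w) \<le> 36/1000 * cmod w"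
proof -
  have "exp \<bar>Re w\<bar> \<le> exp (1/30)" using assms abs_Re_le_cmod[of w] by simp
  also have "\<dots> \<le> 1 + 2 * (1/30)" using exp_bound_lemma[of "1/30 :: real"] by simp
  finally have "exp \<bar>Re w\<bar> \<le> 107/100" by simp
  have "cmod (exp w - (\<Sum>k\<le>1. w ^ k / fact k)) \<le> exp \<bar>Re w\<bar> * cmod w ^ Suc 1 / fact 1"
    by (rule Taylor_exp)
  then have "cmod (exp w - 1 - w) \<le> exp \<bar>Re w\<bar> * (cmod w * cmod w)"
    by (simp add: power2_eq_square algebra_simps)
  also have "\<dots> \<le> 107/100 * (1/30 * cmod w)"
    using assms \<open>exp \<bar>Re w\<bar> \<le> 107/100\<close> by (intro mult_mono) auto
  also have "\<dots> \<le> 36/1000 * cmod w" by simp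
  finally show ?thesis .
qed

lemma near_Ln:
  assumes e: "0 < e" "e \<le> 1/100" and "\<alpha> \<noteq> 0" "\<alpha>' \<noteq> 0"
    and n: "cmod (z - \<alpha>) < 73/100 * e * cmod \<alpha>" "cmod (z - \<alpha>') < 73/100 * e * cmod \<alpha>'"
  shows "cmod (Ln (\<alpha>' / \<alpha>)) \<le> 155/100 * e"
proof -
  define X where "X = cmod (\<alpha>' / \<alpha> - 1)"
  have X: "cmod (\<alpha>' - \<alpha>) = X * cmod \<alpha>" unfolding X_def
    unfolding norm_mult[symmetric] using assms by (simp add: left_diff_distrib)
  have a': "cmod \<alpha>' \<le> cmod \<alpha> + X * cmod \<alpha>" using norm_triangle_ineq[of \<alpha> "\<alpha>' - \<alpha>"] X by simp
  have "X * cmod \<alpha> \<le> cmod (z - \<alpha>) + cmod (z - \<alpha>')" 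
    using norm_triangle_ineq4[of "z - \<alpha>" "z - \<alpha>'"] X by simp
  also have "\<dots> \<le> 73/100 * e * cmod \<alpha> + 73/100 * e * cmod \<alpha>'" using n by simp
  also have "\<dots> \<le> 73/100 * e * cmod \<alpha> + 73/100 * e * (cmod \<alpha> + X * cmod \<alpha>)"
    using a' e by (intro add_left_mono mult_left_mono) auto
  also have "\<dots> = cmod \<alpha> * (146/100 * e + 73/100 * e * X)" by (simp add: field_simps)
  finally have "cmod \<alpha> * X \<le> cmod \<alpha> * (146/100 * e + 73/100 * e * X)" by (simp add: mult.commute)
  then have X1: "X \<le> 146/100 * e + 73/100 * e * X" using assms by simp
  have X0: "X \<ge> 0" by (simp add: X_def)
  have "e * X \<le> 1/100 * X" using e X0 by (intro mult_right_mono) auto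
  then have X2: "X \<le> 1472/1000 * e" using X1 e by simp
  \<comment> \<open>A crude bound, used only to enter the range of \<open>exp_near\<close>, which
    gives the sharp one.\<close>
  have "cmod (Ln (1 + (\<alpha>' / \<alpha> - 1))) \<le> 2 * X" unfolding X_def
    using X2 e by (intro norm_Ln_le) (simp add: X_def)
  then have L: "cmod (Ln (\<alpha>' / \<alpha>)) \<le> 2 * X" by simp
  define w where "w = Ln (\<alpha>' / \<alpha>)"
  have ew: "exp w = \<alpha>' / \<alpha>" using assms by (simp add: w_def)
  have "cmod w \<le> 1/30" using L X2 e by (simp add: w_def)
  from exp_near[OF this] have "cmod (exp w - 1 - w) \<le> 36/1000 * cmod w" .
  moreover have "cmod w \<le> cmod (exp w - 1) + cmod (exp w - 1 - w)"
    using norm_triangle_ineq4[of "exp w - 1" "exp w - 1 - w"] by simp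
  ultimately have "cmod w \<le> X + 36/1000 * cmod w" by (simp add: ew X_def)
  then show ?thesis using X2 e by (simp add: w_def)
qed

lemma near_exp:
  assumes e: "0 < e" "e \<le> 1/100" and w: "cmod w \<le> 62/100 * e"
  shows "cmod (z - z * exp w) \<le> 654/1000 * e * cmod (z * exp w)"
proof -
  have "cmod (- w) \<le> 1/30" using assms by simp
  from exp_near[OF this] have "cmod (exp (- w) - 1 - (- w)) \<le> 36/1000 * cmod w" by simp
  then have "cmod (exp (- w) - 1) \<le> 36/1000 * cmod w + cmod w"
    using norm_triangle_ineq[of "exp (- w) - 1 - (- w)" "- w"] by simp
  also have "\<dots> \<le> 654/1000 * e" using w e by simp
  finally have 1: "cmod (exp (- w) - 1) \<le> 654/1000 * e" .
  have "z - z * exp w = z * exp w * (exp (- w) - 1)" by (simp add: exp_minus field_simps)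
  then show ?thesis using mult_left_mono[OF 1, of "cmod (z * exp w)"] by (simp add: norm_mult mult_ac)
qed


section \<open>Representations of the figure-eight knot group\<close>

definition dg :: "complex \<Rightarrow> m2" where "dg c = M2 c 0 0 (1 / c)"

lemma dg_mult: "dg a * dg b = dg (a * b)" by (simp add: dg_def)
lemma dg_1 [simp]: "dg 1 = 1" by (simp add: dg_def one_m2_def)
lemma det_dg: "a \<noteq> 0 \<Longrightarrow> det2 (dg a) = 1" by (simp add: dg_def)
lemma adj_dg: "a \<noteq> 0 \<Longrightarrow> adj2 (dg a) = dg (1 / a)" by (simp add: dg_def)

text \<open>Riley's family of representations: the meridian is diag(M, W), and the matrix with rows
  (a, b) and (a, d), normalised to send infinity to 1, conjugates it to the second generator. The
  equation for \<open>\<zeta>\<close>, that is \<zeta> + 1/\<zeta> = M^2 + W^2 - 1, is the Riley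
  equation of the figure-eight knot.\<close>

context
  fixes a b d M W \<zeta> \<delta> :: complex
  assumes MW: "M * W = 1" and \<delta>: "\<delta> = M - W" "\<delta> \<noteq> 0"
    and a: "a * \<delta> = M\<^sup>2 - \<zeta>" and d: "d * \<delta> = \<zeta> - W\<^sup>2" and det: "a * d - b * a = 1"
    and \<zeta>: "\<zeta>\<^sup>2 + 1 = (M\<^sup>2 + W\<^sup>2 - 1) * \<zeta>"
begin

lemma MW': "M * (W * x) = x" by (simp add: MW mult.assoc[symmetric])
lemma zz: "\<zeta> * \<zeta> = M * M * \<zeta> + W * W * \<zeta> - \<zeta> - 1"
  using \<zeta> by (simp add: power2_eq_square algebra_simps eq_diff_eq)
lemma zz': "\<zeta> * (\<zeta> * x) = (M * M * \<zeta> + W * W * \<zeta> - \<zeta> - 1) * x"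
  by (simp add: zz mult.assoc[symmetric])

text \<open>Normal forms modulo \<open>M * W = 1\<close> and the quadratic equation of
  \<open>\<zeta>\<close>. They decide identities once factors \<open>\<delta>\<close> have turned
  the matrix entries into polynomials.\<close>

lemmas reduce = MW MW' zz zz' power2_eq_square power4_eq_xxxx algebra_simps

lemma fig8_ad: "a * d * \<delta>\<^sup>2 = \<zeta>"
proof -
  have "a * d * \<delta>\<^sup>2 = (a * \<delta>) * (d * \<delta>)" by (simp add: power2_eq_square)
  also have "\<dots> = (M\<^sup>2 - \<zeta>) * (\<zeta> - W\<^sup>2)" by (simp only: a d)
  also have "\<dots> = \<zeta>" by (simp add: reduce)
  finally show ?thesis .
qed

lemma fig8_ba: "b * a * \<delta>\<^sup>2 = \<zeta> - \<delta>\<^sup>2"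
proof -
  have "b * a = a * d - (a * d - b * a)" by simp
  then have "b * a = a * d - 1" by (simp only: det)
  then show ?thesis using fig8_ad by (simp add: left_diff_distrib)
qed

lemma fig8_p: "(a*d*M - b*a*W) * \<delta> = \<zeta> + 1 - W\<^sup>2" 
proof -
  have "\<delta> * ((a*d*M - b*a*W) * \<delta>) = (a * d * \<delta>\<^sup>2) * M - (b * a * \<delta>\<^sup>2) * W" by (simp add: power2_eq_square algebra_simps)
  also have "\<dots> = \<delta> * (\<zeta> + 1 - W\<^sup>2)" unfolding fig8_ad fig8_ba unfolding \<delta>(1) by (simp add: reduce)
  finally show ?thesis using \<delta>(2) by simp
qed

lemma fig8_q: "(a*d*W - b*a*M) * \<delta> = M\<^sup>2 - 1 - \<zeta>" 
proof -
  have "\<delta> * ((a*d*W - b*a*M) * \<delta>) = (a * d * \<delta>\<^sup>2) * W - (b * a * \<delta>\<^sup>2) * M" by (simp add: power2_eq_square algebra_simps)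
  also have "\<dots> = \<delta> * (M\<^sup>2 - 1 - \<zeta>)" unfolding fig8_ad fig8_ba unfolding \<delta>(1) by (simp add: reduce)
  finally show ?thesis using \<delta>(2) by simp
qed

text \<open>For the meridian x, the conjugator y and z = y x y^-1 this says y = x^-1 z x z^-1 x.
  With w = x^-1 z x z^-1 it becomes the two-bridge relation w x = z w.\<close>

lemma fig8_relation:
  "M2 W 0 0 M * (M2 a b a d * M2 M 0 0 W * M2 d (-b) (-a) a) * M2 M 0 0 W
       = M2 a b a d * M2 W 0 0 M * (M2 a b a d * M2 M 0 0 W * M2 d (-b) (-a) a)"
proof -
  define p q where "p = a*d*M - b*a*W" and "q = a*d*W - b*a*M"
  note pq = fig8_p[folded p_def] fig8_q[folded q_def]
  have cancel: "x = y" if "\<delta> * x = \<delta> * y" for x y using that \<delta>(2) by simp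
  have s: "M2 a b a d * M2 M 0 0 W * M2 d (-b) (-a) a = M2 p (- a*b*\<delta>) (a*d*\<delta>) q"
    unfolding p_def q_def \<delta>(1) by (simp add: algebra_simps)
  have 1: "p = a*W*p + b*M*(a*d*\<delta>)"
  proof (rule cancel, rule cancel)
    have "\<delta> * (\<delta> * (a*W*p + b*M*(a*d*\<delta>))) = (a * \<delta>) * W * (p * \<delta>) + (b * a * \<delta>\<^sup>2) * M * (d * \<delta>)" by (simp add: power2_eq_square algebra_simps)
    also have "\<dots> = \<delta> * (\<zeta> + 1 - W\<^sup>2)" unfolding a d pq fig8_ba unfolding \<delta>(1) by (simp add: reduce)
    also have "\<dots> = \<delta> * (\<delta> * p)" by (simp add: pq(1)[symmetric])
    finally show "\<delta> * (\<delta> * p) = \<delta> * (\<delta> * (a*W*p + b*M*(a*d*\<delta>)))" by (rule sym)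
  qed
  have 2: "- (W * a*b*\<delta> * W) = - (a*W*(a*b*\<delta>)) + b*M*q"
  proof -
    have "- (W * a*\<delta> * W) = - (a*W*(a*\<delta>)) + M*q" 
    proof (rule cancel)
      have "\<delta> * (- (a*W*(a*\<delta>)) + M*q) = - ((a*\<delta>)*W*(a*\<delta>)) + M*(q*\<delta>)" by (simp add: power2_eq_square algebra_simps)
      also have "\<dots> = - \<delta> * W\<^sup>2 * (M\<^sup>2 - \<zeta>)" unfolding a pq unfolding \<delta>(1) by (simp add: reduce)
      also have "\<dots> = \<delta> * (- (W * a*\<delta> * W))" unfolding a[symmetric] by (simp add: power2_eq_square algebra_simps)
      finally show "\<delta> * (- (W * a*\<delta> * W)) = \<delta> * (- (a*W*(a*\<delta>)) + M*q)" by simp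
    qed
    from arg_cong[OF this, of "times b"] show ?thesis by (simp add: algebra_simps)
  qed
  have 3: "M * (a*d*\<delta>) * M = a*W*p + d*M*(a*d*\<delta>)"
  proof -
    have "M * (d*\<delta>) * M = W*p + d*M*(d*\<delta>)" 
    proof (rule cancel)
      have "\<delta> * (W*p + d*M*(d*\<delta>)) = W*(p*\<delta>) + (d*\<delta>)*M*(d*\<delta>)" by (simp add: power2_eq_square algebra_simps)
      also have "\<dots> = \<delta> * M\<^sup>2 * (\<zeta> - W\<^sup>2)" unfolding d pq unfolding \<delta>(1) by (simp add: reduce)
      also have "\<dots> = \<delta> * (M * (d*\<delta>) * M)" unfolding d[symmetric] by (simp add: power2_eq_square algebra_simps)
      finally show "\<delta> * (M * (d*\<delta>) * M) = \<delta> * (W*p + d*M*(d*\<delta>))" by (rule sym)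
    qed
    from arg_cong[OF this, of "times a"] show ?thesis by (simp add: algebra_simps)
  qed
  have 4: "q = - (a*W*(a*b*\<delta>)) + d*M*q"
  proof (rule cancel, rule cancel)
    have "\<delta> * (\<delta> * (- (a*W*(a*b*\<delta>)) + d*M*q)) = - ((a*\<delta>)*W*(b*a*\<delta>\<^sup>2)) + (d*\<delta>)*M*(q*\<delta>)" by (simp add: power2_eq_square algebra_simps)
    also have "\<dots> = \<delta> * (M\<^sup>2 - 1 - \<zeta>)" unfolding a d pq fig8_ba unfolding \<delta>(1) by (simp add: reduce)
    also have "\<dots> = \<delta> * (\<delta> * q)" by (simp add: pq(2)[symmetric])
    finally show "\<delta> * (\<delta> * q) = \<delta> * (\<delta> * (- (a*W*(a*b*\<delta>)) + d*M*q))" by (rule sym)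
  qed
  have e1: "W * p * M = p" "M * q * W = q" using MW by algebra+
  have 2: "- (W * (a*b*\<delta>) * W) = b*M*q - a*W*(a*b*\<delta>)" using 2 by (simp add: mult.assoc)
  show ?thesis unfolding s unfolding M2_mult m2.inject using 1 2 3 4 e1 by simp
qed

text \<open>Solved for the last factor, this is the longitude z^-1 x^2 y^-1 x^-1 y, a diagonal
  matrix with eigenvalue \<open>L\<close>.\<close>

lemma fig8_longitude:
  assumes L: "L * (1 - M\<^sup>2 * \<zeta>) = \<zeta> - M\<^sup>2" "L * K = 1"
  shows "M2 d (-b) (-a) a * M2 W 0 0 M * M2 a b a d
       = M2 W 0 0 M * M2 W 0 0 M * (M2 a b a d * M2 M 0 0 W * M2 d (-b) (-a) a) * M2 L 0 0 K"
proof -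
  define p q where "p = a*d*M - b*a*W" and "q = a*d*W - b*a*M"
  note pq = fig8_p[folded p_def] fig8_q[folded q_def]
  have cancel: "x = y" if "\<delta> * x = \<delta> * y" for x y using that \<delta>(2) by simp
  \<comment> \<open>The equation of \<open>L\<close> in terms of the matrix entries; all four
    entries of the relation reduce to it.\<close>
  have e: "a = M\<^sup>2 * (d * L)" 
  proof (rule cancel)
    have "\<delta> * (M\<^sup>2 * (d * L)) = M\<^sup>2 * (d * \<delta>) * L" by (simp add: power2_eq_square algebra_simps)
    also have "\<dots> = - (L * (1 - M\<^sup>2 * \<zeta>))" unfolding d by (simp add: reduce)
    also have "\<dots> = M\<^sup>2 - \<zeta>" by (simp add: L(1))
    finally show "\<delta> * a = \<delta> * (M\<^sup>2 * (d * L))" using a by (simp add: mult.commute)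
  qed
  have "a * K = M\<^sup>2 * d * (L * K)" by (subst e) (simp add: mult_ac)
  then have e': "a * K = M\<^sup>2 * d" by (simp add: L(2))
  have "\<zeta> \<noteq> 0" using \<zeta> by auto
  then have d0: "d * \<delta> \<noteq> 0" using fig8_ad \<delta>(2) by auto
  have 1: "q = W\<^sup>2 * p * L"
  proof (rule cancel)
    have "(d * \<delta>) * (\<delta> * (W\<^sup>2 * p * L)) = W^4 * ((M\<^sup>2 * (d * L)) * \<delta>) * (p * \<delta>)" by (simp add: reduce)
    also have "\<dots> = W^4 * (a * \<delta>) * (p * \<delta>)" by (simp only: e[symmetric])
    also have "\<dots> = (d * \<delta>) * (q * \<delta>)" unfolding a d pq by (simp add: reduce)
    finally show "\<delta> * q = \<delta> * (W\<^sup>2 * p * L)" using d0 by (auto simp: mult.assoc)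
  qed
  have 4: "p = M\<^sup>2 * q * K"
  proof -
    have "M\<^sup>2 * q * K = (M * W)\<^sup>2 * p * (L * K)" unfolding 1 by (simp add: power2_eq_square mult_ac)
    then show ?thesis by (simp add: MW L(2))
  qed
  have 2: "d*b*W - b*d*M = W\<^sup>2 * (- a*b*\<delta>) * K" 
  proof -
    have "W\<^sup>2 * (- a*b*\<delta>) * K = - (W\<^sup>2 * b * \<delta> * (a * K))" by simp
    also have "\<dots> = - ((M * W)\<^sup>2 * b * \<delta> * d)" unfolding e' by (simp add: power2_eq_square mult_ac)
    finally show ?thesis by (simp add: MW \<delta>(1) algebra_simps)
  qed
  have 3: "a*a*M - a*a*W = M\<^sup>2 * (a*d*\<delta>) * L" 
  proof -
    have "M\<^sup>2 * (a*d*\<delta>) * L = a * \<delta> * (M\<^sup>2 * (d * L))" by simp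
    also have "\<dots> = a * \<delta> * a" by (simp only: e[symmetric])
    finally show ?thesis by (simp add: \<delta>(1) algebra_simps)
  qed
  have s: "M2 a b a d * M2 M 0 0 W * M2 d (-b) (-a) a = M2 p (- a*b*\<delta>) (a*d*\<delta>) q"
    unfolding p_def q_def \<delta>(1) by (simp add: algebra_simps)
  have l: "M2 d (-b) (-a) a * M2 W 0 0 M * M2 a b a d = M2 q (d*b*W - b*d*M) (a*a*M - a*a*W) p"
    unfolding p_def q_def by (simp add: algebra_simps)
  show ?thesis unfolding s l using 1 2 3 4 by (simp add: power2_eq_square mult.assoc)
qed

end


section \<open>Distance to an axis\<close>

definition Fq :: "complex \<times> real \<Rightarrow> real" where "Fq p = hform 1 0 p * hform 0 1 p"

lemma Fq_eq: "Fq p = ((cmod (fst p))\<^sup>2 + (snd p)\<^sup>2) / (snd p)\<^sup>2"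
  by (simp add: Fq_def hform_def power2_eq_square)

text \<open>\<open>A\<close> maps \<open>\<infinity>\<close> to \<open>\<alpha>\<close> and 0 to \<open>\<alpha> (1 - \<theta>)\<close>.\<close>

definition axis :: "m2 \<Rightarrow> complex \<Rightarrow> complex \<Rightarrow> bool" where
  "axis A \<alpha> \<theta> \<longleftrightarrow> m11 A = \<alpha> * m21 A \<and> m12 A = \<alpha> * (1 - \<theta>) * m22 A \<and> m21 A * m22 A * \<alpha> * \<theta> = 1"

lemma axis_dg_left: "h \<noteq> 0 \<Longrightarrow> axis A \<alpha> \<theta> \<Longrightarrow> axis (dg h * A) (h\<^sup>2 * \<alpha>) \<theta>"
  by (cases A) (auto simp: axis_def dg_def power2_eq_square mult.assoc)

lemma axis_adj2:
  assumes "axis A \<alpha> \<theta>" "det2 A = 1" 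
  shows "m11 A * m22 A * \<theta> = 1"
  using assms by (simp add: axis_def mult_ac)

text \<open>The rows of \<open>adj2 A\<close> are linear forms that vanish at the two ends of the
  axis, so each factor of \<open>Fq\<close> measures the distance to one end.\<close>

lemma Fq_axis:
  assumes "axis A \<alpha> \<theta>" "det2 A = 1" "p \<in> hyp3"
  shows "Fq (mob (adj2 A) p) = ((cmod (fst p - \<alpha>))\<^sup>2 + (snd p)\<^sup>2) * ((cmod (fst p - \<alpha> * (1 - \<theta>)))\<^sup>2 + (snd p)\<^sup>2)
     / ((snd p)\<^sup>2 * (cmod \<alpha>)\<^sup>2 * (cmod \<theta>)\<^sup>2)"
proof -
  obtain z t where p: "p = (z,t)" by (cases p)
  define c d where "c = m21 A" and "d = m22 A"
  have ax: "m11 A = \<alpha> * c" "m12 A = \<alpha> * (1 - \<theta>) * d" "c * d * \<alpha> * \<theta> = 1"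
    using assms by (auto simp: axis_def c_def d_def)
  have t: "t > 0" using assms p by (simp add: hyp3_def)
  have n: "\<alpha> \<noteq> 0" "\<theta> \<noteq> 0" using ax by auto
  have cd: "cmod c * cmod d = 1 / (cmod \<alpha> * cmod \<theta>)"
    using arg_cong[OF ax(3), of cmod] n by (simp add: norm_mult field_simps)
  have m: "m11 (adj2 A) = d" "m12 (adj2 A) = - (\<alpha> * (1 - \<theta>) * d)" "m21 (adj2 A) = - c" "m22 (adj2 A) = \<alpha> * c"
    by (simp_all add: adj2_def c_def d_def ax(1,2)[unfolded c_def d_def])
  have "hform 1 0 (mob (adj2 A) p) = (cmod d)\<^sup>2 * ((cmod (z - \<alpha> * (1 - \<theta>)))\<^sup>2 + t\<^sup>2) / t"
  proof -
    have "d * z + - (\<alpha> * (1 - \<theta>) * d) = d * (z - \<alpha> * (1 - \<theta>))" by (simp add: algebra_simps)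
    then have "cmod (d * z + - (\<alpha> * (1 - \<theta>) * d)) = cmod d * cmod (z - \<alpha> * (1 - \<theta>))" by (simp only: norm_mult)
    moreover have "hform 1 0 (mob (adj2 A) p) = hform d (- (\<alpha> * (1 - \<theta>) * d)) p"
      using assms(2,3) by (simp add: hform_mob m)
    ultimately show ?thesis
      by (simp add: hform_def p power_mult_distrib distrib_left)
  qed
  moreover have "hform 0 1 (mob (adj2 A) p) = (cmod c)\<^sup>2 * ((cmod (z - \<alpha>))\<^sup>2 + t\<^sup>2) / t"
  proof -
    have "- c * z + \<alpha> * c = - (c * (z - \<alpha>))" by (simp add: algebra_simps)
    then have "cmod (- c * z + \<alpha> * c) = cmod c * cmod (z - \<alpha>)" by (simp only: norm_mult norm_minus_cancel)
    moreover have "hform 0 1 (mob (adj2 A) p) = hform (- c) (\<alpha> * c) p"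
      using assms(2,3) by (simp add: hform_mob m)
    ultimately show ?thesis
      by (simp add: hform_def p power_mult_distrib distrib_left)
  qed
  ultimately have "Fq (mob (adj2 A) p) = (cmod c * cmod d)\<^sup>2 * (((cmod (z - \<alpha>))\<^sup>2 + t\<^sup>2) * ((cmod (z - \<alpha> * (1 - \<theta>)))\<^sup>2 + t\<^sup>2)) / t\<^sup>2"
    by (simp add: Fq_def power2_eq_square mult_ac)
  then show ?thesis using t n unfolding cd p by (simp add: power_divide power_mult_distrib field_simps)
qed

lemma Fq_dg:
  assumes "h \<noteq> 0" "p \<in> hyp3"
  shows "Fq (mob (dg h) p) = Fq p"
proof -
  have "hform 1 0 (mob (dg h) p) * hform 0 1 (mob (dg h) p) = hform h 0 p * hform 0 (1 / h) p"
    using assms by (simp add: hform_mob det_dg) (simp add: dg_def)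
  also have "hform h 0 p = (cmod h)\<^sup>2 * hform 1 0 p" 
    by (simp add: hform_def norm_mult power_mult_distrib distrib_left)
  also have "hform 0 (1 / h) p = hform 0 1 p / (cmod h)\<^sup>2" 
    by (simp add: hform_def norm_divide power_divide)
  also have "(cmod h)\<^sup>2 * hform 1 0 p * (hform 0 1 p / (cmod h)\<^sup>2) = hform 1 0 p * hform 0 1 p"
    using assms by simp
  finally show ?thesis by (simp add: Fq_def)
qed

text \<open>\<open>Fq p\<close> is the squared hyperbolic cosine of the distance to the vertical axis over 0.\<close>

lemma Fq_chd:
  assumes "p \<in> hyp3" "r > 0"
  shows "Fq p \<le> (chd p (0, r))\<^sup>2"
proof -
  have t: "snd p > 0" using assms by (simp add: hyp3_def)
  define X where "X = (cmod (fst p))\<^sup>2 + (snd p)\<^sup>2"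
  have "4 * X * r\<^sup>2 \<le> (X + r\<^sup>2)\<^sup>2"
    using zero_le_power2[of "X - r\<^sup>2"] by (simp add: power2_eq_square algebra_simps)
  then have "X / (snd p)\<^sup>2 \<le> (X + r\<^sup>2)\<^sup>2 / (2 * snd p * r)\<^sup>2"
    using t assms by (simp add: field_simps)
  then show ?thesis by (simp add: Fq_eq chd_def X_def power_divide)
qed

text \<open>The nearest point of the vertical axis lies on the Euclidean sphere about 0 through
  \<open>p\<close>.\<close>

lemma Fq_chd_eq:
  assumes "p \<in> hyp3"
  obtains r where "r > 0" "Fq p = (chd p (0, r))\<^sup>2"
proof -
  have t: "snd p > 0" using assms by (simp add: hyp3_def)
  define X where "X = (cmod (fst p))\<^sup>2 + (snd p)\<^sup>2"
  have X: "X > 0" using t by (simp add: X_def add_nonneg_pos)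
  have "chd p (0, sqrt X) = 2 * X / (2 * snd p * sqrt X)"
    using X by (simp add: chd_def X_def)
  also have "\<dots> = sqrt X / snd p" using X t by (simp add: field_simps)
  finally have "(chd p (0, sqrt X))\<^sup>2 = Fq p" using X by (simp add: power_divide Fq_eq X_def)
  then show thesis using that[of "sqrt X"] X by simp
qed

text \<open>The distance to the axis grows by at most the distance \<open>D\<close> of the points,
  and cosh (D + D') is at most exp D times cosh D'.\<close>

lemma Fq_lipschitz:
  assumes "p \<in> hyp3" "q \<in> hyp3"
  shows "Fq q \<le> (exp (hyp3_dist p q))\<^sup>2 * Fq p"
proof -
  obtain r where r: "r > 0" "Fq p = (chd p (0, r))\<^sup>2" using Fq_chd_eq assms by blast
  have o: "(0, r) \<in> hyp3" using r by (simp add: hyp3_def)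
  define D D' where "D = hyp3_dist p q" and "D' = hyp3_dist p (0, r)"
  have D: "D \<ge> 0" "D' \<ge> 0" using hyp3_dist_nonneg assms o by (auto simp: D_def D'_def)
  have "hyp3_dist q (0,r) \<le> D + D'"
    using hyp3_dist_triangle[OF assms(2,1) o] by (simp add: D_def D'_def hyp3_dist_sym[of q p])
  then have "chd q (0,r) \<le> cosh (D + D')" using hyp3_dist_le_iff[OF assms(2) o] D by simp
  also have "\<dots> \<le> exp D * cosh D'"
  proof -
    have "cosh (D + D') = (exp D * exp D' + exp (- D) * exp (- D')) / 2"
      by (simp add: cosh_field_def exp_add exp_diff exp_minus field_simps)
    also have "\<dots> \<le> (exp D * exp D' + exp D * exp (- D')) / 2"
      using D by (intro divide_right_mono add_left_mono mult_right_mono) auto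
    finally show ?thesis by (simp add: cosh_field_def algebra_simps)
  qed
  also have "cosh D' = chd p (0,r)" using cosh_hyp3_dist[OF assms(1) o] by (simp add: D'_def)
  finally have "chd q (0,r) \<le> exp D * chd p (0,r)" .
  then have "(chd q (0,r))\<^sup>2 \<le> (exp D * chd p (0,r))\<^sup>2"
    using chd_ge_1[OF assms(2) o] by (intro power_mono) auto
  then show ?thesis using Fq_chd[OF assms(2) r(1)] r by (simp add: D_def power_mult_distrib)
qed


declare One_nat_def [simp del]

text \<open>\<open>M\<close> and \<open>L = (\<zeta> - M\<^sup>2) / (1 - M\<^sup>2 \<zeta>)\<close> are eigenvalues of the meridian and the longitude, and \<open>u\<close>, \<open>v\<close>
  are logarithms of their squares, that is, their complex translation lengths. The equation
  \<open>uv\<close> is the Dehn filling equation. The \<open>b j\<close> are logarithms of ends of four neighbouring axes.\<close>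

locale fig8 =
  fixes M \<zeta> u v :: complex and b :: "nat \<Rightarrow> complex" and N :: nat
  assumes mu: "M\<^sup>2 = exp u" and mu1: "M\<^sup>2 \<noteq> 1"
    and zeta: "\<zeta>\<^sup>2 + 1 = (M\<^sup>2 + (1/M)\<^sup>2 - 1) * \<zeta>"
    and zeta1: "\<zeta>\<^sup>2 \<noteq> 1"
    and Lv: "((\<zeta> - M\<^sup>2) / (1 - M\<^sup>2 * \<zeta>))\<^sup>2 = exp v"
    and LN: "((\<zeta> - M\<^sup>2) / (1 - M\<^sup>2 * \<zeta>)) ^ N * M = 1"
    and uv: "u + of_nat N * v = 2 * of_real pi * \<i>"
    and u0: "u \<noteq> 0" and u_small: "cmod u \<le> 1/100" and Re_v: "Re v \<noteq> 0"
    and v_near: "cmod ((v - 2 * u) / u - 4 * om) \<le> 1/100"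
    and b_near: "j < 4 \<Longrightarrow> cmod (b j / u - (of_nat j - 1) * om) \<le> 1/100"
    and theta: "99/100 * (cmod u)\<^sup>2 \<le> cmod ((M - 1/M)\<^sup>2 / \<zeta>)" "cmod ((M - 1/M)\<^sup>2 / \<zeta>) \<le> 101/100 * (cmod u)\<^sup>2"
      "99/100 * (cmod u)\<^sup>2 \<le> cmod ((M - 1/M)\<^sup>2 * \<zeta>)" "cmod ((M - 1/M)\<^sup>2 * \<zeta>) \<le> 101/100 * (cmod u)\<^sup>2"
    and exp_b: "exp (b 0) = (M\<^sup>2 * \<zeta> - 1) / \<zeta>\<^sup>2" "exp (b 1) = 1" 
      "exp (b 2) = (\<zeta> / M\<^sup>2 - 1) / \<zeta>\<^sup>2" "exp (b 3) = - (\<zeta> - 1 / M\<^sup>2)\<^sup>2 / \<zeta> * exp v"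
begin

definition "W = 1 / M"
definition "\<delta> = M - W"
definition "a = (M\<^sup>2 - \<zeta>) / \<delta>"
definition "d = (\<zeta> - W\<^sup>2) / \<delta>"
definition "b' = (a * d - 1) / a"
definition "L = (\<zeta> - M\<^sup>2) / (1 - M\<^sup>2 * \<zeta>)"
definition "y = M2 a b' a d"

lemma M0 [simp]: "M \<noteq> 0" using mu by auto
lemma MW: "M * W = 1" by (simp add: W_def)
lemma W0 [simp]: "W \<noteq> 0" by (simp add: W_def)
lemma d0 [simp]: "\<delta> \<noteq> 0" using mu1 by (auto simp: \<delta>_def W_def field_simps power2_eq_square)
lemma z0 [simp]: "\<zeta> \<noteq> 0" using zeta by auto
lemma L0 [simp]: "L \<noteq> 0" using Lv by (auto simp: L_def)
lemma a\<delta>: "a * \<delta> = M\<^sup>2 - \<zeta>" by (simp add: a_def)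
lemma d\<delta>: "d * \<delta> = \<zeta> - W\<^sup>2" by (simp add: d_def)
lemma zeta': "\<zeta>\<^sup>2 + 1 = (M\<^sup>2 + W\<^sup>2 - 1) * \<zeta>" using zeta by (simp add: W_def)

lemma ad: "a * d * \<delta>\<^sup>2 = \<zeta>"
proof -
  have "a * d * \<delta>\<^sup>2 = (a * \<delta>) * (d * \<delta>)" by (simp add: power2_eq_square)
  also have "\<dots> = (M\<^sup>2 - \<zeta>) * (\<zeta> - W\<^sup>2)" by (simp only: a\<delta> d\<delta>)
  also have "\<dots> = (M\<^sup>2 + W\<^sup>2) * \<zeta> - (M * W)\<^sup>2 - \<zeta>\<^sup>2" by (simp add: power2_eq_square algebra_simps)
  also have "\<dots> = (M\<^sup>2 + W\<^sup>2 - 1) * \<zeta> + \<zeta> - 1 - \<zeta>\<^sup>2" unfolding MW by (simp add: algebra_simps)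
  also have "\<dots> = \<zeta>" unfolding zeta'[symmetric] by simp
  finally show ?thesis .
qed

lemma a0 [simp]: "a \<noteq> 0" and dd0 [simp]: "d \<noteq> 0" using ad z0 by auto
lemma det: "a * d - b' * a = 1" by (simp add: b'_def)
lemmas f8 = MW \<delta>_def d0 a\<delta> d\<delta> det zeta'

lemma det_y [simp]: "det2 y = 1" using det by (simp add: y_def)

lemma dg_M: "dg M = M2 M 0 0 W" "dg W = M2 W 0 0 M" by (simp_all add: dg_def W_def)

text \<open>The second meridian, the element \<open>y\<close> and their inverses. They represent the
  kinds of neighbours of the tube, in the order of the rows of the hexagonal lattice.\<close>

definition s :: "nat \<Rightarrow> m2" where
  "s j = (if j = 0 then y * dg M * adj2 y else if j = 1 then y else if j = 2 then y * dg W * adj2 y else adj2 y)"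

lemma det_s [simp]: "det2 (s j) = 1" by (simp add: s_def det2_mult det_dg)

lemma s0_eq: "s 0 = M2 (a*d*M - b'*a*W) (- (a*b'*\<delta>)) (a*d*\<delta>) (a*d*W - b'*a*M)"
  by (simp add: s_def y_def dg_M \<delta>_def algebra_simps)

lemma s2_eq: "s 2 = M2 (a*d*W - b'*a*M) (a*b'*\<delta>) (- (a*d*\<delta>)) (a*d*M - b'*a*W)"
  by (simp add: s_def y_def dg_M \<delta>_def algebra_simps)

lemma adj_s0: "adj2 (s 0) = s 2" and adj_s2: "adj2 (s 2) = s 0"
  by (simp_all add: s0_eq s2_eq)
lemma adj_s1: "adj2 (s 1) = s 3" and adj_s3: "adj2 (s 3) = s 1"
  by (simp_all add: s_def)

text \<open>The image of infinity under \<open>s j\<close>, which is \<open>m11 / m21\<close>,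
  expressed by \<open>M\<close> and \<open>\<zeta>\<close> alone.\<close>

definition al :: "nat \<Rightarrow> complex" where
  "al j = (if j = 0 then (M\<^sup>2 * \<zeta> - 1) / \<zeta>\<^sup>2 else if j = 1 then 1 else if j = 2 then (\<zeta> / M\<^sup>2 - 1) / \<zeta>\<^sup>2
     else - (\<zeta> - 1 / M\<^sup>2)\<^sup>2 / \<zeta>)"

text \<open>For a matrix of determinant 1 the relative distance of the images of infinity and 0 is
  \<open>1 / (m11 * m22)\<close>.\<close>

definition th :: "nat \<Rightarrow> complex" where
  "th j = (if j = 0 \<or> j = 2 then \<delta>\<^sup>2 * \<zeta> else \<delta>\<^sup>2 / \<zeta>)"

lemma p\<delta>: "(a*d*M - b'*a*W) * \<delta> = \<zeta> + 1 - W\<^sup>2" using fig8_p[OF f8] .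
lemma q\<delta>: "(a*d*W - b'*a*M) * \<delta> = M\<^sup>2 - 1 - \<zeta>" using fig8_q[OF f8] .

lemma WM2: "W\<^sup>2 = 1 / M\<^sup>2" by (simp add: W_def power_divide)

lemma al_0: "al 0 * \<zeta> = \<zeta> + 1 - W\<^sup>2"
proof -
  have "al 0 * \<zeta> * \<zeta> = M\<^sup>2 * \<zeta> - 1" by (simp add: al_def power2_eq_square)
  also have "\<dots> = (\<zeta> + 1 - W\<^sup>2) * \<zeta>" using zeta' by (simp add: algebra_simps power2_eq_square)
  finally show ?thesis by simp
qed

lemma al_2: "al 2 * \<zeta> = - (M\<^sup>2 - 1 - \<zeta>)"
proof -
  have "al 2 * \<zeta> * \<zeta> = W\<^sup>2 * \<zeta> - 1" unfolding WM2 by (simp add: al_def power2_eq_square)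
  also have "\<dots> = - (M\<^sup>2 - 1 - \<zeta>) * \<zeta>" using zeta' by (simp add: algebra_simps power2_eq_square)
  finally show ?thesis by simp
qed

lemma al_3: "al 3 * a = - d"
proof -
  have "al 3 * \<zeta> = - ((d * \<delta>) * (d * \<delta>))" unfolding d\<delta> WM2 by (simp add: al_def power2_eq_square)
  then have "al 3 * (a * d * \<delta>\<^sup>2) = - ((d * \<delta>) * (d * \<delta>))" unfolding ad .
  then have *: "(d * \<delta>\<^sup>2) * (al 3 * a) = (d * \<delta>\<^sup>2) * (- d)" by (simp add: power2_eq_square mult_ac)
  have "d * \<delta>\<^sup>2 \<noteq> 0" by simp
  from mult_left_cancel[THEN iffD1, OF this *] show ?thesis .
qed

lemma pq: "(a*d*M - b'*a*W) * (a*d*W - b'*a*M) * (\<delta>\<^sup>2 * \<zeta>) = 1"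
proof -
  have "(a*d*M - b'*a*W) * (a*d*W - b'*a*M) * (\<delta>\<^sup>2 * \<zeta>)
    = ((a*d*M - b'*a*W) * \<delta>) * ((a*d*W - b'*a*M) * \<delta>) * \<zeta>" by (simp only: power2_eq_square mult_ac)
  also have "\<dots> = (\<zeta> + 1 - W\<^sup>2) * (M\<^sup>2 - 1 - \<zeta>) * \<zeta>" by (simp only: p\<delta> q\<delta>)
  also have "\<dots> = ((M\<^sup>2 + W\<^sup>2) * (\<zeta> + 1) - 1 - (M * W)\<^sup>2 - 2 * \<zeta> - \<zeta>\<^sup>2) * \<zeta>" 
    by (simp add: power2_eq_square algebra_simps)
  also have "\<dots> = ((M\<^sup>2 + W\<^sup>2 - 1) * \<zeta> + (M\<^sup>2 + W\<^sup>2) - 1 - \<zeta> - (\<zeta>\<^sup>2 + 1)) * \<zeta>" 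
    unfolding MW by (simp add: algebra_simps)
  also have "\<dots> = (M\<^sup>2 + W\<^sup>2 - 1) * \<zeta> - \<zeta>\<^sup>2" unfolding zeta' by (simp add: power2_eq_square algebra_simps)
  also have "\<dots> = 1" unfolding zeta'[symmetric] by simp
  finally show ?thesis .
qed

lemma axisI:
  assumes "det2 A = 1" "m21 A \<noteq> 0" "m11 A = \<alpha> * m21 A" "m11 A * m22 A * \<theta> = 1"
  shows "axis A \<alpha> \<theta>"
proof -
  have "m21 A * m12 A = m11 A * m22 A - 1" 
    using assms(1) by (simp add: det2_def algebra_simps)
  also have "\<dots> = m11 A * m22 A - m11 A * m22 A * \<theta>" by (simp only: assms(4))
  also have "\<dots> = m21 A * (\<alpha> * (1 - \<theta>) * m22 A)" unfolding assms(3) by (simp add: algebra_simps)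
  finally have "m12 A = \<alpha> * (1 - \<theta>) * m22 A" using assms(2) by simp
  moreover have "m21 A * m22 A * \<alpha> * \<theta> = 1" using assms(3,4) by (simp add: mult_ac)
  ultimately show ?thesis using assms by (simp add: axis_def)
qed

lemma axis_s:
  assumes "j < 4" shows "axis (s j) (al j) (th j)"
proof (rule axisI)
  have c: "x = y" if "\<delta> * x = \<delta> * y" for x y using that by simp
  have j: "j = 0 \<or> j = 1 \<or> j = 2 \<or> j = 3" using assms by linarith
  show "m21 (s j) \<noteq> 0" using j by (auto simp: s0_eq s2_eq) (auto simp: s_def y_def)
  have e0: "a*d*M - b'*a*W = al 0 * (a*d*\<delta>)"
  proof (rule c)
    have "\<delta> * (al 0 * (a*d*\<delta>)) = al 0 * (a*d*\<delta>\<^sup>2)" by (simp add: power2_eq_square)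
    also have "\<dots> = \<delta> * (a*d*M - b'*a*W)" unfolding ad al_0 p\<delta>[symmetric] by simp
    finally show "\<delta> * (a*d*M - b'*a*W) = \<delta> * (al 0 * (a*d*\<delta>))" by simp
  qed
  have e2: "a*d*W - b'*a*M = al 2 * (- (a*d*\<delta>))"
  proof (rule c)
    have "\<delta> * (al 2 * (- (a*d*\<delta>))) = - (al 2 * (a*d*\<delta>\<^sup>2))" by (simp add: power2_eq_square)
    also have "\<dots> = \<delta> * (a*d*W - b'*a*M)" unfolding ad al_2 q\<delta>[symmetric] by simp
    finally show "\<delta> * (a*d*W - b'*a*M) = \<delta> * (al 2 * (- (a*d*\<delta>)))" by simp
  qed
  have "d = al 3 * (- a)" using al_3 by simp
  then show "m11 (s j) = al j * m21 (s j)" using j e0 e2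
    by (elim disjE) (simp_all add: s0_eq s2_eq, simp_all add: s_def y_def al_def)
  show "m11 (s j) * m22 (s j) * th j = 1" using j pq ad
    by (elim disjE) (simp_all add: s0_eq s2_eq th_def mult_ac, simp_all add: s_def y_def mult_ac)
qed simp

text \<open>Otherwise the axis of \<open>s 0\<close> would have its end \<open>al 0\<close> at
  0.\<close>

lemma ML1: "1 - M\<^sup>2 * \<zeta> \<noteq> 0"
proof
  assume "1 - M\<^sup>2 * \<zeta> = 0"
  then have "al 0 = 0" by (simp add: al_def)
  then show False using axis_s[of 0] by (simp add: axis_def)
qed

lemma L_eq: "L * (1 - M\<^sup>2 * \<zeta>) = \<zeta> - M\<^sup>2" using ML1 by (simp add: L_def)

text \<open>The relations of the figure-eight knot group, with \<open>dg M\<close> and \<open>dg L\<close> in the roles of the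
  meridian and the longitude.\<close>

lemma rel1: "dg W * s 0 * dg M = s 1 * dg W * s 0"
  using fig8_relation[OF f8] by (simp add: s_def y_def dg_M del: M2_mult)

lemma rel2: "s 3 * dg W * s 1 = dg W * dg W * s 0 * dg L"
  using fig8_longitude[OF f8 L_eq, of "1 / L"] 
  by (simp add: s_def y_def dg_M del: M2_mult) (simp add: dg_def)

lemma s_cancel [simp]: 
  "s 0 * s 2 = 1" "s 2 * s 0 = 1" "s 1 * s 3 = 1" "s 3 * s 1 = 1"
  "s 0 * (s 2 * g) = g" "s 2 * (s 0 * g) = g" "s 1 * (s 3 * g) = g" "s 3 * (s 1 * g) = g"
  using adj2_right[OF det_s[of 0]] adj2_left[OF det_s[of 0]] adj2_right[OF det_s[of 1]] adj2_left[OF det_s[of 1]]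
    adj2_right_assoc[OF det_s[of 0]] adj2_left_assoc[OF det_s[of 0]] adj2_right_assoc[OF det_s[of 1]] adj2_left_assoc[OF det_s[of 1]]
  by (simp_all only: adj_s0 adj_s1)

lemma dg_cancel [simp]:
  "dg M * dg W = 1" "dg W * dg M = 1" "dg M * (dg W * g) = g" "dg W * (dg M * g) = g"
proof -
  show *: "dg M * dg W = 1" "dg W * dg M = 1" using MW by (simp_all add: dg_mult mult.commute)
  show "dg M * (dg W * g) = g" "dg W * (dg M * g) = g" by (simp_all add: mult.assoc[symmetric] *)
qed

lemma dgL_cancel [simp]:
  "dg L * dg (1/L) = 1" "dg (1/L) * dg L = 1" "dg L * (dg (1/L) * g) = g" "dg (1/L) * (dg L * g) = g"
proof -
  show *: "dg L * dg (1/L) = 1" "dg (1/L) * dg L = 1" by (simp_all add: dg_mult)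
  show "dg L * (dg (1/L) * g) = g" "dg (1/L) * (dg L * g) = g" by (simp_all add: mult.assoc[symmetric] * del: times_divide_eq_right)
qed

lemma dg_commute: "dg g * dg h = dg h * dg g" by (simp add: dg_mult mult.commute)

lemma adj_dg_MW [simp]: "adj2 (dg M) = dg W" "adj2 (dg W) = dg M"
  by (simp_all add: adj_dg W_def)

lemma s0_s1: "s 0 = s 1 * (dg M * s 3)" and s2_s1: "s 2 = s 1 * (dg W * s 3)"
  by (simp_all add: s_def mult.assoc)

lemma rel1': "dg W * (s 0 * dg M) = s 1 * (dg W * s 0)"
  using rel1 by (simp add: mult.assoc)

lemma rel2': "s 3 * (dg W * s 1) = dg W * (dg W * (s 0 * dg L))"
  using rel2 by (simp add: mult.assoc)

text \<open>The lemmas \<open>r0a\<close> to \<open>r3b\<close> compute the relative position of two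
  adjacent neighbours of the tube. The digit is the row of the first one; a, b and c stand for the
  lattice steps (1,0), (0,1) and (1,1). In row 3 the steps a and c are \<open>s0_s1\<close> and
  \<open>rel1'\<close>.\<close>

lemma r0c: "s 2 * (dg M * s 1) = dg M * (s 2 * dg M)"
proof -
  have "s 3 * (dg W * s 0) = s 3 * ((s 1 * (dg W * s 0)) * dg W)"
    unfolding rel1'[symmetric] by (simp add: mult.assoc)
  also have "\<dots> = dg W * (s 0 * dg W)" by (simp add: mult.assoc)
  finally show ?thesis using arg_cong[of _ _ adj2] by (metis adj2_mult adj_dg_MW adj_s0 adj_s3 mult.assoc)
qed

lemma r1a: "s 3 * (dg M * s 1) = dg (1/L) * (s 2 * (dg M * dg M))"
  using arg_cong[OF rel2', of adj2] by (simp add: adj2_mult adj_s0 adj_s1 adj_s3 adj_dg mult.assoc)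

lemma r2c': "s 2 * (dg M * s 3) = dg W * (s 2 * dg M)"
  using arg_cong[OF rel1', of adj2] by (simp add: adj2_mult adj_s0 adj_s1 adj_s3 adj_dg mult.assoc)

lemma r1c: "s 3 * (dg M * s 2) = dg (1/L) * (dg W * (s 2 * dg M))"
proof -
  have "s 3 * (dg M * s 2) = (s 3 * (dg M * s 1)) * (dg W * s 3)" by (simp add: s2_s1 mult.assoc)
  also have "\<dots> = dg (1/L) * (s 2 * (dg M * s 3))" unfolding r1a by (simp add: mult.assoc)
  finally show ?thesis unfolding r2c' .
qed

lemma s0_L: "s 0 * dg L = dg M * (dg M * (s 3 * (dg W * s 1)))"
  unfolding rel2' by simp

lemma s3_s0: "s 3 * (dg W * s 0) = dg W * (s 0 * dg W)"
  using arg_cong[OF r0c, of adj2] by (simp add: adj2_mult adj_s0 adj_s2 adj_s1 mult.assoc)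

lemma r2b: "s 0 * (dg L * s 3) = dg M * (dg M * (s 3 * dg W))"
  using arg_cong[OF s0_L, of "\<lambda>g. g * s 3"] by (simp add: mult.assoc)

lemma r2c: "s 0 * (dg M * (dg L * s 3)) = dg M * (s 0 * dg W)"
proof -
  have "s 0 * (dg M * (dg L * s 3)) = (s 0 * dg L) * (dg M * s 3)" 
    by (metis dg_commute mult.assoc)
  also have "\<dots> = dg M * (dg M * (s 3 * (dg W * (s 1 * (dg M * s 3)))))" unfolding s0_L by (simp add: mult.assoc)
  also have "s 1 * (dg M * s 3) = s 0" by (simp only: s0_s1)
  finally show ?thesis unfolding s3_s0 by simp
qed

lemma r0a: "s 2 * (dg M * s 0) = dg M * (dg L * (s 3 * dg M))"
proof -
  have "s 2 * (dg M * s 0) = (s 2 * (dg M * s 1)) * (dg M * s 3)" by (simp add: s0_s1 mult.assoc)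
  also have "\<dots> = dg M * (s 2 * (dg M * dg M)) * s 3" unfolding r0c by (simp add: mult.assoc)
  also have "s 2 * (dg M * dg M) = dg L * (s 3 * (dg M * s 1))" unfolding r1a by simp
  finally show ?thesis by (simp add: mult.assoc)
qed

lemma r2a: "s 0 * (dg M * s 2) = dg M * (s 1 * dg W)"
proof -
  have "s 0 * (dg M * s 2) = dg M * ((dg W * (s 0 * dg M)) * s 2)" by (simp add: mult.assoc)
  then show ?thesis unfolding rel1' by (simp add: mult.assoc)
qed

lemma r3b: "s 1 * (dg W * (dg W * s 0)) = dg W * (s 1 * dg (1/L))"
proof -
  have "dg W * (dg W * s 0) = s 3 * (dg W * s 1) * dg (1/L)" unfolding rel2' by (simp add: mult.assoc)
  then show ?thesis by (simp add: mult.assoc)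
qed

lemma r0b: "s 2 * s 1 = s 1 * dg W" by (simp add: s2_s1 mult.assoc)
lemma r1b: "s 3 * s 2 = dg W * s 3" by (simp add: s2_s1)

text \<open>Eigenvalues of the peripheral group. The filling makes this group cyclic, because
  \<open>M\<close> becomes a power of \<open>L\<close>.\<close>

definition Hs :: "complex set" where "Hs = range (\<lambda>i::int. L powi i)"

lemma Hs_mult: "h \<in> Hs \<Longrightarrow> h' \<in> Hs \<Longrightarrow> h * h' \<in> Hs"
  by (auto simp: Hs_def power_int_add[symmetric])
lemma Hs_inverse: "h \<in> Hs \<Longrightarrow> 1 / h \<in> Hs"
  by (auto simp: Hs_def inverse_eq_divide[symmetric] power_int_minus[symmetric])
lemma Hs_1: "1 \<in> Hs" using rangeI[of "\<lambda>i::int. L powi i" 0] by (simp add: Hs_def)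
lemma Hs_L: "L \<in> Hs" using rangeI[of "\<lambda>i::int. L powi i" 1] by (simp add: Hs_def)
lemma Hs_nz: "h \<in> Hs \<Longrightarrow> h \<noteq> 0" by (auto simp: Hs_def)
lemma LN': "L ^ N * M = 1" using LN by (simp add: L_def)
lemma M_powi: "M = L powi (- int N)"
  using LN' by (simp add: power_int_minus field_simps)
lemma Hs_M: "M \<in> Hs" using rangeI[of "\<lambda>i::int. L powi i" "- int N"] M_powi by (simp add: Hs_def)
lemma Hs_W: "W \<in> Hs" using Hs_inverse[OF Hs_M] by (simp add: W_def)
lemma Hs_powi: "h \<in> Hs \<Longrightarrow> h powi i \<in> Hs"
  by (auto simp: Hs_def power_int_mult[symmetric])

definition DC :: "nat \<Rightarrow> m2 set" where
  "DC j = {dg h * s j * dg h' |h h'. h \<in> Hs \<and> h' \<in> Hs}"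

lemma DCI: "h \<in> Hs \<Longrightarrow> h' \<in> Hs \<Longrightarrow> A = dg h * s j * dg h' \<Longrightarrow> A \<in> DC j"
  by (auto simp: DC_def)

lemma DC_left: "A \<in> DC j \<Longrightarrow> h \<in> Hs \<Longrightarrow> dg h * A \<in> DC j"
  unfolding DC_def by (smt (verit) Hs_mult dg_mult mem_Collect_eq mult.assoc)

lemma DC_right: "A \<in> DC j \<Longrightarrow> h \<in> Hs \<Longrightarrow> A * dg h \<in> DC j"
  unfolding DC_def by (smt (verit) Hs_mult dg_mult mem_Collect_eq mult.assoc)

lemma DC_s: "s j \<in> DC j" by (rule DCI[OF Hs_1 Hs_1]) simp

definition iv :: "nat \<Rightarrow> nat" where "iv j = (if j = 0 then 2 else if j = 1 then 3 else if j = 2 then 0 else 1)"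

lemma adj_s: "j < 4 \<Longrightarrow> adj2 (s j) = s (iv j)"
  using adj_s0 adj_s1 adj_s2 adj_s3 by (cases "j = 0"; cases "j = 1"; cases "j = 2"; cases "j = 3") (auto simp: iv_def)

lemma DC_adj: "A \<in> DC j \<Longrightarrow> j < 4 \<Longrightarrow> adj2 A \<in> DC (iv j)"
proof -
  assume "A \<in> DC j" "j < 4"
  then obtain h h' where h: "h \<in> Hs" "h' \<in> Hs" "A = dg h * s j * dg h'" by (auto simp: DC_def)
  show ?thesis
    by (rule DCI[OF Hs_inverse[OF h(2)] Hs_inverse[OF h(1)]])
       (use h \<open>j < 4\<close> in \<open>simp add: adj2_mult adj_dg Hs_nz adj_s mult.assoc\<close>)
qed

end


section \<open>Adjacent neighbours of the tube\<close>

context fig8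
begin

sublocale hex_lattice u v b
  using u0 v_near b_near by unfold_locales auto

abbreviation jj :: "int \<Rightarrow> nat" where "jj k \<equiv> nat (k mod 4)"

text \<open>Chosen so that \<open>G m k\<close> sends infinity to \<open>exp (lam m k)\<close>: the
  exponents are the coefficients of \<open>u\<close> and \<open>v\<close> in \<open>lam\<close>, and
  the additional \<open>L\<close> in row 3 matches the factor \<open>exp v\<close> in
  \<open>exp_b\<close>.\<close>

definition hh :: "int \<Rightarrow> int \<Rightarrow> complex" where
  "hh m k = M powi (m - 2 * (k div 4)) * L powi (k div 4 + (if jj k = 3 then 1 else 0))"

definition G :: "int \<Rightarrow> int \<Rightarrow> m2" where "G m k = dg (hh m k) * s (jj k)"

lemma jj4: "jj k < 4" by (simp add: nat_less_iff)

lemma hh_Hs: "hh m k \<in> Hs" unfolding hh_def by (intro Hs_mult Hs_powi Hs_M Hs_L)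
lemma hh_nz [simp]: "hh m k \<noteq> 0" using Hs_nz hh_Hs by blast

lemma L2: "L\<^sup>2 = exp v" using Lv by (simp add: L_def)

lemma hh_al: "(hh m k)\<^sup>2 * al (jj k) = exp (lam m k)"
proof -
  define n j where "n = k div 4" and "j = jj k"
  have j: "j = 0 \<or> j = 1 \<or> j = 2 \<or> j = 3" using jj4[of k] unfolding j_def by linarith
  have Mi: "(M powi i)\<^sup>2 = exp (of_int i * u)" for i
    by (metis exp_power_int mu power_int_commutes power_int_mult power_int_numeral mult.commute power_int_of_nat of_nat_numeral)
  have Li: "(L powi i)\<^sup>2 = exp (of_int i * v)" for i
    by (metis exp_power_int L2 power_int_commutes power_int_mult power_int_numeral mult.commute power_int_of_nat of_nat_numeral)
  have lam: "lam m k = of_int (m - 2 * n) * u + of_int n * v + b j"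
    by (simp add: lam_def n_def j_def algebra_simps)
  have al: "exp (b j) = al j * (if j = 3 then exp v else 1)" using j exp_b by (auto simp: al_def)
  have "(hh m k)\<^sup>2 * al j = exp (of_int (m - 2 * n) * u) * exp (of_int (n + (if j = 3 then 1 else 0)) * v) * al j"
    by (simp only: hh_def power_mult_distrib Mi Li n_def j_def)
  also have "\<dots> = exp (of_int (m - 2 * n) * u) * exp (of_int n * v) * exp (b j)"
    unfolding al by (simp add: exp_add distrib_right)
  also have "\<dots> = exp (lam m k)" unfolding lam by (simp add: exp_add)
  finally show ?thesis by (simp add: j_def)
qed

lemma axis_G: "axis (G m k) (exp (lam m k)) (th (jj k))"
  unfolding G_def hh_al[symmetric] by (intro axis_dg_left axis_s jj4 hh_nz)

lemma det_G [simp]: "det2 (G m k) = 1" by (simp add: G_def det2_mult det_dg)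

lemma G_DC: "G m k \<in> DC (jj k)"
  unfolding G_def by (intro DC_left DC_s hh_Hs)

lemma DC_G:
  assumes "A \<in> DC j" "j < 4"
  obtains m k h where "A = G m k * dg h" "h \<in> Hs" "jj k = j"
proof -
  obtain i h where h: "A = dg (L powi i) * s j * dg h" "h \<in> Hs"
    using assms(1) by (auto simp: DC_def Hs_def)
  define n where "n = i - (if j = 3 then 1 else 0)"
  define k where "k = 4 * n + int j"
  have "k div 4 = n" "jj k = j" using assms(2) by (auto simp: k_def)
  \<comment> \<open>The choice \<open>m = 2 * n\<close> cancels the power of \<open>M\<close> in
    \<open>hh\<close>; powers of \<open>L\<close> already exhaust \<open>Hs\<close>.\<close>
  then have "G (2 * n) k = dg (L powi i) * s j" by (simp add: G_def hh_def n_def)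
  then show thesis using that h \<open>jj k = j\<close> by metis
qed

lemma adj_G_G: "adj2 (G m k) * G m' k' = s (iv (jj k)) * (dg (hh m' k' / hh m k) * s (jj k'))"
proof -
  have "adj2 (G m k) * G m' k' = s (iv (jj k)) * ((dg (1 / hh m k) * dg (hh m' k')) * s (jj k'))"
    by (simp add: G_def adj2_mult adj_dg adj_s jj4 mult.assoc)
  then show ?thesis by (simp add: dg_mult)
qed

text \<open>The filling relation \<open>L ^ N * M = 1\<close> for matrices becomes
  \<open>u + N v = 2 pi i\<close> for logarithms. The shift by \<open>2 * q * int N\<close>
  compensates the summand \<open>- 2 * u\<close> contained in each period of rows.\<close>

lemma G_period: "G (m + q + 2 * q * int N) (k + 4 * q * int N) = G m k"
  and lam_period: "lam (m + q + 2 * q * int N) (k + 4 * q * int N) = lam m k + of_int q * (2 * of_real pi * \<i>)"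
proof -
  have k: "(k + 4 * q * int N) div 4 = k div 4 + q * int N" "(k + 4 * q * int N) mod 4 = k mod 4"
    using div_mult_self1[of 4 k "q * int N"] mod_mult_self1[of k "q * int N" 4] by (simp_all add: mult_ac)
  have "M powi q * L powi (q * int N) = (L ^ N * M) powi q"
    by (simp add: power_int_mult_distrib power_int_mult mult.commute[of q])
  then have c: "M powi q * L powi (q * int N) = 1" by (simp add: LN')
  define e where "e = (if jj k = 3 then 1 else 0 :: int)"
  have 1: "m + q + 2 * q * int N - 2 * (k div 4 + q * int N) = (m - 2 * (k div 4)) + q" by simp
  have 2: "k div 4 + q * int N + e = (k div 4 + e) + q * int N" by simp
  have "hh (m + q + 2 * q * int N) (k + 4 * q * int N) 
     = M powi ((m - 2 * (k div 4)) + q) * L powi ((k div 4 + e) + q * int N)"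
    unfolding hh_def k e_def[symmetric] 1 2 ..
  also have "\<dots> = (M powi (m - 2 * (k div 4)) * L powi (k div 4 + e)) * (M powi q * L powi (q * int N))"
    by (simp add: power_int_add)
  also have "\<dots> = hh m k" unfolding c by (simp add: hh_def e_def)
  finally show "G (m + q + 2 * q * int N) (k + 4 * q * int N) = G m k"
    unfolding G_def k by simp
  show "lam (m + q + 2 * q * int N) (k + 4 * q * int N) = lam m k + of_int q * (2 * of_real pi * \<i>)"
    unfolding uv[symmetric] lam_def k by (simp add: algebra_simps)
qed

lemma DC_mid: "h \<in> Hs \<Longrightarrow> h' \<in> Hs \<Longrightarrow> dg h * (s j * dg h') \<in> DC j"
  by (rule DCI[of h h']) (auto simp: mult.assoc)

text \<open>One statement for each edge of the hexagonal lattice modulo its periods: four rows times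
  three directions.\<close>

lemma rel_DC:
  "s 2 * (dg M * s 0) \<in> DC 3" "s 2 * (dg 1 * s 1) \<in> DC 1" "s 2 * (dg M * s 1) \<in> DC 2"
  "s 3 * (dg M * s 1) \<in> DC 2" "s 3 * (dg 1 * s 2) \<in> DC 3" "s 3 * (dg M * s 2) \<in> DC 2"
  "s 0 * (dg M * s 2) \<in> DC 1" "s 0 * (dg L * s 3) \<in> DC 3" "s 0 * (dg (M * L) * s 3) \<in> DC 0"
  "s 1 * (dg M * s 3) \<in> DC 0" "s 1 * (dg (W * W) * s 0) \<in> DC 1" "s 1 * (dg W * s 0) \<in> DC 0"
proof -
  note H = Hs_mult Hs_M Hs_W Hs_L Hs_inverse Hs_1
  have 1: "dg h * (dg h' * g) = dg (h * h') * g" for h h' g by (simp add: mult.assoc[symmetric] dg_mult)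
  have 2: "s j * dg h = dg 1 * (s j * dg h)" for j h by simp
  show "s 2 * (dg M * s 0) \<in> DC 3" unfolding r0a 1 by (intro DC_mid H)
  show "s 2 * (dg 1 * s 1) \<in> DC 1" using DC_mid[OF Hs_1 Hs_W, of 1] by (simp add: r0b)
  show "s 2 * (dg M * s 1) \<in> DC 2" unfolding r0c by (intro DC_mid H)
  show "s 3 * (dg M * s 1) \<in> DC 2" unfolding r1a dg_mult by (intro DC_mid H)
  show "s 3 * (dg 1 * s 2) \<in> DC 3" using DC_mid[OF Hs_W Hs_1, of 3] by (simp add: r1b)
  show "s 3 * (dg M * s 2) \<in> DC 2" unfolding r1c 1 by (intro DC_mid H)
  show "s 0 * (dg M * s 2) \<in> DC 1" unfolding r2a by (intro DC_mid H)
  show "s 0 * (dg L * s 3) \<in> DC 3" unfolding r2b 1 by (intro DC_mid H)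
  show "s 0 * (dg (M * L) * s 3) \<in> DC 0" unfolding 1[symmetric] r2c by (intro DC_mid H)
  show "s 1 * (dg M * s 3) \<in> DC 0" using DC_s[of 0] by (simp add: s0_s1)
  show "s 1 * (dg (W * W) * s 0) \<in> DC 1" unfolding 1[symmetric] r3b by (intro DC_mid H)
  show "s 1 * (dg W * s 0) \<in> DC 0" unfolding rel1'[symmetric] by (intro DC_mid H)
qed

text \<open>The opposite directions follow by inversion in \<open>neighbour\<close>. Classes 0 and 1
  are the positive ones. The last conjuncts say, for an edge and for its reversal, that a positive
  element times a positive relative position is again positive; \<open>pos_no_fixpoint\<close>
  depends on this.\<close>

lemma neighbour1:
  assumes "(dm, dk) \<in> {(1,0),(0,1),(1,1)}"
  shows "\<exists>i<4. adj2 (G m k) * G (m + dm) (k + dk) \<in> DC i \<and>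
    (jj k < 2 \<and> i < 2 \<longrightarrow> jj (k + dk) < 2) \<and> (jj (k + dk) < 2 \<and> iv i < 2 \<longrightarrow> jj k < 2)"
proof -
  define n r where "n = k div 4" and "r = k mod 4"
  have k: "k = 4 * n + r" by (simp add: n_def r_def)
  have r: "r \<in> {0,1,2,3}" unfolding r_def using pos_mod_bound[of 4 k] pos_mod_sign[of 4 k] by auto
  have d: "(4 * n + j) div 4 = n" "(4 * n + j) mod 4 = j" if "0 \<le> j" "j < 4" for j
    using that by (auto intro: int_div_pos_eq int_mod_pos_eq)
  have d1: "(4 * n + 1) div 4 = n" "(4 * n + 2) div 4 = n" "(4 * n + 3) div 4 = n"
    using d(1)[of 1] d(1)[of 2] d(1)[of 3] by simp_all
  have m1: "(4 * n + 1) mod 4 = 1" "(4 * n + 2) mod 4 = 2" "(4 * n + 3) mod 4 = 3" 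
    using d(2)[of 1] d(2)[of 2] d(2)[of 3] by simp_all
  have e: "hh (m + 1) k / hh m k = M" by (simp add: hh_def power_int_add power_int_diff)
  have q: "hh m (k + 1) / hh m k = (if r = 2 then L else if r = 3 then W * W else 1)"
    using r by (auto simp: hh_def k d1 m1 power_int_add power_int_diff W_def power2_eq_square)
  have q1: "hh (m + 1) (k + 1) / hh m k = (if r = 2 then M * L else if r = 3 then W else M)"
    using r by (auto simp: hh_def k d1 m1 power_int_add power_int_diff W_def power2_eq_square)
  have jk: "jj k = (if r = 0 then 0 else if r = 1 then 1 else if r = 2 then 2 else 3)" 
    using r unfolding r_def[symmetric] by (auto simp: One_nat_def)
  have jk1: "jj (k + 1) = (if r = 0 then 1 else if r = 1 then 2 else if r = 2 then 3 else 0)" 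
    using r by (auto simp: k m1 One_nat_def)
  consider "dm = 1" "dk = 0" | "dm = 0" "dk = 1" | "dm = 1" "dk = 1" using assms by auto
  then show ?thesis
  proof cases
    case 1
    have "adj2 (G m k) * G (m + dm) (k + dk) \<in> DC (if r = 0 then 3 else if r = 1 then 2 else if r = 2 then 1 else 0)"
      using r rel_DC 1 by (auto simp: adj_G_G e jk iv_def)
    then show ?thesis using r 1
      by (intro exI[of _ "if r = 0 then 3 else if r = 1 then 2 else if r = 2 then 1 else 0"]) (auto simp: jk iv_def)
  next
    case 2
    have "adj2 (G m k) * G (m + dm) (k + dk) \<in> DC (if r = 0 then 1 else if r = 1 then 3 else if r = 2 then 3 else 1)"
      using r rel_DC 2 by (auto simp: adj_G_G q jk jk1 iv_def simp del: dg_1)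
    then show ?thesis using r 2
      by (intro exI[of _ "if r = 0 then 1 else if r = 1 then 3 else if r = 2 then 3 else 1"]) (auto simp: jk jk1 iv_def)
  next
    case 3
    have "adj2 (G m k) * G (m + dm) (k + dk) \<in> DC (if r = 0 then 2 else if r = 1 then 2 else if r = 2 then 0 else 0)"
      using r rel_DC 3 by (auto simp: adj_G_G q1 jk jk1 iv_def)
    then show ?thesis using r 3
      by (intro exI[of _ "if r = 0 then 2 else if r = 1 then 2 else if r = 2 then 0 else 0"]) (auto simp: jk jk1 iv_def)
  qed
qed

lemma iv_iv: "i < 4 \<Longrightarrow> iv (iv i) = i" "iv i < 4" by (auto simp: iv_def)

lemma neighbour:
  assumes "(m' - m, k' - k) \<in> {(0,0),(1,0),(-1,0),(0,1),(0,-1),(1,1),(-1,-1)}"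
  shows "G m' k' = G m k \<or> (\<exists>i<4. adj2 (G m k) * G m' k' \<in> DC i \<and> (jj k < 2 \<and> i < 2 \<longrightarrow> jj k' < 2))"
proof -
  consider "m' = m" "k' = k" | dm dk where "(dm, dk) \<in> {(1,0),(0,1),(1,1)}" "m' = m + dm" "k' = k + dk"
    | dm dk where "(dm, dk) \<in> {(1,0),(0,1),(1,1)}" "m = m' + dm" "k = k' + dk"
  proof -
    define p q where "p = m' - m" and "q = k' - k"
    have pq: "m' = m + p" "k' = k + q" "m = m' + (- p)" "k = k' + (- q)" by (simp_all add: p_def q_def)
    have "(p, q) \<in> {(0,0),(1,0),(-1,0),(0,1),(0,-1),(1,1),(-1,-1)}" using assms by (simp only: p_def q_def)
    then have "p = 0 \<and> q = 0 \<or> (p, q) \<in> {(1,0),(0,1),(1,1)} \<or> (- p, - q) \<in> {(1,0),(0,1),(1,1)}"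
      by (elim insertE emptyE) simp_all
    then show thesis using that(1) that(2)[OF _ pq(1,2)] that(3)[OF _ pq(3,4)] pq(1,2) by (elim disjE conjE) simp_all
  qed
  then show ?thesis
  proof cases
    case 2 then show ?thesis using neighbour1[OF 2(1), of m k] by auto
  next
    case 3
    obtain i where i: "i < 4" "adj2 (G m' k') * G m k \<in> DC i" "jj k < 2 \<and> iv i < 2 \<longrightarrow> jj k' < 2"
      using neighbour1[OF 3(1), of m' k'] 3 by auto
    have "adj2 (adj2 (G m' k') * G m k) \<in> DC (iv i)" using DC_adj i by blast
    then have "adj2 (G m k) * G m' k' \<in> DC (iv i)" by (simp add: adj2_mult)
    then show ?thesis using i iv_iv by blast
  qed simp
qed

end


section \<open>The tube and its translates as a tiling\<close>

context fig8
begin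

definition kap :: real where "kap = 2 / (cmod u)\<^sup>2"
definition V :: "(complex \<times> real) set" where "V = {p \<in> hyp3. Fq p < kap}"

lemma cu: "0 < cmod u" using u0 by simp
lemma kap: "kap > 0" using cu by (simp add: kap_def)

lemma th_bounds: "99/100 * (cmod u)\<^sup>2 \<le> cmod (th j)" "cmod (th j) \<le> 101/100 * (cmod u)\<^sup>2"
  using theta by (auto simp: th_def \<delta>_def W_def)

lemma Fq_G_less:
  assumes "x \<in> hyp3"
  shows "Fq (mob (adj2 (G m k)) x) < c \<longleftrightarrow> 
    ((cmod (fst x - exp (lam m k)))\<^sup>2 + (snd x)\<^sup>2) * ((cmod (fst x - exp (lam m k) * (1 - th (jj k))))\<^sup>2 + (snd x)\<^sup>2)
     < c * (snd x)\<^sup>2 * (cmod (exp (lam m k)))\<^sup>2 * (cmod (th (jj k)))\<^sup>2" (is ?A)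
  and "Fq (mob (adj2 (G m k)) x) \<le> c \<longleftrightarrow> 
    ((cmod (fst x - exp (lam m k)))\<^sup>2 + (snd x)\<^sup>2) * ((cmod (fst x - exp (lam m k) * (1 - th (jj k))))\<^sup>2 + (snd x)\<^sup>2)
     \<le> c * (snd x)\<^sup>2 * (cmod (exp (lam m k)))\<^sup>2 * (cmod (th (jj k)))\<^sup>2" (is ?B)
proof -
  have "0 < 99/100 * (cmod u)\<^sup>2" using cu by simp
  also have "\<dots> \<le> cmod (th (jj k))" by (rule th_bounds)
  finally have pos: "(snd x)\<^sup>2 * (cmod (exp (lam m k)))\<^sup>2 * (cmod (th (jj k)))\<^sup>2 > 0"
    using assms by (simp add: hyp3_def)
  show ?A ?B
    unfolding Fq_axis[OF axis_G det_G assms] pos_divide_less_eq[OF pos] pos_divide_le_eq[OF pos] 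
    by (simp_all only: mult.assoc)
qed

lemma G_near:
  assumes "x \<in> hyp3" "Fq (mob (adj2 (G m k)) x) < kap"
  shows "cmod (fst x - exp (lam m k)) < 73/100 * cmod u * cmod (exp (lam m k))"
proof (rule tube_near[where t = "snd x" and \<theta> = "th (jj k)"])
  show "((cmod (fst x - exp (lam m k)))\<^sup>2 + (snd x)\<^sup>2) * ((cmod (fst x - exp (lam m k) * (1 - th (jj k))))\<^sup>2 + (snd x)\<^sup>2)
     < 2 / (cmod u)\<^sup>2 * (snd x)\<^sup>2 * (cmod (exp (lam m k)))\<^sup>2 * (cmod (th (jj k)))\<^sup>2"
    using assms Fq_G_less(1)[OF assms(1)] by (simp only: kap_def)
qed (use cu u_small assms th_bounds in \<open>auto simp: hyp3_def\<close>)

text \<open>The ends of the two axes are so close that their logarithms differ by at most 155/100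
  times \<open>cmod u\<close> modulo 2 pi i. A period of \<open>G\<close> absorbs the multiple of 2
  pi i, and then \<open>lam_near\<close> applies.\<close>

lemma G_overlap0:
  assumes "x \<in> hyp3" "Fq (mob (adj2 (G m k)) x) < kap" "Fq (mob (adj2 (G m' k')) x) < kap"
  obtains dm dk where "(dm, dk) \<in> {(0,0),(1,0),(-1,0),(0,1),(0,-1),(1,1),(-1,-1)}"
    "G m' k' = G (m + dm) (k + dk)" "jj k' = jj (k + dk)"
proof -
  define w where "w = Ln (exp (lam m' k') / exp (lam m k))"
  have w: "cmod w \<le> 155/100 * cmod u"
    unfolding w_def using near_Ln[OF cu u_small _ _ G_near[OF assms(1,2)] G_near[OF assms(1,3)]] by simp
  have "exp w = exp (lam m' k' - lam m k)" by (simp add: w_def exp_diff)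
  then obtain q :: int where "w = lam m' k' - lam m k + of_int q * (2 * of_real pi * \<i>)"
    by (auto simp: exp_eq mult_ac)
  then have "lam (m' + q + 2 * q * int N) (k' + 4 * q * int N) - lam m k = w"
    unfolding lam_period by simp
  then have "cmod ((lam (m' + q + 2 * q * int N) (k' + 4 * q * int N) - lam m k) / u) \<le> 155/100"
    using w cu by (simp add: norm_divide divide_le_eq)
  note n = lam_near[OF this]
  have "jj (k' + 4 * q * int N) = jj k'" using mod_mult_self1[of k' "q * int N" 4] by (simp add: mult_ac)
  then show thesis using G_period[of m' q k'] that[OF n] by (simp add: algebra_simps)
qed

lemma G_overlap:
  assumes "x \<in> hyp3" "Fq (mob (adj2 (G m k)) x) < kap" "Fq (mob (adj2 (G m' k')) x) < kap"
  shows "G m' k' = G m k \<or> (\<exists>i<4. adj2 (G m k) * G m' k' \<in> DC i \<and> (jj k < 2 \<and> i < 2 \<longrightarrow> jj k' < 2))"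
proof -
  obtain dm dk where d: "(dm, dk) \<in> {(0,0),(1,0),(-1,0),(0,1),(0,-1),(1,1),(-1,-1)}"
    "G m' k' = G (m + dm) (k + dk)" "jj k' = jj (k + dk)" using G_overlap0[OF assms] by metis
  have "(m + dm - m, k + dk - k) \<in> {(0,0),(1,0),(-1,0),(0,1),(0,-1),(1,1),(-1,-1)}" using d(1) by simp
  from neighbour[OF this] show ?thesis unfolding d(2,3) .
qed

lemma G_finite:
  assumes "x \<in> hyp3"
  shows "finite {A. \<exists>m k. A = G m k \<and> Fq (mob (adj2 A) x) < kap}" (is "finite ?A")
proof (cases "?A = {}")
  case False
  then obtain m k where mk: "Fq (mob (adj2 (G m k)) x) < kap" by auto
  have "?A \<subseteq> (\<lambda>(dm, dk). G (m + dm) (k + dk)) ` {(0,0),(1,0),(-1,0),(0,1),(0,-1),(1,1),(-1,-1)}"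
  proof
    fix A assume "A \<in> ?A"
    then obtain m' k' where A: "A = G m' k'" "Fq (mob (adj2 (G m' k')) x) < kap" by auto
    obtain dm dk where d: "(dm, dk) \<in> {(0,0),(1,0),(-1,0),(0,1),(0,-1),(1,1),(-1,-1)}"
      "G m' k' = G (m + dm) (k + dk)" using G_overlap0[OF assms mk A(2)] by metis
    show "A \<in> (\<lambda>(dm, dk). G (m + dm) (k + dk)) ` {(0,0),(1,0),(-1,0),(0,1),(0,-1),(1,1),(-1,-1)}"
      by (rule image_eqI[OF _ d(1)]) (simp add: A d(2))
  qed
  then show ?thesis by (rule finite_subset) simp
qed (simp only: finite.emptyI)

text \<open>The stabiliser of the tube together with the elements that move the tube to an adjacent
  one.\<close>

definition T :: "m2 set" where "T = dg ` Hs \<union> (\<Union>j<4. DC j)"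

lemma T_iff: "A \<in> T \<longleftrightarrow> (\<exists>h\<in>Hs. A = dg h) \<or> (\<exists>j<4. A \<in> DC j)"
  by (auto simp: T_def)

lemma T_left: "h \<in> Hs \<Longrightarrow> A \<in> T \<Longrightarrow> dg h * A \<in> T"
  unfolding T_iff using DC_left Hs_mult dg_mult by metis
lemma T_right: "h \<in> Hs \<Longrightarrow> A \<in> T \<Longrightarrow> A * dg h \<in> T"
  unfolding T_iff using DC_right Hs_mult dg_mult by metis
lemma T_adj: "A \<in> T \<Longrightarrow> adj2 A \<in> T"
  unfolding T_iff using DC_adj iv_iv(2) adj_dg Hs_nz Hs_inverse by metis

lemma Fq_adj_dg: 
  assumes "h \<in> Hs" "det2 A = 1" "x \<in> hyp3" shows "Fq (mob (adj2 (A * dg h)) x) = Fq (mob (adj2 A) x)"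
  using assms by (simp add: adj2_mult adj_dg Hs_nz mob_mult det_dg Fq_dg mob_hyp3)

lemma T_cocycle:
  assumes "g \<in> T" "g' \<in> T" "x \<in> V" "mob (adj2 g) x \<in> V" "mob (adj2 g') x \<in> V"
  shows "adj2 g * g' \<in> T"
proof -
  consider h where "h \<in> Hs" "g = dg h" | h where "h \<in> Hs" "g' = dg h" 
    | j j' where "g \<in> DC j" "g' \<in> DC j'" "j < 4" "j' < 4"
    using assms(1,2) unfolding T_def by auto
  then show ?thesis
  proof cases
    case 1 then show ?thesis using T_left[OF Hs_inverse assms(2)] by (simp add: adj_dg Hs_nz)
  next
    case 2 then show ?thesis using T_right[OF _ T_adj[OF assms(1)]] by simp
  next
    case 3
    obtain m k h where g: "g = G m k * dg h" "h \<in> Hs" using DC_G 3 by metis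
    obtain m' k' h' where g': "g' = G m' k' * dg h'" "h' \<in> Hs" using DC_G 3 by metis
    have x: "x \<in> hyp3" using assms(3) by (simp add: V_def)
    have "Fq (mob (adj2 (G m k)) x) < kap" "Fq (mob (adj2 (G m' k')) x) < kap"
      using assms(4,5) x g g' by (auto simp: V_def Fq_adj_dg)
    from G_overlap[OF x this] have "adj2 (G m k) * G m' k' \<in> T"
    proof
      assume "G m' k' = G m k"
      then have "adj2 (G m k) * G m' k' = dg 1" by (simp add: adj2_left)
      then show ?thesis using Hs_1 by (simp add: T_def del: dg_1)
    qed (auto simp: T_def)
    then have "dg (1 / h) * (adj2 (G m k) * G m' k') * dg h' \<in> T"
      using g g' by (intro T_left T_right Hs_inverse)
    then show ?thesis using g g' by (simp add: adj2_mult adj_dg Hs_nz mult.assoc)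
  qed
qed

text \<open>Well inside the tube, \<open>1\<close> serves. In the outer shell the logarithm of the
  horizontal coordinate is close to some \<open>lam m k\<close>, and the tube of that neighbour
  contains the point with a margin.\<close>

lemma V_cover:
  assumes "x \<in> V" 
  shows "\<exists>t\<in>T. Fq (mob (adj2 t) x) \<le> 95/100 * kap"
proof (cases "Fq x \<le> 95/100 * kap")
  case True
  have "1 \<in> T" using Hs_1 dg_1 unfolding T_def by (metis UnI1 image_eqI)
  then show ?thesis using True by (intro bexI[of _ 1]) simp
next
  case False
  obtain z t where x: "x = (z,t)" by (cases x)
  have t: "t > 0" and xh: "x \<in> hyp3" using assms x by (auto simp: V_def hyp3_def)
  have F: "(cmod z)\<^sup>2 + t\<^sup>2 < kap * t\<^sup>2" "95/100 * kap * t\<^sup>2 \<le> (cmod z)\<^sup>2 + t\<^sup>2"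
    using assms False t by (simp_all add: V_def Fq_eq x field_simps)
  have "(cmod u)\<^sup>2 \<le> (1/100)\<^sup>2" using u_small by (intro power_mono) auto
  then have "kap \<ge> 2" using cu unfolding kap_def by (simp add: field_simps power2_eq_square)
  then have "95/100 * kap > 1" by simp
  then have "95/100 * kap * t\<^sup>2 > 1 * t\<^sup>2" using t by (intro mult_strict_right_mono) auto
  \<comment> \<open>The outer shell avoids the axis over 0, so the logarithm of \<open>z\<close> is
    available.\<close>
  then have z: "z \<noteq> 0" using F by auto
  obtain m k where mk: "cmod ((lam m k - Ln z) / u) \<le> 62/100" using lam_cover by blast
  then have w: "cmod (lam m k - Ln z) \<le> 62/100 * cmod u" using cu by (simp add: norm_divide divide_le_eq)
  have "z * exp (lam m k - Ln z) = exp (lam m k)" using z by (simp add: exp_diff)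
  with near_exp[OF cu u_small w, of z] have n: "cmod (z - exp (lam m k)) \<le> 654/1000 * cmod u * cmod (exp (lam m k))"
    by simp
  have "Fq (mob (adj2 (G m k)) x) \<le> 95/100 * kap"
    unfolding Fq_G_less(2)[OF xh] 
    unfolding kap_def x fst_conv snd_conv
    by (rule tube_cover[OF cu u_small t _ th_bounds]) (use F n in \<open>simp_all add: kap_def\<close>)
  moreover have "G m k \<in> T" unfolding T_iff using G_DC jj4 by blast
  ultimately show ?thesis by blast
qed

definition S :: "m2 set" where "S = dg ` Hs \<union> s ` {..<4}"

text \<open>In Euclidean terms the tube is a round open cone, which makes its convexity
  visible.\<close>

lemma V_alt: "V = {p. 0 < snd p \<and> cmod (fst p) < sqrt (kap - 1) * snd p}"
proof -
  have "(cmod u)\<^sup>2 \<le> (1/100)\<^sup>2" using u_small by (intro power_mono) auto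
  then have k: "kap \<ge> 2" using cu unfolding kap_def by (simp add: field_simps power2_eq_square)
  have "(cmod z)\<^sup>2 + t\<^sup>2 < kap * t\<^sup>2 \<longleftrightarrow> cmod z < sqrt (kap - 1) * t" if "t > 0" for z t
  proof -
    have "(cmod z)\<^sup>2 + t\<^sup>2 < kap * t\<^sup>2 \<longleftrightarrow> (cmod z)\<^sup>2 < (sqrt (kap - 1) * t)\<^sup>2"
      using k by (simp add: power_mult_distrib left_diff_distrib less_diff_eq)
    also have "\<dots> \<longleftrightarrow> cmod z < sqrt (kap - 1) * t"
      using that k by (auto intro: power_less_imp_less_base power_strict_mono)
    finally show ?thesis .
  qed
  then show ?thesis by (auto simp: V_def hyp3_def Fq_eq divide_less_eq)
qed

lemma connected_V: "connected V"
proof (rule convex_connected, rule convexI)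
  fix p q :: "complex \<times> real" and x y :: real
  assume pq: "p \<in> V" "q \<in> V" and xy: "0 \<le> x" "0 \<le> y" "x + y = 1"
  have pos: "0 < x * snd p + y * snd q"
    using pq xy by (cases "x = 0") (auto simp: V_alt intro!: add_pos_nonneg)
  have "cmod (x *\<^sub>R fst p + y *\<^sub>R fst q) \<le> x * cmod (fst p) + y * cmod (fst q)"
    using xy norm_triangle_ineq[of "x *\<^sub>R fst p" "y *\<^sub>R fst q"] by simp
  also have "\<dots> < x * (sqrt (kap - 1) * snd p) + y * (sqrt (kap - 1) * snd q)"
  proof (cases "x = 0")
    case True then show ?thesis using pq xy by (simp add: V_alt)
  next
    case False
    then show ?thesis using pq xy by (intro add_less_le_mono mult_strict_left_mono mult_left_mono) (auto simp: V_alt)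
  qed
  finally show "x *\<^sub>R p + y *\<^sub>R q \<in> V" using pos by (simp add: V_alt algebra_simps)
qed

lemma V_dg: "h \<in> Hs \<Longrightarrow> p \<in> V \<Longrightarrow> mob (dg h) p \<in> V"
  by (simp add: V_def Fq_dg Hs_nz mob_hyp3 det_dg)

lemma origin_V: "(0,1) \<in> V"
proof -
  have "(cmod u)\<^sup>2 \<le> (1/100)\<^sup>2" using u_small by (intro power_mono) auto
  then have k: "kap \<ge> 2" using cu unfolding kap_def by (simp add: field_simps power2_eq_square)
  then show ?thesis by (simp add: V_def hyp3_def Fq_eq)
qed

lemma overlap_s:
  assumes "j < 4" shows "\<exists>x\<in>V. mob (adj2 (s j)) x \<in> V"
proof -
  define e where "e = cmod u"
  have e: "0 < e" "e \<le> 1/100" using cu u_small by (auto simp: e_def)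
  have ax: "axis (s j) (al j) (th j)" by (rule axis_s[OF assms])
  then have al: "al j \<noteq> 0" by (auto simp: axis_def)
  \<comment> \<open>Over the end of the axis, the tube \<open>V\<close> starts near height
    \<open>e / sqrt 2\<close> and the neighbour reaches up to about \<open>sqrt 2 * e\<close>, in
    units of \<open>cmod (al j)\<close>; height \<open>e\<close> lies in both.\<close>
  define x where "x = (al j, cmod (al j) * e)"
  have xh: "x \<in> hyp3" using al e by (simp add: x_def hyp3_def)
  have e2: "0 < e\<^sup>2" "e\<^sup>2 \<le> 1/10000" using e power_mono[of e "1/100" 2] by (auto simp: power2_eq_square)
  have "Fq x = (1 + e\<^sup>2) / e\<^sup>2" using al e by (simp add: Fq_eq x_def power_mult_distrib field_simps)
  also have "\<dots> < 2 / e\<^sup>2" using e2 by (intro divide_strict_right_mono) auto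
  finally have 1: "x \<in> V" using xh by (simp add: V_def kap_def e_def)
  define t where "t = cmod (th j)"
  have t: "99/100 * e\<^sup>2 \<le> t" "t \<le> 101/100 * e\<^sup>2" using th_bounds by (auto simp: t_def e_def)
  have t0: "t > 0" using t e2 by linarith
  have a2: "(cmod (al j))\<^sup>2 > 0" using al by simp
  have "Fq (mob (adj2 (s j)) x) = ((cmod (al j) * e)\<^sup>2 * ((cmod (al j) * t)\<^sup>2 + (cmod (al j) * e)\<^sup>2))
     / ((cmod (al j) * e)\<^sup>2 * (cmod (al j))\<^sup>2 * t\<^sup>2)"
    unfolding Fq_axis[OF ax det_s xh] by (simp add: x_def t_def norm_mult right_diff_distrib)
  also have "\<dots> = (t\<^sup>2 + e\<^sup>2) / t\<^sup>2"
    using a2 e2 t0 by (simp add: power_mult_distrib field_simps)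
  also have "\<dots> = 1 + e\<^sup>2 / t\<^sup>2" using t0 by (simp add: add_divide_distrib)
  also have "\<dots> < 2 / e\<^sup>2"
  proof -
    have "(99/100 * e\<^sup>2)\<^sup>2 \<le> t\<^sup>2" using t e2 by (intro power_mono) auto
    then have "e\<^sup>2 / t\<^sup>2 \<le> e\<^sup>2 / (99/100 * e\<^sup>2)\<^sup>2" using e2 t0 by (intro divide_left_mono) auto
    also have "\<dots> = (10000/9801) / e\<^sup>2" using e2 by (simp add: power2_eq_square)
    finally have "1 + e\<^sup>2 / t\<^sup>2 \<le> 1 + (10000/9801) / e\<^sup>2" by simp
    also have "\<dots> \<le> (1/10000) / e\<^sup>2 + (10000/9801) / e\<^sup>2" 
      using e2 by (intro add_right_mono) (simp add: pos_le_divide_eq)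
    also have "\<dots> = (1/10000 + 10000/9801) / e\<^sup>2" by (simp only: add_divide_distrib)
    also have "\<dots> < 2 / e\<^sup>2" using e2 by (intro divide_strict_right_mono) auto
    finally show ?thesis .
  qed
  finally have "mob (adj2 (s j)) x \<in> V" using xh by (simp add: V_def kap_def e_def mob_hyp3)
  then show ?thesis using 1 by blast
qed

lemma one_T: "1 \<in> T" unfolding T_iff using Hs_1 dg_1 by metis

sublocale til: tiling S T V "1/50"
proof
  show "det2 t = 1" if "t \<in> S" for t using that by (auto simp: S_def det_dg Hs_nz)
  show "adj2 t \<in> S" if "t \<in> S" for t
    using that Hs_inverse iv_iv(2) by (auto simp: S_def adj_dg Hs_nz adj_s)
  show "S \<subseteq> T" unfolding S_def T_iff subset_eq using DC_s by blast
  show "T \<subseteq> mgen S"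
  proof
    fix A assume "A \<in> T"
    then consider h where "h \<in> Hs" "A = dg h" | j h h' where "j < 4" "h \<in> Hs" "h' \<in> Hs" "A = dg h * s j * dg h'"
      unfolding T_iff DC_def by blast
    then show "A \<in> mgen S"
    proof cases
      case 1 then show ?thesis by (intro mgen_base) (simp add: S_def)
    next
      case 2
      then have "dg h \<in> mgen S" "s j \<in> mgen S" "dg h' \<in> mgen S" by (auto intro!: mgen_base simp: S_def)
      then show ?thesis unfolding 2 by (intro mgen_mult)
    qed
  qed
  show "\<exists>x\<in>V. mob (adj2 t) x \<in> V" if tS: "t \<in> S" for t
  proof -
    consider h where "h \<in> Hs" "t = dg h" | j where "j < 4" "t = s j" using tS by (auto simp: S_def)
    then show ?thesis
    proof cases
      case 1
      then have "mob (adj2 t) (0,1) \<in> V" using V_dg[OF Hs_inverse origin_V] by (simp add: adj_dg Hs_nz)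
      then show ?thesis using origin_V by blast
    qed (use overlap_s in auto)
  qed
  show "\<exists>t\<in>T. \<forall>q\<in>hyp3. hyp3_dist x q < 1/50 \<longrightarrow> mob (adj2 t) q \<in> V" if x: "x \<in> V" for x
  proof -
    have xh: "x \<in> hyp3" using x by (simp add: V_def)
    obtain t where t: "t \<in> T" "Fq (mob (adj2 t) x) \<le> 95/100 * kap" using V_cover[OF x] by blast
    have dt: "det2 t = 1" using t(1) unfolding T_iff DC_def by (auto simp: det_dg Hs_nz det2_mult)
    have "mob (adj2 t) q \<in> V" if q: "q \<in> hyp3" "hyp3_dist x q < 1/50" for q
    proof -
      define D where "D = hyp3_dist (mob (adj2 t) x) (mob (adj2 t) q)"
      have D: "D < 1/50" using q xh dt by (simp add: D_def hyp3_dist_mob)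
      have "(exp D)\<^sup>2 \<le> (exp (1/50))\<^sup>2" using D by (intro power_mono) auto
      also have "\<dots> = exp (1/25 :: real)" by (simp add: exp_double[symmetric])
      also have "\<dots> \<le> 1 + 1/25 + (1/25)\<^sup>2" by (rule exp_bound) auto
      \<comment> \<open>This determines the radius 1/50: 105/100 times 95/100 is still below
        1.\<close>
      finally have eD: "(exp D)\<^sup>2 \<le> 105/100" by (simp add: power2_eq_square)
      have "Fq (mob (adj2 t) q) \<le> (exp D)\<^sup>2 * Fq (mob (adj2 t) x)"
        unfolding D_def using xh q dt by (intro Fq_lipschitz mob_hyp3) auto
      also have "\<dots> \<le> 105/100 * (95/100 * kap)" using eD t(2) by (intro mult_mono) (auto simp: Fq_eq)
      also have "\<dots> < kap" using kap by simp
      finally show ?thesis using q dt by (simp add: V_def mob_hyp3)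
    qed
    then show ?thesis using t(1) by blast
  qed
qed (use one_T T_adj T_cocycle connected_V origin_V in \<open>auto simp: V_def\<close>)

section \<open>Freeness of the action\<close>

lemma cmod_L: "cmod L \<noteq> 1"
proof
  assume "cmod L = 1"
  then have "cmod (exp v) = 1" unfolding L2[symmetric] by (simp add: norm_power)
  then show False using Re_v by simp
qed

lemma Hs_cmod_1: "h \<in> Hs \<Longrightarrow> cmod h = 1 \<Longrightarrow> h = 1"
proof -
  assume "h \<in> Hs" "cmod h = 1"
  then obtain i :: int where i: "h = L powi i" "cmod L powi i = 1" by (auto simp: Hs_def norm_power_int)
  have "(L powi i)\<^sup>2 = exp (of_int i * v)"
    by (metis exp_power_int L2 power_int_commutes power_int_mult power_int_numeral mult.commute power_int_of_nat of_nat_numeral)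
  then have "cmod (exp (of_int i * v)) = (cmod L powi i)\<^sup>2" by (metis norm_power norm_power_int)
  then have "exp (of_int i * Re v) = 1" unfolding i(2) by simp
  then have "i = 0" using Re_v by simp
  then show "h = 1" using i by simp
qed

text \<open>The matrix \<open>dg (- 1)\<close> acts trivially on hyperbolic space, so only the
  moduli can show that it is not in the peripheral group.\<close>

lemma minus_one_Hs: "- 1 \<notin> Hs" using Hs_cmod_1[of "- 1"] by auto


lemma m12_s: "j < 4 \<Longrightarrow> m12 (s j) \<noteq> 0"
proof -
  assume j: "j < 4"
  have ax: "axis (s j) (al j) (th j)" by (rule axis_s[OF j])
  have "(cmod u)\<^sup>2 \<le> (1/100)\<^sup>2" using u_small by (intro power_mono) auto
  then have "cmod (th j) < 1" using th_bounds(2)[of j] by (simp add: power2_eq_square)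
  then have "th j \<noteq> 1" by auto
  then show ?thesis using ax by (auto simp: axis_def)
qed

text \<open>Diagonal factors on either side preserve \<open>m11 * m22\<close> and multiply
  \<open>m12\<close> by an element of \<open>Hs\<close>.\<close>

lemma DC_invariants:
  assumes "A \<in> DC j" "j < 4"
  obtains h where "h \<in> Hs" "m12 A = h * m12 (s j)" "m11 A * m22 A * th j = 1"
proof -
  obtain h h' where h: "h \<in> Hs" "h' \<in> Hs" "A = dg h * s j * dg h'" using assms by (auto simp: DC_def)
  have "m12 A = h * (1 / h') * m12 (s j)" "m11 A * m22 A = m11 (s j) * m22 (s j)"
    using Hs_nz[OF h(1)] Hs_nz[OF h(2)] unfolding h(3) by (cases "s j"; simp add: dg_def)+
  then show thesis using that[OF Hs_mult[OF h(1) Hs_inverse[OF h(2)]]] axis_adj2[OF axis_s[OF assms(2)]] by simp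
qed

lemma DC_not_dg: "A \<in> DC j \<Longrightarrow> j < 4 \<Longrightarrow> A \<noteq> dg h"
  using m12_s Hs_nz by (metis DC_invariants dg_def m2.sel(2) mult_eq_0_iff)

text \<open>The value of \<open>th\<close> separates the classes 0 and 2 from 1 and 3, as \<zeta>^2
  is not 1. Inside such a pair the representatives are mutually inverse and have opposite entries
  \<open>m12\<close>, so a common element would put -1 into \<open>Hs\<close>.\<close>

lemma DC_pos:
  assumes "A \<in> DC i" "A \<in> DC j" "i < 2" "j < 4"
  shows "j < 2"
proof (rule ccontr)
  assume j: "\<not> j < 2"
  obtain h where h: "h \<in> Hs" "m12 A = h * m12 (s i)" "m11 A * m22 A * th i = 1"
    using DC_invariants[OF assms(1)] assms(3) by auto
  obtain h' where h': "h' \<in> Hs" "m12 A = h' * m12 (s j)" "m11 A * m22 A * th j = 1"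
    using DC_invariants[OF assms(2,4)] by blast
  have "m11 A * m22 A * th i = m11 A * m22 A * th j" using h(3) h'(3) by simp
  moreover have "m11 A * m22 A \<noteq> 0" using h(3) by auto
  ultimately have "th i = th j" by simp
  moreover have "\<delta>\<^sup>2 * \<zeta> \<noteq> \<delta>\<^sup>2 / \<zeta>" using zeta1 by (simp add: field_simps power2_eq_square)
  ultimately have "j = iv i" using assms(3,4) j by (auto simp: th_def iv_def split: if_splits)
  then have "m12 (s j) = - m12 (s i)" using adj_s[of i] assms(3) by (metis (no_types) adj2_def m2.sel(2) numeral_less_iff order_less_trans semiring_norm(76,78))
  then have "h * m12 (s i) = - h' * m12 (s i)" using h(2) h'(2) by simp
  then have "(h + h') * m12 (s i) = 0" by (simp add: distrib_right)
  moreover have "m12 (s i) \<noteq> 0" using m12_s assms(3) by simp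
  ultimately have "h = - h'" by (simp add: eq_neg_iff_add_eq_0)
  then have "- 1 = h * (1 / h')" using Hs_nz[OF h'(1)] by simp
  then show False using minus_one_Hs Hs_mult[OF h(1) Hs_inverse[OF h'(1)]] by metis
qed

lemma V_axis:
  assumes "A \<in> DC j" "j < 4" "x \<in> hyp3" "mob (adj2 A) x \<in> V"
  obtains m k h where "A = G m k * dg h" "h \<in> Hs" "jj k = j" "Fq (mob (adj2 (G m k)) x) < kap"
  using DC_G[OF assms(1,2)] assms(3,4) by (metis (no_types, lifting) Fq_adj_dg V_def det_G mem_Collect_eq)

text \<open>All powers of \<open>g\<close> fix \<open>x\<close> and therefore lie in
  \<open>T\<close>, and \<open>G_overlap\<close> keeps them positive by induction. Only finitely
  many tubes contain \<open>x\<close>, so two powers differ by a peripheral element, although their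
  quotient is itself a positive power.\<close>

lemma pos_no_fixpoint:
  assumes g: "g \<in> mgen S" "g \<in> DC j" "j < 2" and x: "x \<in> V" "mob g x = x"
  shows False
proof -
  have xh: "x \<in> hyp3" using x by (simp add: V_def)
  have dgn: "det2 (g ^ n) = 1" and Gn: "g ^ n \<in> mgen S" and fixp: "mob (g ^ n) x = x" for n
  proof -
    show *: "det2 (g ^ n) = 1" for n using g(1) by (induction n) (auto simp: det2_mult)
    show "g ^ n \<in> mgen S" by (induction n) (auto intro: mgen.one mgen_mult g(1))
    show "mob (g ^ n) x = x" using g(1) x(2) xh * by (induction n) (auto simp: mob_mult)
  qed
  have fix': "mob (adj2 (g ^ n)) x = x" for n using mob_adj2(1)[OF dgn xh, of n] by (simp add: fixp)
  have fixV: "mob (adj2 (g ^ n)) x \<in> V" for n using x(1) by (simp add: fix')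
  have inT: "g ^ n \<in> T" for n using til.tile_overlap[OF Gn x(1)] x(1) by (simp add: fix')
  have pos: "\<exists>j<2. g ^ Suc n \<in> DC j" for n
  proof (induction n)
    case 0 then show ?case using g by auto
  next
    case (Suc n)
    then obtain i where i: "i < 2" "g ^ Suc n \<in> DC i" by blast
    have i4: "i < 4" using i by simp
    obtain m k h where mk: "g ^ Suc n = G m k * dg h" "h \<in> Hs" "jj k = i" "Fq (mob (adj2 (G m k)) x) < kap"
      by (rule V_axis[OF i(2) i4 xh fixV])
    have gg: "g = adj2 (g ^ Suc n) * g ^ Suc (Suc n)" 
    proof -
      have "g ^ Suc (Suc n) = g ^ Suc n * g" by (simp only: power_Suc2)
      then show ?thesis using adj2_left_assoc[OF dgn[of "Suc n"]] by simp
    qed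
    from inT[of "Suc (Suc n)"] consider h' where "h' \<in> Hs" "g ^ Suc (Suc n) = dg h'" | i' where "i' < 4" "g ^ Suc (Suc n) \<in> DC i'"
      unfolding T_iff by blast
    then show ?case
    proof cases
      case 1
      then have "mob (dg h') x = x" using fixp[of "Suc (Suc n)"] by simp
      then have "h'\<^sup>2 * fst x = fst x" "(cmod h')\<^sup>2 * snd x = snd x"
        using mob_diag[OF Hs_nz[OF 1(1)], of x] by (metis dg_def fst_conv, metis dg_def snd_conv)
      then have "(cmod h')\<^sup>2 = 1" using xh by (auto simp: hyp3_def)
      then have "h' = 1" using Hs_cmod_1[OF 1(1)] norm_ge_zero[of h'] by (auto simp: power2_eq_1_iff)
      \<comment> \<open>If the next power were peripheral, it would be trivial, and the positive
        element \<open>g\<close> would be the inverse of a positive element.\<close>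
      then have "g = adj2 (g ^ Suc n)" using gg 1 by simp
      then have "g \<in> DC (iv i)" using DC_adj[OF i(2) i4] by simp
      then have "iv i < 2" using DC_pos[OF g(2) _ g(3)] iv_iv(2) by blast
      then show ?thesis using i by (simp add: iv_def split: if_splits)
    next
      case 2
      obtain m' k' h' where mk': "g ^ Suc (Suc n) = G m' k' * dg h'" "h' \<in> Hs" "jj k' = i'" "Fq (mob (adj2 (G m' k')) x) < kap"
        by (rule V_axis[OF 2(2) 2(1) xh fixV])
      have gg': "g = dg (1 / h) * (adj2 (G m k) * G m' k') * dg h'"
        using gg unfolding mk(1) mk'(1) by (simp add: adj2_mult adj_dg Hs_nz[OF mk(2)] mult.assoc)
      from G_overlap[OF xh mk(4) mk'(4)] show ?thesis
      proof
        assume "G m' k' = G m k"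
        then have "g = dg (1 / h * h')" using gg' by (simp add: adj2_left dg_mult)
        then show ?thesis using DC_not_dg[OF g(2)] g(3) by auto
      next
        assume "\<exists>l<4. adj2 (G m k) * G m' k' \<in> DC l \<and> (jj k < 2 \<and> l < 2 \<longrightarrow> jj k' < 2)"
        then obtain l where l: "l < 4" "adj2 (G m k) * G m' k' \<in> DC l" "jj k < 2 \<and> l < 2 \<longrightarrow> jj k' < 2" by blast
        have "g \<in> DC l" unfolding gg' using l mk mk' by (intro DC_left DC_right Hs_inverse)
        then have "l < 2" using DC_pos[OF g(2) _ g(3)] l(1) by blast
        then have "i' < 2" using l(3) mk(3) mk'(3) i(1) by simp
        then show ?thesis using 2 by blast
      qed
    qed
  qed
  define Z where "Z = {A. \<exists>m k. A = G m k \<and> Fq (mob (adj2 A) x) < kap}"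
  have "\<exists>A h. g ^ Suc n = A * dg h \<and> h \<in> Hs \<and> A \<in> Z" for n
  proof -
    obtain i where i: "i < 2" "g ^ Suc n \<in> DC i" using pos by blast
    have i4: "i < 4" using i by simp
    obtain m k h where "g ^ Suc n = G m k * dg h" "h \<in> Hs" "jj k = i" "Fq (mob (adj2 (G m k)) x) < kap"
      by (rule V_axis[OF i(2) i4 xh fixV])
    then show ?thesis unfolding Z_def by (intro exI[of _ "G m k"] exI[of _ h]) auto
  qed
  then have "\<forall>n. \<exists>A. \<exists>h. g ^ Suc n = A * dg h \<and> h \<in> Hs \<and> A \<in> Z" by (rule allI)
  from choice[OF this] obtain A where "\<forall>n. \<exists>h. g ^ Suc n = A n * dg h \<and> h \<in> Hs \<and> A n \<in> Z" ..
  from choice[OF this] obtain h where A: "g ^ Suc n = A n * dg (h n)" "h n \<in> Hs" "A n \<in> Z" for n by blast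
  have "finite Z" unfolding Z_def by (rule G_finite[OF xh])
  then have "finite (range A)" using A(3) by (intro finite_subset[OF _ \<open>finite Z\<close>]) (rule image_subsetI)
  then have "\<not> inj A" using finite_imageD infinite_UNIV_nat by blast
  then obtain n n' where nn: "n < n'" "A n = A n'" by (metis injI linorder_neqE_nat)
  obtain r where r: "Suc n' = Suc n + Suc r" using nn(1) less_imp_Suc_add by fastforce
  have dA: "det2 (A n) = 1" using A(3)[of n] by (auto simp: Z_def)
  have "g ^ Suc r = adj2 (g ^ Suc n) * g ^ Suc n'"
    unfolding r power_add by (rule adj2_left_assoc[OF dgn, symmetric])
  also have "\<dots> = dg (1 / h n * h n')"
    unfolding A(1) nn(2)[symmetric] using dA A(2) 
    by (simp add: adj2_mult adj_dg Hs_nz mult.assoc adj2_left_assoc dg_mult)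
  finally have "g ^ Suc r = dg (1 / h n * h n')" .
  moreover obtain i where i: "i < 2" "g ^ Suc r \<in> DC i" using pos by blast
  have "g ^ Suc r \<noteq> dg (1 / h n * h n')" using DC_not_dg[OF i(2)] i(1) by simp
  ultimately show False by simp
qed

lemma dg_fix:
  assumes "h \<in> Hs" "x \<in> hyp3" "mob (dg h) x = x" shows "h = 1"
proof -
  have "(cmod h)\<^sup>2 * snd x = snd x"
    using mob_diag[OF Hs_nz[OF assms(1)], of x] assms(3) by (metis dg_def snd_conv)
  then have "(cmod h)\<^sup>2 = 1" using assms(2) by (auto simp: hyp3_def)
  then show ?thesis using Hs_cmod_1[OF assms(1)] norm_ge_zero[of h] by (auto simp: power2_eq_1_iff)
qed

text \<open>Conjugation moves the fixed point into \<open>V\<close>, where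
  \<open>tile_overlap\<close> places the element in \<open>T\<close>; if it is negative, its inverse
  is positive.\<close>

theorem free_action:
  assumes g: "g \<in> mgen S" and x: "x \<in> hyp3" "mob g x = x"
  shows "g = 1"
proof -
  obtain k where k: "k \<in> mgen S" "mob (adj2 k) x \<in> V" using til.tile_cover[OF x(1)] by blast
  define x' g' where "x' = mob (adj2 k) x" and "g' = adj2 k * g * k"
  have det: "det2 g = 1" "det2 k = 1" using g k by auto
  have g': "g' \<in> mgen S" unfolding g'_def using g k til.adj_Gamma by (intro mgen_mult) auto
  have dg': "det2 g' = 1" using g' by simp
  have x': "x' \<in> V" "x' \<in> hyp3" using k by (auto simp: x'_def V_def)
  have gx': "mob g' x' = x'"
    using det x by (simp add: g'_def x'_def mob_mult det2_mult mob_hyp3)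
  then have ax': "mob (adj2 g') x' = x'" using mob_adj2(1)[OF dg' x'(2)] by simp
  have "g' \<in> T" using til.tile_overlap[OF g' x'(1)] ax' x'(1) by simp
  then consider h where "h \<in> Hs" "g' = dg h" | j where "j < 4" "g' \<in> DC j" unfolding T_iff by blast
  then have "g' = 1"
  proof cases
    case 1
    then show ?thesis using dg_fix[OF 1(1) x'(2)] gx' by simp
  next
    case 2
    show ?thesis
    proof (cases "j < 2")
      case True
      then show ?thesis using pos_no_fixpoint[OF g' 2(2) True x'(1) gx'] by simp
    next
      case False
      then have "iv j < 2" using 2 by (auto simp: iv_def)
      then show ?thesis using pos_no_fixpoint[OF til.adj_Gamma[OF g'] DC_adj[OF 2(2,1)] _ x'(1) ax'] by simp
    qed
  qed
  then have "k * g' * adj2 k = 1" using det by (simp add: adj2_right)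
  then show ?thesis using det by (simp add: g'_def mult.assoc adj2_right_assoc adj2_right)
qed

end


section \<open>Discreteness and cocompactness\<close>

context fig8
begin

lemma L_powi_cmod: "(cmod (L powi i))\<^sup>2 = exp (of_int i * Re v)"
proof -
  have "(L powi i)\<^sup>2 = exp (of_int i * v)"
    by (metis exp_power_int L2 power_int_commutes power_int_mult power_int_numeral mult.commute power_int_of_nat of_nat_numeral)
  then have "cmod (exp (of_int i * v)) = (cmod (L powi i))\<^sup>2" by (metis norm_power)
  then show ?thesis by simp
qed

lemma Hs_exp:
  assumes "h \<in> Hs" obtains i :: int where "h = L powi i" "(cmod h)\<^sup>2 = exp (of_int i * Re v)"
  using assms L_powi_cmod by (auto simp: Hs_def)

lemma Hs_finite:
  fixes c c' :: real
  assumes "0 < c" shows "finite {h \<in> Hs. c \<le> (cmod h)\<^sup>2 \<and> (cmod h)\<^sup>2 \<le> c'}"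
proof -
  define C where "C = (\<bar>ln c\<bar> + \<bar>ln c'\<bar>) / \<bar>Re v\<bar>"
  have "{h \<in> Hs. c \<le> (cmod h)\<^sup>2 \<and> (cmod h)\<^sup>2 \<le> c'} \<subseteq> (\<lambda>i. L powi i) ` {-\<lceil>C\<rceil>..\<lceil>C\<rceil>}"
  proof
    fix h assume "h \<in> {h \<in> Hs. c \<le> (cmod h)\<^sup>2 \<and> (cmod h)\<^sup>2 \<le> c'}"
    then have h: "h \<in> Hs" "c \<le> (cmod h)\<^sup>2" "(cmod h)\<^sup>2 \<le> c'" by auto
    obtain i :: int where i: "h = L powi i" "(cmod h)\<^sup>2 = exp (of_int i * Re v)" using Hs_exp[OF h(1)] by blast
    have "ln c \<le> of_int i * Re v" using h(2) assms ln_le_cancel_iff[of c "exp (of_int i * Re v)"] unfolding i(2) by simp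
    moreover have "of_int i * Re v \<le> ln c'"
    proof -
      have "0 < c'" using h assms by linarith
      then show ?thesis using h(3) unfolding i(2) by (simp add: ln_ge_iff)
    qed
    ultimately have "\<bar>of_int i * Re v\<bar> \<le> \<bar>ln c\<bar> + \<bar>ln c'\<bar>" by linarith
    then have "\<bar>of_int i\<bar> * \<bar>Re v\<bar> \<le> \<bar>ln c\<bar> + \<bar>ln c'\<bar>" by (simp add: abs_mult)
    then have "\<bar>real_of_int i\<bar> \<le> C" using Re_v by (simp add: C_def pos_le_divide_eq)
    also have "C \<le> of_int \<lceil>C\<rceil>" by (rule le_of_int_ceiling)
    finally have "\<bar>i\<bar> \<le> \<lceil>C\<rceil>" by (metis of_int_abs of_int_le_iff)
    then show "h \<in> (\<lambda>i. L powi i) ` {-\<lceil>C\<rceil>..\<lceil>C\<rceil>}" using i(1) by (intro image_eqI[of _ _ i]) auto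
  qed
  then show ?thesis by (rule finite_subset) simp
qed

lemma snd_dg: "h \<in> Hs \<Longrightarrow> snd (mob (dg h) p) = (cmod h)\<^sup>2 * snd p"
  using mob_diag[OF Hs_nz, of h p] by (simp add: dg_def)

lemma height_near:
  assumes "p \<in> hyp3" "q \<in> hyp3" "hyp3_dist p q < 1/50"
  shows "snd p / 4 \<le> snd q" "snd q \<le> 4 * snd p"
proof -
  have t: "snd p > 0" "snd q > 0" using assms by (auto simp: hyp3_def)
  have "exp (1/50 :: real) \<le> 2" using exp_bound_lemma[of "1/50 :: real"] by simp
  moreover have "exp (- (1/50)) \<le> exp (1/50 :: real)" by simp
  ultimately have "exp (1/50) + exp (- (1/50)) \<le> (4 :: real)" by linarith
  then have "cosh (1/50 :: real) \<le> 2" by (simp add: cosh_field_def)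
  moreover have "chd p q \<le> cosh (1/50)" using assms hyp3_dist_le_iff[of p q "1/50"] by simp
  ultimately have "chd p q \<le> 2" by linarith
  then have "(cmod (fst p - fst q))\<^sup>2 + (snd p)\<^sup>2 + (snd q)\<^sup>2 \<le> 2 * (2 * snd p * snd q)"
    using t by (simp add: chd_def divide_le_eq)
  then have *: "(snd p)\<^sup>2 + (snd q)\<^sup>2 \<le> 4 * snd p * snd q" using zero_le_power2[of "cmod (fst p - fst q)"] by linarith
  have "0 \<le> (snd p)\<^sup>2" "0 \<le> (snd q)\<^sup>2" by simp_all
  then have "(snd p)\<^sup>2 \<le> 4 * snd p * snd q" "(snd q)\<^sup>2 \<le> 4 * snd p * snd q" using * by linarith+
  then have "snd p * snd p \<le> snd p * (4 * snd q)" "snd q * snd q \<le> snd q * (4 * snd p)"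
    by (simp_all add: power2_eq_square mult_ac)
  then show "snd p / 4 \<le> snd q" "snd q \<le> 4 * snd p" using t by auto
qed

text \<open>Such an element lies in \<open>T\<close>. Its inverse is a product of one of the
  finitely many \<open>G m k\<close> whose tube contains \<open>yy\<close> and a peripheral element,
  and the height of the image leaves finitely many choices for the latter.\<close>

lemma small_displacement_finite:
  assumes yy: "yy \<in> hyp3" "\<And>q. q \<in> hyp3 \<Longrightarrow> hyp3_dist yy q < 1/50 \<Longrightarrow> q \<in> V"
  shows "finite {g \<in> mgen S. hyp3_dist yy (mob g yy) < 1/50}"
proof -
  have yV: "yy \<in> V" using yy(2)[OF yy(1)] hyp3_dist_0_iff[OF yy(1) yy(1)] by simp
  have t: "snd yy > 0" using yy by (simp add: hyp3_def)
  define Z where "Z = {A. \<exists>m k. A = G m k \<and> Fq (mob (adj2 A) yy) < kap}"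
  define H where "H = (\<lambda>c c'. {h \<in> Hs. c \<le> (cmod h)\<^sup>2 \<and> (cmod h)\<^sup>2 \<le> c'})"
  define E where "E = (\<lambda>B. H (snd (mob (adj2 B) yy) / (4 * snd yy)) (4 * snd (mob (adj2 B) yy) / snd yy))"
  have "{g \<in> mgen S. hyp3_dist yy (mob g yy) < 1/50} \<subseteq> dg ` H (1/4) 4 \<union> (\<Union>B\<in>Z. (\<lambda>h. dg (1/h) * adj2 B) ` E B)"
  proof
    fix g assume "g \<in> {g \<in> mgen S. hyp3_dist yy (mob g yy) < 1/50}"
    then have g: "g \<in> mgen S" "hyp3_dist yy (mob g yy) < 1/50" by auto
    have gy: "mob g yy \<in> hyp3" using g yy by (simp add: mob_hyp3)
    have gV: "mob g yy \<in> V" using yy(2)[OF gy g(2)] .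
    have hn: "snd yy / 4 \<le> snd (mob g yy)" "snd (mob g yy) \<le> 4 * snd yy" using height_near[OF yy(1) gy g(2)] .
    have "g \<in> T" using til.tile_overlap[OF g(1) gV] g(1) yy(1) yV by simp
    then consider h where "h \<in> Hs" "g = dg h" | j where "j < 4" "g \<in> DC j" unfolding T_iff by blast
    then show "g \<in> dg ` H (1/4) 4 \<union> (\<Union>B\<in>Z. (\<lambda>h. dg (1/h) * adj2 B) ` E B)"
    proof cases
      case 1
      have "1/4 * snd yy \<le> (cmod h)\<^sup>2 * snd yy" "(cmod h)\<^sup>2 * snd yy \<le> 4 * snd yy"
        using hn snd_dg[OF 1(1), of yy] 1(2) by auto
      then have "h \<in> H (1/4) 4" using t 1 by (simp add: H_def)
      then show ?thesis using 1 by blast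
    next
      case 2
      have "mob (adj2 (adj2 g)) yy \<in> V" using gV by simp
      from V_axis[OF DC_adj[OF 2(2,1)] iv_iv(2) yy(1) this]
      obtain m k h where B: "adj2 g = G m k * dg h" "h \<in> Hs" "Fq (mob (adj2 (G m k)) yy) < kap" by blast
      have gg: "g = dg (1/h) * adj2 (G m k)" 
        using arg_cong[OF B(1), of adj2] by (simp add: adj2_mult adj_dg Hs_nz[OF B(2)])
      define w where "w = mob (adj2 (G m k)) yy"
      have "mob g yy = mob (dg (1/h)) w" unfolding gg w_def 
        using Hs_nz[OF B(2)] yy(1) by (simp add: mob_mult det_dg)
      then have "snd (mob g yy) = snd w / (cmod h)\<^sup>2" 
        using snd_dg[OF Hs_inverse[OF B(2)], of w] by (simp add: norm_divide power_divide)
      moreover have "(cmod h)\<^sup>2 > 0" using Hs_nz[OF B(2)] by simp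
      ultimately have "h \<in> E (G m k)" unfolding E_def H_def w_def[symmetric] 
        using hn t B(2) by (simp add: field_simps)
      moreover have "G m k \<in> Z" using B(3) by (auto simp: Z_def)
      ultimately show ?thesis using gg by blast
    qed
  qed
  moreover have "finite (H (1/4) 4)" unfolding H_def by (rule Hs_finite) simp
  moreover have "finite (E B)" if "B \<in> Z" for B
  proof -
    have "det2 B = 1" using that by (auto simp: Z_def)
    then have "snd (mob (adj2 B) yy) > 0" using mob_hyp3[of "adj2 B" yy] yy(1) by (simp add: hyp3_def)
    then show ?thesis unfolding E_def H_def using t by (intro Hs_finite) simp
  qed
  moreover have "finite Z" unfolding Z_def by (rule G_finite[OF yy(1)])
  ultimately show ?thesis by (meson finite_UN_I finite_Un finite_imageI finite_subset)
qed

text \<open>Conjugation by a good representative at \<open>x\<close> brings a whole ball about the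
  point into \<open>V\<close>. Then the minimum over a finite set is taken, and freeness makes it
  positive.\<close>

theorem displacement:
  assumes "x \<in> hyp3"
  shows "\<exists>r>0. \<forall>g\<in>mgen S. g \<noteq> 1 \<longrightarrow> r \<le> hyp3_dist x (mob g x)"
proof -
  obtain g0 where g0: "g0 \<in> mgen S" "til.inV g0 x" using til.tile_cover[OF assms] assms by (auto simp: til.inV_def)
  obtain k where k: "til.sim g0 k x" "\<And>q. q \<in> hyp3 \<Longrightarrow> hyp3_dist x q < 1/50 \<Longrightarrow> til.inV k q"
    using til.good_rep[OF g0] by metis
  have kG: "k \<in> mgen S" using k(1) by (simp add: til.sim_def)
  have dk: "det2 k = 1" using kG by simp
  define yy where "yy = mob (adj2 k) x"
  have yy: "yy \<in> hyp3" using dk assms by (simp add: yy_def mob_hyp3)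
  have yV: "q \<in> V" if "q \<in> hyp3" "hyp3_dist yy q < 1/50" for q
  proof -
    have "hyp3_dist x (mob k q) = hyp3_dist yy q"
      using hyp3_dist_mob[OF dk yy that(1)] dk assms by (simp add: yy_def)
    then have "til.inV k (mob k q)" using k(2)[of "mob k q"] that dk by (simp add: mob_hyp3)
    then show ?thesis using dk that by (simp add: til.inV_def)
  qed
  define F where "F = {g \<in> mgen S. hyp3_dist yy (mob g yy) < 1/50}"
  have F: "finite F" unfolding F_def by (rule small_displacement_finite[OF yy yV])
  define r where "r = Min (insert (1/50) ((\<lambda>g. hyp3_dist yy (mob g yy)) ` (F - {1})))"
  have "hyp3_dist yy (mob g yy) > 0" if "g \<in> F - {1}" for g
  proof -
    have g: "g \<in> mgen S" "g \<noteq> 1" using that by (auto simp: F_def)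
    then have "mob g yy \<noteq> yy" using free_action[OF g(1) yy] by blast
    moreover have "mob g yy \<in> hyp3" using g yy by (simp add: mob_hyp3)
    ultimately show ?thesis using hyp3_dist_0_iff[OF yy, of "mob g yy"] hyp3_dist_nonneg[OF yy, of "mob g yy"] by force
  qed
  then have r: "r > 0" unfolding r_def using F by (subst Min_gr_iff) auto
  have le: "r \<le> hyp3_dist yy (mob g yy)" if "g \<in> mgen S" "g \<noteq> 1" for g
  proof (cases "g \<in> F")
    case True
    then show ?thesis unfolding r_def using F that by (intro Min_le) auto
  next
    case False
    have "r \<le> 1/50" unfolding r_def using F by (intro Min_le) auto
    then show ?thesis using False that by (simp add: F_def)
  qed
  show ?thesis
  proof (intro exI[of _ r] conjI r ballI impI)
    fix g assume g: "g \<in> mgen S" "g \<noteq> 1"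
    define g' where "g' = adj2 k * g * k"
    have dg: "det2 g = 1" using g by simp
    have g': "g' \<in> mgen S" unfolding g'_def using g kG til.adj_Gamma by (intro mgen_mult) auto
    have "g' \<noteq> 1"
    proof
      assume "g' = 1"
      then have "k * g' * adj2 k = 1" using dk by (simp add: adj2_right)
      then show False using g(2) dk by (simp add: g'_def mult.assoc adj2_right_assoc adj2_right)
    qed
    then have "r \<le> hyp3_dist yy (mob g' yy)" using le g' by blast
    also have "mob g' yy = mob (adj2 k) (mob g x)"
      using dk dg assms by (simp add: g'_def yy_def mob_mult det2_mult mob_hyp3)
    also have "hyp3_dist yy \<dots> = hyp3_dist x (mob g x)"
      unfolding yy_def using dk dg assms by (intro hyp3_dist_mob) (auto simp: mob_hyp3)
    finally show "r \<le> hyp3_dist x (mob g x)" .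
  qed
qed

text \<open>After a translation into \<open>V\<close>, powers of \<open>L\<close> bring the height
  into one period of the scaling by exp (Re v), and in the cone \<open>V\<close> the height bounds
  the horizontal coordinate.\<close>

theorem cocompact:
  obtains K where "compact K" "K \<subseteq> hyp3" "\<And>x. x \<in> hyp3 \<Longrightarrow> \<exists>g\<in>mgen S. mob g x \<in> K"
proof
  define c \<Lambda> where "c = \<bar>Re v\<bar>" and "\<Lambda> = exp \<bar>Re v\<bar>"
  have c: "c > 0" using Re_v by (simp add: c_def)
  have "(cmod u)\<^sup>2 \<le> (1/100)\<^sup>2" using u_small by (intro power_mono) auto
  then have k2: "kap \<ge> 2" using cu unfolding kap_def by (simp add: field_simps power2_eq_square)
  define K :: "(complex \<times> real) set" where "K = cball 0 (sqrt (kap - 1) * \<Lambda>) \<times> {1..\<Lambda>}"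
  show "compact K" unfolding K_def by (intro compact_Times) auto
  show "K \<subseteq> hyp3" by (auto simp: K_def hyp3_def)
  fix x assume x: "x \<in> hyp3"
  obtain g where g: "g \<in> mgen S" "mob (adj2 g) x \<in> V" using til.tile_cover[OF x] by blast
  define p where "p = mob (adj2 g) x"
  have p: "p \<in> V" "p \<in> hyp3" using g by (auto simp: p_def V_def)
  have t: "snd p > 0" using p by (simp add: hyp3_def)
  define n where "n = \<lceil>- ln (snd p) / c\<rceil>"
  define i where "i = (if Re v > 0 then n else - n)"
  have iv: "of_int i * Re v = of_int n * c" by (simp add: i_def c_def)
  have "- ln (snd p) / c \<le> of_int n" "of_int n < - ln (snd p) / c + 1" unfolding n_def by linarith+
  then have n: "0 \<le> of_int n * c + ln (snd p)" "of_int n * c + ln (snd p) \<le> c"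
    using c by (auto simp: field_simps)
  have h: "L powi i \<in> Hs" by (auto simp: Hs_def)
  have "snd (mob (dg (L powi i)) p) = exp (of_int n * c + ln (snd p))"
    using t by (simp add: snd_dg[OF h] L_powi_cmod iv exp_add)
  then have s: "1 \<le> snd (mob (dg (L powi i)) p)" "snd (mob (dg (L powi i)) p) \<le> \<Lambda>"
    using n by (simp_all add: \<Lambda>_def c_def)
  have "mob (dg (L powi i)) p \<in> V" using V_dg[OF h p(1)] .
  then have "cmod (fst (mob (dg (L powi i)) p)) \<le> sqrt (kap - 1) * snd (mob (dg (L powi i)) p)" by (simp add: V_alt)
  also have "\<dots> \<le> sqrt (kap - 1) * \<Lambda>" using s k2 by (intro mult_left_mono) auto
  finally have "mob (dg (L powi i)) p \<in> K" using s by (auto simp: K_def mem_Times_iff)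
  moreover have "mob (dg (L powi i)) p = mob (dg (L powi i) * adj2 g) x"
    using g x h by (simp add: p_def mob_mult det_dg Hs_nz)
  moreover have "dg (L powi i) * adj2 g \<in> mgen S"
    using h by (intro mgen_mult[OF til.adj_Gamma[OF g(1)]] mgen_base) (auto simp: S_def)
  ultimately show "\<exists>g\<in>mgen S. mob g x \<in> K" by metis
qed

end


section \<open>Existence of Dehn filling parameters\<close>

lemma om_sq: "om\<^sup>2 = - 1 - om"
  by (simp add: om_def complex_eq_iff power2_eq_square)

lemma om_om: "om * om = - 1 - om" using om_sq by (simp add: power2_eq_square)

lemma om_om': "om * (om * x) = - x - om * x"
  using om_om by (simp add: mult.assoc[symmetric] left_diff_distrib)

text \<open>The quantities of \<open>fig8\<close> as functions of the meridian length
  \<open>u\<close>: \<open>fB\<close> is the sum \<zeta> + 1/\<zeta>, and \<open>fz\<close> is the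
  root \<zeta> that starts at \<open>1 + om\<close>, the value for the complete structure at
  \<open>u = 0\<close>.\<close>

definition fB :: "complex \<Rightarrow> complex" where "fB u = exp u + exp (- u) - 1"
definition fz :: "complex \<Rightarrow> complex" where "fz u = (fB u + \<i> * csqrt (4 - (fB u)\<^sup>2)) / 2"
definition fL :: "complex \<Rightarrow> complex" where "fL u = (fz u - exp u) / (1 - exp u * fz u)"
text \<open>The longitude has eigenvalue -1 at the complete structure. Removing this sign gives a
  logarithm of \<open>(fL u)^2\<close> that vanishes at 0.\<close>

definition fv :: "complex \<Rightarrow> complex" where "fv u = 2 * Ln (- fL u)"
definition fa0 :: "complex \<Rightarrow> complex" where "fa0 u = (exp u * fz u - 1) / (fz u)\<^sup>2"
definition fa2 :: "complex \<Rightarrow> complex" where "fa2 u = (fz u / exp u - 1) / (fz u)\<^sup>2"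
definition fa3 :: "complex \<Rightarrow> complex" where "fa3 u = - (fz u - 1 / exp u)\<^sup>2 / fz u"
definition fb :: "complex \<Rightarrow> nat \<Rightarrow> complex" where
  "fb u j = (if j = 0 then Ln (fa0 u) else if j = 1 then 0 else if j = 2 then Ln (fa2 u) else Ln (fa3 u) + fv u)"

lemma fz_eq: "(fz u)\<^sup>2 + 1 = fB u * fz u"
proof -
  have "2 * fz u - fB u = \<i> * csqrt (4 - (fB u)\<^sup>2)" by (simp add: fz_def field_simps)
  then have "(2 * fz u - fB u)\<^sup>2 = - (4 - (fB u)\<^sup>2)" by (simp only: power_mult_distrib power2_csqrt power2_i) simp
  then have "4 * ((fz u)\<^sup>2 + 1) = 4 * (fB u * fz u)" by (simp add: power2_eq_square algebra_simps)
  then show ?thesis by (subst (asm) mult_left_cancel) simp_all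
qed

lemma csqrt_3: "csqrt 3 = of_real (sqrt 3)"
  using csqrt_of_real_nonneg[of 3] by simp

lemma fz_0: "fz 0 = 1 + om"
  by (simp add: fz_def fB_def csqrt_3 om_def complex_eq_iff)

lemma om_facts: "1 + om \<noteq> 0" "om \<noteq> 0" "(1 + om)\<^sup>2 = om" "1 / (1 + om) = - om" "1 / om = - 1 - om"
proof -
  show o: "om \<noteq> 0" "1 + om \<noteq> 0" by (simp_all add: om_def complex_eq_iff)
  show "(1 + om)\<^sup>2 = om" by (simp add: power2_sum om_sq)
  have "om * (- 1 - om) = 1" by (simp add: algebra_simps om_om om_om')
  then show "1 / om = - 1 - om" using o by (metis nonzero_mult_div_cancel_left)
  have "(1 + om) * (- om) = 1" by (simp add: algebra_simps om_om om_om')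
  then show "1 / (1 + om) = - om" using o by (metis nonzero_mult_div_cancel_left)
qed

lemma fB_deriv: "(fB has_field_derivative (exp u - exp (- u))) (at u)"
  unfolding fB_def by (auto intro!: derivative_eq_intros)

text \<open>Keeps the argument of \<open>csqrt\<close> in \<open>fz\<close> off the branch
  cut.\<close>

definition good :: "complex \<Rightarrow> bool" where "good u \<longleftrightarrow> 4 - (fB u)\<^sup>2 \<notin> \<real>\<^sub>\<le>\<^sub>0"

lemma fz_isCont: "good u \<Longrightarrow> isCont fz u"
  unfolding fz_def good_def
  by (intro continuous_intros isCont_csqrt' DERIV_isCont[OF fB_deriv]) auto

lemma good_0: "good 0"
  by (simp add: good_def fB_def complex_nonpos_Reals_iff)

text \<open>\<open>fB\<close> is even, so \<open>fz\<close> is constant to first order; this makes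
  the subsequent derivatives at 0 short.\<close>

lemma fz_deriv_0: "(fz has_field_derivative 0) (at 0)"
proof -
  have "(fB has_field_derivative 0) (at 0)" using fB_deriv[of 0] by simp
  moreover have "4 - (fB 0)\<^sup>2 \<notin> \<real>\<^sub>\<le>\<^sub>0" using good_0 by (simp add: good_def)
  ultimately show ?thesis unfolding fz_def
    by (auto intro!: derivative_eq_intros)
qed

lemma fL_0: "fL 0 = - 1" by (simp add: fL_def fz_0 om_facts)

lemma fL_deriv_0: "(fL has_field_derivative (- 1 - 2 * om)) (at 0)"
proof -
  have "(fL has_field_derivative (((0 - 1) * (1 - fz 0) - (fz 0 - 1) * (0 - fz 0)) / ((1 - fz 0) * (1 - fz 0)))) (at 0)"
    unfolding fL_def by (auto intro!: derivative_eq_intros fz_deriv_0 simp: fz_0 om_facts)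
  moreover have "((0 - 1) * (1 - fz 0) - (fz 0 - 1) * (0 - fz 0)) / ((1 - fz 0) * (1 - fz 0)) = (2 + om) * (1 / om)"
    using om_facts(2) by (simp add: fz_0 divide_simps) (simp add: algebra_simps power2_eq_square)
  moreover have "(2 + om) * (1 / om) = - 1 - 2 * om" 
    unfolding om_facts by (simp add: algebra_simps om_om om_om')
  ultimately show ?thesis by simp
qed

text \<open>\<open>2 + 4 * om\<close> equals 2 sqrt 3 i, the shape of the cusp of the figure-eight
  knot complement.\<close>

lemma fv_deriv_0: "(fv has_field_derivative (2 + 4 * om)) (at 0)"
  unfolding fv_def by (auto intro!: derivative_eq_intros fL_deriv_0 simp: fL_0 complex_nonpos_Reals_iff)

lemma fv_0: "fv 0 = 0" by (simp add: fv_def fL_0)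

lemma fa_0: "fa0 0 = 1" "fa2 0 = 1" "fa3 0 = 1"
proof -
  show "fa0 0 = 1" "fa2 0 = 1" by (simp_all add: fa0_def fa2_def fz_0 om_facts)
  have "- om\<^sup>2 = 1 + om" by (simp add: om_sq)
  then show "fa3 0 = 1" by (simp add: fa3_def fz_0 om_facts)
qed

lemma fa0_deriv: "(fa0 has_field_derivative (- om)) (at 0)"
proof -
  have "(fa0 has_field_derivative (fz 0 * (fz 0)\<^sup>2 / ((fz 0)\<^sup>2 * (fz 0)\<^sup>2))) (at 0)"
    unfolding fa0_def by (auto intro!: derivative_eq_intros fz_deriv_0 simp: fz_0 om_facts)
  moreover have "fz 0 * (fz 0)\<^sup>2 / ((fz 0)\<^sup>2 * (fz 0)\<^sup>2) = 1 / fz 0" by (simp add: power2_eq_square)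
  ultimately show ?thesis by (simp add: fz_0 om_facts)
qed

lemma fa2_deriv: "(fa2 has_field_derivative om) (at 0)"
proof -
  have "(fa2 has_field_derivative (- fz 0 * (fz 0)\<^sup>2 / ((fz 0)\<^sup>2 * (fz 0)\<^sup>2))) (at 0)"
    unfolding fa2_def by (auto intro!: derivative_eq_intros fz_deriv_0 simp: fz_0 om_facts)
  moreover have "- fz 0 * (fz 0)\<^sup>2 / ((fz 0)\<^sup>2 * (fz 0)\<^sup>2) = - (1 / fz 0)" by (simp add: power2_eq_square)
  ultimately show ?thesis by (simp add: fz_0 om_facts)
qed

lemma fa3_deriv: "(fa3 has_field_derivative (- 2 - 2 * om)) (at 0)"
proof -
  have "(fa3 has_field_derivative (- (2 * (fz 0 - 1)) * fz 0 / (fz 0 * fz 0))) (at 0)"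
    unfolding fa3_def by (auto intro!: derivative_eq_intros fz_deriv_0 simp: fz_0 om_facts)
  moreover have "- (2 * (fz 0 - 1)) * fz 0 / (fz 0 * fz 0) = - 2 * om * (1 / (1 + om))" 
    using om_facts(1) by (simp add: fz_0)
  moreover have "- 2 * om * (1 / (1 + om)) = - 2 - 2 * om" 
    unfolding om_facts by (simp add: algebra_simps om_om om_om')
  ultimately show ?thesis by simp
qed

lemma quotient_near:
  fixes f :: "complex \<Rightarrow> complex"
  assumes "(f has_field_derivative c) (at 0)" "f 0 = 0" "r > 0"
  shows "\<forall>\<^sub>F u in at 0. cmod (f u / u - c) \<le> r"
proof -
  have "((\<lambda>u. f u / u) \<longlongrightarrow> c) (at 0)"
    using assms(1,2) by (simp add: has_field_derivative_iff)
  from tendstoD[OF this assms(3)] show ?thesis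
    by eventually_elim (simp add: dist_norm)
qed

lemma fb_near:
  assumes "j < 4"
  shows "\<forall>\<^sub>F u in at 0. cmod (fb u j / u - (of_nat j - 1) * om) \<le> 1/100"
proof -
  have "((\<lambda>u. Ln (fa0 u)) has_field_derivative (- om)) (at 0)"
    by (auto intro!: derivative_eq_intros fa0_deriv simp: fa_0 complex_nonpos_Reals_iff)
  moreover have "((\<lambda>u. Ln (fa2 u)) has_field_derivative om) (at 0)"
    by (auto intro!: derivative_eq_intros fa2_deriv simp: fa_0 complex_nonpos_Reals_iff)
  \<comment> \<open>Adding \<open>fv\<close> turns the slope \<open>- 2 - 2 * om\<close> into
    \<open>2 * om\<close>, which places this row directly after row 2.\<close>
  moreover have "((\<lambda>u. Ln (fa3 u) + fv u) has_field_derivative (2 * om)) (at 0)"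
    by (auto intro!: derivative_eq_intros fa3_deriv fv_deriv_0 simp: fa_0 complex_nonpos_Reals_iff)
  moreover have "j = 0 \<or> j = 1 \<or> j = 2 \<or> j = 3" using assms by linarith
  ultimately have "((\<lambda>u. fb u j) has_field_derivative ((of_nat j - 1) * om)) (at 0)"
    by (elim disjE) (simp_all add: fb_def)
  moreover have "fb 0 j = 0" by (simp add: fb_def fa_0 fv_0)
  ultimately show ?thesis by (rule quotient_near) simp
qed

lemma fz_tendsto: "(fz \<longlongrightarrow> 1 + om) (at 0)"
  using DERIV_isCont[OF fz_deriv_0] by (simp add: isCont_def fz_0)

lemma cmod_1om: "cmod (1 + om) = 1"
proof -
  have "(cmod (1 + om))\<^sup>2 = 1" using cmod_om[of 1 1] by simp
  then show ?thesis using norm_ge_zero[of "1 + om"] by (auto simp: power2_eq_1_iff)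
qed

lemma exp_quotient: "((\<lambda>u. (exp u + exp (- u) - 2) / u\<^sup>2) \<longlongrightarrow> (1::complex)) (at 0)"
proof -
  have "((exp :: complex \<Rightarrow> complex) has_field_derivative 1) (at 0)"
    using DERIV_exp[of "0::complex"] by simp
  then have "((\<lambda>u. (exp u - 1) / u) \<longlongrightarrow> (1::complex)) (at 0)"
    by (simp add: has_field_derivative_iff)
  moreover have "((\<lambda>u. exp (- u)) \<longlongrightarrow> exp (- 0)) (at (0::complex))" by (intro tendsto_intros)
  ultimately have "((\<lambda>u. exp (- u) * ((exp u - 1) / u)\<^sup>2) \<longlongrightarrow> exp (- 0) * (1::complex)\<^sup>2) (at 0)"
    by (intro tendsto_intros)
  moreover have "exp (- u) * ((exp u - 1) / u)\<^sup>2 = (exp u + exp (- u) - 2) / u\<^sup>2" for u :: complex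
  proof -
    have "exp (- u) * (exp u - 1)\<^sup>2 = exp u + exp (- u) - 2"
      by (simp add: power2_eq_square algebra_simps exp_minus_inverse)
    then show ?thesis by (simp add: power_divide)
  qed
  ultimately show ?thesis by simp
qed

text \<open>The first factor is \<open>(M - 1 / M)^2\<close>, which is u^2 to leading order, and the
  other factor has modulus close to 1.\<close>

lemma theta_near:
  assumes "(g \<longlongrightarrow> l) (at 0)" "cmod l = 1"
  shows "\<forall>\<^sub>F u in at 0. 99/100 * (cmod u)\<^sup>2 \<le> cmod ((exp u + exp (- u) - 2) * g u) \<and>
    cmod ((exp u + exp (- u) - 2) * g u) \<le> 101/100 * (cmod u)\<^sup>2"
proof -
  have "((\<lambda>u. cmod ((exp u + exp (- u) - 2) / u\<^sup>2 * g u)) \<longlongrightarrow> cmod (1 * l)) (at 0)"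
    by (intro tendsto_intros exp_quotient assms)
  then have "((\<lambda>u. cmod ((exp u + exp (- u) - 2) / u\<^sup>2 * g u)) \<longlongrightarrow> 1) (at 0)" using assms by simp
  from tendstoD[OF this, of "1/100"]
  have "\<forall>\<^sub>F u in at 0. \<bar>cmod ((exp u + exp (- u) - 2) / u\<^sup>2 * g u) - 1\<bar> < 1/100" by (simp add: dist_real_def)
  moreover have "\<forall>\<^sub>F u in at (0::complex). u \<noteq> 0" by (simp add: eventually_at_filter)
  ultimately show ?thesis
  proof eventually_elim
    case (elim u)
    define X where "X = cmod ((exp u + exp (- u) - 2) * g u)"
    have u: "(cmod u)\<^sup>2 > 0" using elim by simp
    have "cmod ((exp u + exp (- u) - 2) / u\<^sup>2 * g u) = X / (cmod u)\<^sup>2"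
      by (simp add: X_def norm_mult norm_divide norm_power)
    then have "\<bar>X / (cmod u)\<^sup>2 - 1\<bar> < 1/100" using elim(1) by simp
    then have "99/100 \<le> X / (cmod u)\<^sup>2" "X / (cmod u)\<^sup>2 \<le> 101/100" by linarith+
    then show ?case using u unfolding X_def[symmetric] by (simp add: pos_le_divide_eq pos_divide_le_eq)
  qed
qed

lemma fv_isCont: "\<forall>\<^sub>F u in at 0. isCont fv u"
proof -
  have B: "isCont fB u" for u using fB_deriv DERIV_isCont by blast
  have "open (- \<real>\<^sub>\<le>\<^sub>0 :: complex set)" by (simp add: closed_nonpos_Reals_complex open_Compl)
  moreover have "((\<lambda>u. 4 - (fB u)\<^sup>2) \<longlongrightarrow> 4 - (fB 0)\<^sup>2) (at 0)"
    using B[of 0] unfolding isCont_def by (intro tendsto_intros)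
  ultimately have "\<forall>\<^sub>F u in at 0. 4 - (fB u)\<^sup>2 \<in> - \<real>\<^sub>\<le>\<^sub>0"
    using good_0 by (intro topological_tendstoD) (auto simp: good_def)
  moreover have "\<forall>\<^sub>F u in at 0. - fL u \<in> - \<real>\<^sub>\<le>\<^sub>0"
  proof -
    have "isCont fL 0" using fL_deriv_0 DERIV_isCont by blast
    then have "((\<lambda>u. - fL u) \<longlongrightarrow> - fL 0) (at 0)" unfolding isCont_def by (intro tendsto_intros)
    then show ?thesis using \<open>open (- \<real>\<^sub>\<le>\<^sub>0)\<close> by (intro topological_tendstoD) (auto simp: fL_0 complex_nonpos_Reals_iff)
  qed
  ultimately show ?thesis
  proof eventually_elim
    case (elim u)
    have z: "isCont fz u" using fz_isCont[of u] elim(1) by (simp add: good_def)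
    have "1 - exp u * fz u \<noteq> 0" using elim(2) by (auto simp: fL_def)
    then have "isCont fL u" unfolding fL_def using z by (intro continuous_intros)
    then show ?case unfolding fv_def using elim(2) by (intro continuous_intros isCont_Ln') auto
  qed
qed

text \<open>With \<open>\<tau> = v / u\<close> the filling equation reads
  \<open>u = 2 pi i / (1 + N \<tau>)\<close>. As \<tau> is continuous and stays away from the reals
  near 0, the right-hand side maps a fixed small disc into itself for large \<open>N\<close>, and
  Brouwer's theorem gives a solution.\<close>

theorem fig8_exists:
  obtains N0 where "\<And>N. N \<ge> N0 \<Longrightarrow> \<exists>M \<zeta> u v b. fig8 M \<zeta> u v b N"
proof -
  define P where "P = (\<lambda>u. isCont fv u \<and> (\<forall>j<4. cmod (fb u j / u - (of_nat j - 1) * om) \<le> 1/100)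
    \<and> cmod (fv u / u - (2 + 4 * om)) \<le> 1/100 \<and> fa0 u \<noteq> 0 \<and> fa2 u \<noteq> 0 \<and> fa3 u \<noteq> 0 \<and> fL u \<noteq> 0 \<and> (fz u)\<^sup>2 \<noteq> 1
    \<and> (99/100 * (cmod u)\<^sup>2 \<le> cmod ((exp u + exp (- u) - 2) * fz u) \<and>
       cmod ((exp u + exp (- u) - 2) * fz u) \<le> 101/100 * (cmod u)\<^sup>2)
    \<and> (99/100 * (cmod u)\<^sup>2 \<le> cmod ((exp u + exp (- u) - 2) * (1 / fz u)) \<and>
       cmod ((exp u + exp (- u) - 2) * (1 / fz u)) \<le> 101/100 * (cmod u)\<^sup>2))"
  have ne: "\<forall>\<^sub>F u in at 0. f u \<noteq> 0" if "(f has_field_derivative d) (at 0)" "f 0 \<noteq> 0" for f :: "complex \<Rightarrow> complex" and d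
    using DERIV_isCont[OF that(1)] that(2) unfolding isCont_def by (rule tendsto_imp_eventually_ne)
  have "\<forall>\<^sub>F u in at 0. \<forall>j<4. cmod (fb u j / u - (of_nat j - 1) * om) \<le> 1/100"
    using fb_near by (simp add: eventually_ball_finite_distrib flip: lessThan_iff Ball_def)
  moreover have "\<forall>\<^sub>F u in at 0. (fz u)\<^sup>2 \<noteq> 1"
  proof -
    have "((\<lambda>u. (fz u)\<^sup>2) \<longlongrightarrow> (1 + om)\<^sup>2) (at 0)" by (intro tendsto_intros fz_tendsto)
    then show ?thesis by (rule tendsto_imp_eventually_ne) (simp add: om_facts, simp add: om_def complex_eq_iff)
  qed
  moreover have "cmod (1 / (1 + om)) = 1" by (simp add: norm_divide cmod_1om)
  then have "\<forall>\<^sub>F u in at 0. 99/100 * (cmod u)\<^sup>2 \<le> cmod ((exp u + exp (- u) - 2) * (1 / fz u)) \<and>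
    cmod ((exp u + exp (- u) - 2) * (1 / fz u)) \<le> 101/100 * (cmod u)\<^sup>2"
    by (intro theta_near[where l = "1 / (1 + om)"] tendsto_intros fz_tendsto om_facts)
  moreover note fv_isCont theta_near[OF fz_tendsto cmod_1om]
  moreover have "\<forall>\<^sub>F u in at 0. cmod (fv u / u - (2 + 4 * om)) \<le> 1/100"
    by (rule quotient_near[OF fv_deriv_0 fv_0]) simp
  moreover have "\<forall>\<^sub>F u in at 0. fa0 u \<noteq> 0" "\<forall>\<^sub>F u in at 0. fa2 u \<noteq> 0" "\<forall>\<^sub>F u in at 0. fa3 u \<noteq> 0" "\<forall>\<^sub>F u in at 0. fL u \<noteq> 0"
    using ne[OF fa0_deriv] ne[OF fa2_deriv] ne[OF fa3_deriv] ne[OF fL_deriv_0] by (simp_all add: fa_0 fL_0)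
  ultimately have "\<forall>\<^sub>F u in at 0. P u"
    unfolding P_def by eventually_elim blast
  then obtain \<rho> where \<rho>: "\<rho> > 0" "\<And>u. u \<noteq> 0 \<Longrightarrow> cmod u < \<rho> \<Longrightarrow> P u"
    by (auto simp: eventually_at dist_norm)
  define r where "r = min (\<rho> / 2) (1/100)"
  have r: "r > 0" "r < \<rho>" "r \<le> 1/100" using \<rho> by (auto simp: r_def)
  \<comment> \<open>The modulus of \<open>F\<close> will be at most 2 pi / (3 N), hence at most
    \<open>r\<close> as soon as \<open>N\<close> is at least pi / r.\<close>
  define N0 where "N0 = nat \<lceil>pi / r\<rceil> + 1"
  show thesis
  proof
    fix N assume N: "N \<ge> N0"
    have Nr: "pi / r \<le> real N" "real N \<ge> 1" using N by (auto simp: N0_def) linarith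
    define \<tau> where "\<tau> = (\<lambda>u. if u = 0 then 2 + 4 * om else fv u / u)"
    define F where "F = (\<lambda>u. 2 * of_real pi * \<i> / (1 + of_nat N * \<tau> u))"
    have \<tau>: "cmod (\<tau> u - (2 + 4 * om)) \<le> 1/100" if "u \<in> cball 0 r" for u
      using \<rho>(2)[of u] that r by (auto simp: \<tau>_def P_def dist_norm)
    have Im\<tau>: "Im (\<tau> u) \<ge> 3" if "u \<in> cball 0 r" for u
    proof -
      have "sqrt 3 \<ge> 16/10" by (rule real_le_rsqrt) (simp add: power2_eq_square)
      moreover have "\<bar>Im (\<tau> u - (2 + 4 * om))\<bar> \<le> 1/100" using \<tau>[OF that] abs_Im_le_cmod order_trans by blast
      moreover have "Im (\<tau> u - (2 + 4 * om)) = Im (\<tau> u) - 2 * sqrt 3" by (simp add: om_def)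
      ultimately show ?thesis by linarith
    qed
    have den: "cmod (1 + of_nat N * \<tau> u) \<ge> 3 * real N" if "u \<in> cball 0 r" for u
    proof -
      have "3 * real N \<le> real N * Im (\<tau> u)" using Im\<tau>[OF that] by (simp add: mult.commute mult_left_mono)
      also have "\<dots> = Im (1 + of_nat N * \<tau> u)" by simp
      also have "\<dots> \<le> cmod (1 + of_nat N * \<tau> u)" using abs_Im_le_cmod abs_ge_self order_trans by blast
      finally show ?thesis .
    qed
    have den0: "1 + of_nat N * \<tau> u \<noteq> 0" if "u \<in> cball 0 r" for u using den[OF that] Nr by auto
    have "isCont \<tau> u" if "u \<in> cball 0 r" for u
    proof (cases "u = 0")
      case True
      have "((\<lambda>u. fv u / u) \<longlongrightarrow> 2 + 4 * om) (at 0)" using fv_deriv_0 fv_0 by (simp add: has_field_derivative_iff)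
      moreover have "\<forall>\<^sub>F u in at 0. fv u / u = \<tau> u" by (auto simp: eventually_at_filter \<tau>_def)
      ultimately have "(\<tau> \<longlongrightarrow> 2 + 4 * om) (at 0)" by (rule Lim_transform_eventually)
      then show ?thesis using True by (simp add: isCont_def \<tau>_def)
    next
      case False
      have "P u" using \<rho>(2)[of u] that r False by (simp add: dist_norm)
      then have "isCont (\<lambda>u. fv u / u) u" using False unfolding P_def by (intro continuous_intros) auto
      moreover have "\<forall>\<^sub>F w in nhds u. fv w / w = \<tau> w"
        using t1_space_nhds[OF False] by eventually_elim (simp add: \<tau>_def)
      ultimately show ?thesis using isCont_cong by fast
    qed
    then have "continuous_on (cball 0 r) \<tau>" by (simp add: continuous_at_imp_continuous_on)
    then have "continuous_on (cball 0 r) F" unfolding F_def using den0 by (intro continuous_intros) auto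
    moreover have "F \<in> cball 0 r \<rightarrow> cball 0 r"
    proof
      fix u :: complex assume u: "u \<in> cball 0 r"
      have "cmod (F u) = 2 * pi / cmod (1 + of_nat N * \<tau> u)" by (simp add: F_def norm_divide norm_mult)
      also have "\<dots> \<le> 2 * pi / (3 * real N)" using den[OF u] Nr by (intro divide_left_mono mult_pos_pos) auto
      also have "\<dots> \<le> pi / real N" using Nr by (simp add: field_simps)
      also have "\<dots> \<le> r" using Nr r by (simp add: field_simps)
      finally show "F u \<in> cball 0 r" by simp
    qed
    ultimately obtain u where u: "u \<in> cball 0 r" "F u = u" using brouwer_ball[OF r(1)] by metis
    have u0: "u \<noteq> 0" using u(2) den0[OF u(1)] by (auto simp: F_def)
    have P: "P u" using \<rho>(2)[OF u0] u(1) r by simp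
    have Pb: "\<forall>j<4. cmod (fb u j / u - (of_nat j - 1) * om) \<le> 1/100"
      and Pv: "cmod (fv u / u - (2 + 4 * om)) \<le> 1/100" and Pne: "fa0 u \<noteq> 0" "fa2 u \<noteq> 0" "fa3 u \<noteq> 0" "fL u \<noteq> 0" "(fz u)\<^sup>2 \<noteq> 1"
      and Pth: "99/100 * (cmod u)\<^sup>2 \<le> cmod ((exp u + exp (- u) - 2) * fz u)"
       "cmod ((exp u + exp (- u) - 2) * fz u) \<le> 101/100 * (cmod u)\<^sup>2"
       "99/100 * (cmod u)\<^sup>2 \<le> cmod ((exp u + exp (- u) - 2) * (1 / fz u))"
       "cmod ((exp u + exp (- u) - 2) * (1 / fz u)) \<le> 101/100 * (cmod u)\<^sup>2"
      using P unfolding P_def by blast+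
    define v where "v = fv u"
    define L where "L = fL u"
    \<comment> \<open>Taking \<open>M\<close> from \<open>L\<close>, and not as a square root of
      \<open>exp u\<close>, fixes the sign in \<open>L ^ N * M = 1\<close>.\<close>
    define M where "M = 1 / L ^ N"
    have uv: "u + of_nat N * v = 2 * of_real pi * \<i>"
    proof -
      have "2 * of_real pi * \<i> = u * (1 + of_nat N * \<tau> u)"
        using u(2) den0[OF u(1)] by (simp add: F_def divide_eq_eq)
      also have "\<dots> = u + of_nat N * v" using u0 by (simp add: \<tau>_def v_def distrib_left)
      finally show ?thesis by simp
    qed
    have L0: "L \<noteq> 0" using Pne by (simp add: L_def)
    have ev: "exp v = L\<^sup>2" using L0 by (simp add: v_def fv_def L_def exp_double)
    have M: "M\<^sup>2 = exp u"
    proof -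
      have "exp u * (exp v) ^ N = 1" using arg_cong[OF uv, of exp] by (simp add: exp_add exp_of_nat_mult)
      then show ?thesis using L0 by (simp add: ev M_def power_divide power_mult[symmetric] mult.commute field_simps)
    qed
    have M0: "M \<noteq> 0" using L0 by (simp add: M_def)
    have Mi: "(1 / M)\<^sup>2 = exp (- u)" by (simp add: power_divide M exp_minus inverse_eq_divide)
    have MM: "(M - 1 / M)\<^sup>2 = exp u + exp (- u) - 2"
      using M0 M Mi by (simp add: power2_diff)
    \<comment> \<open>If \<open>v\<close> were imaginary, the filling equation would make
      \<open>u\<close> imaginary too, and \<open>v / u\<close> would be real.\<close>
    have ReV: "Re v \<noteq> 0"
    proof
      assume "Re v = 0"
      then have "Re u = 0" using arg_cong[OF uv, of Re] by simp
      moreover have "v = \<tau> u * u" using u0 by (simp add: \<tau>_def v_def)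
      ultimately have "Re v = - Im (\<tau> u) * Im u" by simp
      then show False using \<open>Re v = 0\<close> \<open>Re u = 0\<close> u0 Im\<tau>[OF u(1)] by (auto simp: complex_eq_iff)
    qed
    have "fig8 M (fz u) u v (fb u) N"
    proof
      show "M\<^sup>2 = exp u" by (rule M)
      have "0 < 99/100 * (cmod u)\<^sup>2" using u0 by simp
      also have "\<dots> \<le> cmod ((exp u + exp (- u) - 2) * fz u)" by (rule Pth)
      finally have "cmod ((exp u + exp (- u) - 2) * fz u) > 0" .
      then show "M\<^sup>2 \<noteq> 1" unfolding M by (auto simp: exp_minus)
      show "(fz u)\<^sup>2 + 1 = (M\<^sup>2 + (1 / M)\<^sup>2 - 1) * fz u" unfolding M Mi by (simp add: fz_eq fB_def)
      show "(fz u)\<^sup>2 \<noteq> 1" by (rule Pne)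
      show "((fz u - M\<^sup>2) / (1 - M\<^sup>2 * fz u))\<^sup>2 = exp v" unfolding ev M by (simp add: L_def fL_def)
      show "((fz u - M\<^sup>2) / (1 - M\<^sup>2 * fz u)) ^ N * M = 1" unfolding M using L0 by (simp add: M_def L_def fL_def)
      show "cmod ((v - 2 * u) / u - 4 * om) \<le> 1 / 100"
      proof -
        have "(v - 2 * u) / u - 4 * om = fv u / u - (2 + 4 * om)" using u0 by (simp add: v_def diff_divide_distrib)
        then show ?thesis using Pv by (simp only:)
      qed
      show "exp (fb u 0) = (M\<^sup>2 * fz u - 1) / (fz u)\<^sup>2" using Pne unfolding M by (simp add: fb_def) (simp add: fa0_def)
      show "exp (fb u 2) = (fz u / M\<^sup>2 - 1) / (fz u)\<^sup>2" using Pne unfolding M by (simp add: fb_def) (simp add: fa2_def)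
      show "exp (fb u 3) = - (fz u - 1 / M\<^sup>2)\<^sup>2 / fz u * exp v" using Pne unfolding M by (simp add: fb_def exp_add v_def) (simp add: fa3_def)
      show "cmod u \<le> 1/100" using u(1) r by simp
      show "cmod (fb u j / u - (of_nat j - 1) * om) \<le> 1/100" if "j < 4" for j using Pb that by blast
    qed (use u0 uv ReV Pth in \<open>simp_all add: MM fb_def\<close>)
    then show "\<exists>M \<zeta> u v b. fig8 M \<zeta> u v b N" by blast
  qed
qed


section \<open>The quotient of hyperbolic space by a uniform lattice without torsion\<close>

text \<open>Together with \<open>hyp3_dist_small\<close> it shows that the hyperbolic and the
  Euclidean topology agree.\<close>

lemma hyp3_dist_large:
  assumes "p \<in> hyp3" "e > 0"
  obtains d where "d > 0" "\<And>q. q \<in> hyp3 \<Longrightarrow> hyp3_dist p q < d \<Longrightarrow> dist p q < e"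
proof -
  define s where "s = snd p"
  have s: "s > 0" using assms by (simp add: hyp3_def s_def)
  define \<eta> where "\<eta> = min 1 (e\<^sup>2 / (16 * s\<^sup>2))"
  have \<eta>: "0 < \<eta>" "\<eta> \<le> 1" "\<eta> * (16 * s\<^sup>2) \<le> e\<^sup>2"
  proof -
    show "0 < \<eta>" "\<eta> \<le> 1" using s assms by (auto simp: \<eta>_def)
    have "\<eta> \<le> e\<^sup>2 / (16 * s\<^sup>2)" by (simp add: \<eta>_def)
    then show "\<eta> * (16 * s\<^sup>2) \<le> e\<^sup>2" using s by (simp add: pos_le_divide_eq)
  qed
  show thesis
  proof (rule that[of "arcosh (1 + \<eta>)"])
    show "arcosh (1 + \<eta>) > 0" using \<eta> by simp
    fix q assume q: "q \<in> hyp3" "hyp3_dist p q < arcosh (1 + \<eta>)"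
    define t where "t = snd q"
    have t: "t > 0" using q by (simp add: hyp3_def t_def)
    have "cosh (hyp3_dist p q) < cosh (arcosh (1 + \<eta>))"
      using q \<eta> hyp3_dist_nonneg[OF assms(1) q(1)] by (subst cosh_real_nonneg_less_iff) auto
    then have c: "chd p q < 1 + \<eta>" using cosh_hyp3_dist[OF assms(1) q(1)] \<eta> by simp
    have d: "1 + (dist p q)\<^sup>2 / (2 * s * t) = chd p q" using chd_eq[OF assms(1) q(1)] by (simp add: s_def t_def)
    have "(dist p q)\<^sup>2 / (2 * s * t) < \<eta>" using c d by linarith
    then have d2: "(dist p q)\<^sup>2 < \<eta> * (2 * s * t)" using s t by (simp add: pos_divide_less_eq)
    have "(t - s)\<^sup>2 \<le> (dist p q)\<^sup>2"
    proof (rule power2_le_iff_abs_le[THEN iffD2])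
      show "\<bar>t - s\<bar> \<le> dist p q" using dist_snd_le[of p q] by (simp add: s_def t_def dist_real_def abs_minus_commute)
    qed simp
    also have "\<dots> \<le> \<eta> * (2 * s * t)" using d2 by simp
    also have "\<dots> \<le> 1 * (2 * s * t)" using \<eta> s t by (intro mult_right_mono) auto
    finally have "t\<^sup>2 + s\<^sup>2 \<le> 4 * s * t" unfolding power2_diff by (simp add: algebra_simps)
    then have "t\<^sup>2 \<le> 4 * s * t" using zero_le_power2[of s] by linarith
    then have "t * t \<le> t * (4 * s)" by (simp add: power2_eq_square mult_ac)
    \<comment> \<open>With the height of \<open>q\<close> bounded in terms of that of
      \<open>p\<close>, the factor between \<open>chd\<close> and the squared Euclidean distance is
      bounded.\<close>
    then have "t \<le> 4 * s" using t by simp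
    then have "\<eta> * (2 * s * t) \<le> \<eta> * (2 * s * (4 * s))" using \<eta> s by (intro mult_left_mono) auto
    also have "\<dots> \<le> \<eta> * (16 * s\<^sup>2)" using \<eta> s by (intro mult_left_mono) (auto simp: power2_eq_square)
    finally have "(dist p q)\<^sup>2 < e\<^sup>2" using d2 \<eta>(3) by (meson less_le_trans)
    then show "dist p q < e" using assms by (auto intro: power_less_imp_less_base[of _ 2])
  qed
qed

lemma continuous_on_mob: 
  assumes "det2 A = 1" shows "continuous_on hyp3 (mob A)"
  unfolding continuous_on_iff
proof (intro ballI allI impI)
  fix p e assume p: "p \<in> hyp3" and e: "(e::real) > 0"
  obtain d' where d': "d' > 0" "\<And>q. q \<in> hyp3 \<Longrightarrow> hyp3_dist (mob A p) q < d' \<Longrightarrow> dist (mob A p) q < e"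
    using hyp3_dist_large[OF mob_hyp3[OF assms p] e] by blast
  obtain d where d: "d > 0" "\<And>q. q \<in> hyp3 \<Longrightarrow> dist p q < d \<Longrightarrow> hyp3_dist p q < d'"
    using hyp3_dist_small[OF p d'(1)] by blast
  show "\<exists>d>0. \<forall>q\<in>hyp3. dist q p < d \<longrightarrow> dist (mob A q) (mob A p) < e"
    using d d' assms p by (intro exI[of _ d]) (auto simp: dist_commute hyp3_dist_mob mob_hyp3)
qed

locale kleinian =
  fixes \<Gamma> :: "m2 set"
  assumes det: "g \<in> \<Gamma> \<Longrightarrow> det2 g = 1" and one: "1 \<in> \<Gamma>"
    and mult: "g \<in> \<Gamma> \<Longrightarrow> h \<in> \<Gamma> \<Longrightarrow> g * h \<in> \<Gamma>" and adj: "g \<in> \<Gamma> \<Longrightarrow> adj2 g \<in> \<Gamma>"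
    and displacement: "x \<in> hyp3 \<Longrightarrow> \<exists>r>0. \<forall>g\<in>\<Gamma>. g \<noteq> 1 \<longrightarrow> r \<le> hyp3_dist x (mob g x)"
    and cocompact: "\<exists>K. compact K \<and> K \<subseteq> hyp3 \<and> (\<forall>x\<in>hyp3. \<exists>g\<in>\<Gamma>. mob g x \<in> K)"
begin

declare det [simp]

lemma mob_Gamma [simp]: "g \<in> \<Gamma> \<Longrightarrow> x \<in> hyp3 \<Longrightarrow> mob g x \<in> hyp3"
  by (simp add: mob_hyp3)

text \<open>Moving a point by at most r/4 changes its displacement by at most r/2, so finitely many
  balls settle a compact set; conjugation carries the bound to all of hyperbolic space.\<close>

lemma uniform_displacement:
  obtains r where "r > 0" "\<And>x g. x \<in> hyp3 \<Longrightarrow> g \<in> \<Gamma> \<Longrightarrow> g \<noteq> 1 \<Longrightarrow> r \<le> hyp3_dist x (mob g x)"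
proof -
  obtain K where K: "compact K" "K \<subseteq> hyp3" "\<And>x. x \<in> hyp3 \<Longrightarrow> \<exists>g\<in>\<Gamma>. mob g x \<in> K" using cocompact by blast
  have "\<forall>x\<in>hyp3. \<exists>r. r > 0 \<and> (\<forall>g\<in>\<Gamma>. g \<noteq> 1 \<longrightarrow> r \<le> hyp3_dist x (mob g x))" using displacement by blast
  then obtain r where r: "\<And>x. x \<in> hyp3 \<Longrightarrow> r x > 0" 
    "\<And>x g. x \<in> hyp3 \<Longrightarrow> g \<in> \<Gamma> \<Longrightarrow> g \<noteq> 1 \<Longrightarrow> r x \<le> hyp3_dist x (mob g x)" by metis
  have "\<forall>x\<in>hyp3. \<exists>d>0. \<forall>q. q \<in> hyp3 \<longrightarrow> dist x q < d \<longrightarrow> hyp3_dist x q < r x / 4"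
    using hyp3_dist_small r(1) by (metis zero_less_divide_iff zero_less_numeral)
  then obtain d where d: "\<And>x. x \<in> hyp3 \<Longrightarrow> d x > 0" 
    "\<And>x q. x \<in> hyp3 \<Longrightarrow> q \<in> hyp3 \<Longrightarrow> dist x q < d x \<Longrightarrow> hyp3_dist x q < r x / 4" by metis
  have "K \<subseteq> (\<Union>x\<in>K. ball x (d x))" using d(1) K(2) centre_in_ball by blast
  then obtain F where F: "F \<subseteq> K" "finite F" "K \<subseteq> (\<Union>x\<in>F. ball x (d x))"
    using compactE_image[OF K(1), of K "\<lambda>x. ball x (d x)"] by blast
  define R where "R = Min (insert 1 ((\<lambda>x. r x / 2) ` F))"
  have R: "R > 0" unfolding R_def using F K(2) r(1) by (subst Min_gr_iff) auto
  have inK: "R \<le> hyp3_dist q (mob g q)" if "q \<in> K" "g \<in> \<Gamma>" "g \<noteq> 1" for q g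
  proof -
    have "q \<in> (\<Union>x\<in>F. ball x (d x))" using F(3) that(1) by (rule subsetD)
    then obtain x where "x \<in> F" "q \<in> ball x (d x)" by (rule UN_E)
    then have x: "x \<in> F" "dist x q < d x" by simp_all
    have h: "x \<in> hyp3" "q \<in> hyp3" using x F K(2) that by auto
    have "r x \<le> hyp3_dist x (mob g x)" using r(2) h that by blast
    also have "\<dots> \<le> hyp3_dist x q + hyp3_dist q (mob g x)"
      using h that by (intro hyp3_dist_triangle) auto
    also have "hyp3_dist q (mob g x) \<le> hyp3_dist q (mob g q) + hyp3_dist (mob g q) (mob g x)"
      using h that by (intro hyp3_dist_triangle) auto
    also have "hyp3_dist (mob g q) (mob g x) = hyp3_dist x q"
      using h that by (simp add: hyp3_dist_mob hyp3_dist_sym[of q])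
    finally have "r x / 2 \<le> hyp3_dist q (mob g q)" using d(2)[OF h x(2)] by simp
    moreover have "R \<le> r x / 2" unfolding R_def using F x by (intro Min_le) auto
    ultimately show ?thesis by linarith
  qed
  show thesis
  proof (rule that[OF R])
    fix x g assume x: "x \<in> hyp3" and g: "g \<in> \<Gamma>" "g \<noteq> 1"
    obtain k where k: "k \<in> \<Gamma>" "mob k x \<in> K" using K(3)[OF x] by blast
    have "k * g * adj2 k \<noteq> 1"
    proof
      assume "k * g * adj2 k = 1"
      then have "adj2 k * (k * g * adj2 k) * k = 1" using k by (simp add: adj2_left)
      then show False using g k by (simp add: mult.assoc adj2_left adj2_left_assoc)
    qed
    then have "R \<le> hyp3_dist (mob k x) (mob (k * g * adj2 k) (mob k x))"
      using k g by (intro inK mult adj) auto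
    also have "mob (k * g * adj2 k) (mob k x) = mob k (mob g x)"
      using k g x by (simp add: mob_mult det2_mult)
    finally show "R \<le> hyp3_dist x (mob g x)" using k g x by (simp add: hyp3_dist_mob)
  qed
qed

definition r0 :: real where
  "r0 = (SOME r. r > 0 \<and> (\<forall>x g. x \<in> hyp3 \<longrightarrow> g \<in> \<Gamma> \<longrightarrow> g \<noteq> 1 \<longrightarrow> r \<le> hyp3_dist x (mob g x)))"

lemma r0: "r0 > 0" "x \<in> hyp3 \<Longrightarrow> g \<in> \<Gamma> \<Longrightarrow> g \<noteq> 1 \<Longrightarrow> r0 \<le> hyp3_dist x (mob g x)"
proof -
  have "\<exists>r. r > 0 \<and> (\<forall>x g. x \<in> hyp3 \<longrightarrow> g \<in> \<Gamma> \<longrightarrow> g \<noteq> 1 \<longrightarrow> r \<le> hyp3_dist x (mob g x))"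
    using uniform_displacement by metis
  from someI_ex[OF this] show "r0 > 0" "x \<in> hyp3 \<Longrightarrow> g \<in> \<Gamma> \<Longrightarrow> g \<noteq> 1 \<Longrightarrow> r0 \<le> hyp3_dist x (mob g x)"
    unfolding r0_def[symmetric] by blast+
qed

definition orb :: "complex \<times> real \<Rightarrow> (complex \<times> real) set" where
  "orb x = (\<lambda>g. mob g x) ` \<Gamma>"

lemma orb_self: "x \<in> orb x" using one by (auto simp: orb_def intro!: image_eqI[of _ _ 1])

lemma orb_mob:
  assumes "g \<in> \<Gamma>" "x \<in> hyp3" shows "orb (mob g x) = orb x"
proof
  show "orb (mob g x) \<subseteq> orb x" using assms by (auto simp: orb_def mob_mult[symmetric] mult)
  show "orb x \<subseteq> orb (mob g x)"
  proof
    fix z assume "z \<in> orb x"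
    then obtain h where h: "h \<in> \<Gamma>" "z = mob h x" by (auto simp: orb_def)
    then have "z = mob (h * adj2 g) (mob g x)" using assms by (simp add: mob_mult)
    moreover have "h * adj2 g \<in> \<Gamma>" using h assms by (intro mult adj)
    ultimately show "z \<in> orb (mob g x)" by (auto simp: orb_def)
  qed
qed

lemma orb_eq: "y \<in> hyp3 \<Longrightarrow> orb x = orb y \<longleftrightarrow> (\<exists>g\<in>\<Gamma>. x = mob g y)"
proof
  assume "orb x = orb y"
  then have "x \<in> orb y" using orb_self[of x] by simp
  then show "\<exists>g\<in>\<Gamma>. x = mob g y" unfolding orb_def by blast
qed (use orb_mob in blast)

text \<open>The value 0 off the orbit space is there because \<open>Metric_space\<close> asks for
  nonnegativity and symmetry on the whole type.\<close>

definition qd :: "(complex \<times> real) set \<Rightarrow> (complex \<times> real) set \<Rightarrow> real" where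
  "qd A B = (if A \<in> orb ` hyp3 \<and> B \<in> orb ` hyp3 then Inf ((\<lambda>(p,q). hyp3_dist p q) ` (A \<times> B)) else 0)"

lemma qd_eq:
  assumes "x \<in> hyp3" "y \<in> hyp3"
  shows "qd (orb x) (orb y) = (INF g\<in>\<Gamma>. hyp3_dist x (mob g y))"
proof -
  have "(\<lambda>(p,q). hyp3_dist p q) ` (orb x \<times> orb y) = (\<lambda>g. hyp3_dist x (mob g y)) ` \<Gamma>"
  proof (intro equalityI subsetI)
    fix d assume "d \<in> (\<lambda>(p,q). hyp3_dist p q) ` (orb x \<times> orb y)"
    then obtain g h where gh: "g \<in> \<Gamma>" "h \<in> \<Gamma>" "d = hyp3_dist (mob g x) (mob h y)" by (auto simp: orb_def)
    have "d = hyp3_dist (mob (adj2 g) (mob g x)) (mob (adj2 g) (mob h y))"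
      by (subst hyp3_dist_mob) (use gh assms in auto)
    also have "\<dots> = hyp3_dist x (mob (adj2 g * h) y)" using gh assms by (simp add: mob_mult)
    finally show "d \<in> (\<lambda>g. hyp3_dist x (mob g y)) ` \<Gamma>" using gh by (auto intro!: mult adj)
  next
    fix d assume "d \<in> (\<lambda>g. hyp3_dist x (mob g y)) ` \<Gamma>"
    then obtain g where "g \<in> \<Gamma>" "d = hyp3_dist x (mob g y)" by blast
    then show "d \<in> (\<lambda>(p,q). hyp3_dist p q) ` (orb x \<times> orb y)"
      using orb_self[of x] by (intro image_eqI[of _ _ "(x, mob g y)"]) (auto simp: orb_def)
  qed
  then show ?thesis using assms by (simp add: qd_def)
qed

lemma qd_bdd: "x \<in> hyp3 \<Longrightarrow> y \<in> hyp3 \<Longrightarrow> bdd_below ((\<lambda>g. hyp3_dist x (mob g y)) ` \<Gamma>)"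
  by (intro bdd_belowI[of _ 0]) (auto intro: hyp3_dist_nonneg)

lemma qd_le:
  assumes "x \<in> hyp3" "y \<in> hyp3" "g \<in> \<Gamma>" shows "qd (orb x) (orb y) \<le> hyp3_dist x (mob g y)"
  unfolding qd_eq[OF assms(1,2)] by (rule cINF_lower[OF qd_bdd]) (use assms in auto)

lemma qd_le1: "x \<in> hyp3 \<Longrightarrow> y \<in> hyp3 \<Longrightarrow> qd (orb x) (orb y) \<le> hyp3_dist x y"
  using qd_le[OF _ _ one] by simp

lemma qd_less:
  assumes "x \<in> hyp3" "y \<in> hyp3" "qd (orb x) (orb y) < e"
  obtains g where "g \<in> \<Gamma>" "hyp3_dist x (mob g y) < e"
  using assms(3) one unfolding qd_eq[OF assms(1,2)] by (subst (asm) cINF_less_iff[OF _ qd_bdd]) (use assms in auto)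

text \<open>The other points of the orbit of \<open>y\<close> are at least \<open>r0\<close> away
  from \<open>y\<close>, hence no closer to \<open>x\<close> than \<open>y\<close> is.\<close>

lemma qd_local:
  assumes "x \<in> hyp3" "y \<in> hyp3" "hyp3_dist x y \<le> r0 / 2"
  shows "qd (orb x) (orb y) = hyp3_dist x y"
proof (rule antisym[OF qd_le1])
  show "hyp3_dist x y \<le> qd (orb x) (orb y)"
    unfolding qd_eq[OF assms(1,2)]
  proof (rule cINF_greatest)
    fix g assume g: "g \<in> \<Gamma>"
    show "hyp3_dist x y \<le> hyp3_dist x (mob g y)"
    proof (cases "g = 1")
      case False
      have "r0 \<le> hyp3_dist y (mob g y)" using r0(2) g False assms by blast
      also have "\<dots> \<le> hyp3_dist y x + hyp3_dist x (mob g y)"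
        using g assms by (intro hyp3_dist_triangle) auto
      finally show ?thesis using assms(3) by (simp add: hyp3_dist_sym[of y x])
    qed simp
  qed (use one in auto)
qed (use assms in auto)

sublocale Q: Metric_space "orb ` hyp3" qd
proof
  fix A B C
  have nn: "0 \<le> qd (orb x) (orb y)" if "x \<in> hyp3" "y \<in> hyp3" for x y
    unfolding qd_eq[OF that] using one that by (intro cINF_greatest) (auto intro: hyp3_dist_nonneg)
  show "0 \<le> qd A B" 
  proof (cases "A \<in> orb ` hyp3 \<and> B \<in> orb ` hyp3")
    case True then show ?thesis using nn by auto
  next
    case False then show ?thesis unfolding qd_def by (simp only: if_False)
  qed
  show "qd A B = qd B A"
  proof -
    have sub: "(\<lambda>(p,q). hyp3_dist p q) ` (A \<times> B) \<subseteq> (\<lambda>(p,q). hyp3_dist p q) ` (B \<times> A)" for A B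
    proof
      fix e assume "e \<in> (\<lambda>(p,q). hyp3_dist p q) ` (A \<times> B)"
      then obtain p q where pq: "p \<in> A" "q \<in> B" "e = hyp3_dist p q" by auto
      then show "e \<in> (\<lambda>(p,q). hyp3_dist p q) ` (B \<times> A)"
        by (intro image_eqI[of _ _ "(q,p)"]) (auto simp: hyp3_dist_sym)
    qed
    have "(\<lambda>(p,q). hyp3_dist p q) ` (A \<times> B) = (\<lambda>(p,q). hyp3_dist p q) ` (B \<times> A)"
      by (intro antisym sub)
    then show ?thesis by (auto simp: qd_def)
  qed
  show "qd A B = 0 \<longleftrightarrow> A = B" if AB: "A \<in> orb ` hyp3" "B \<in> orb ` hyp3"
  proof -
    obtain x y where xy: "x \<in> hyp3" "y \<in> hyp3" "A = orb x" "B = orb y" using AB by blast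
    show ?thesis
    proof
      assume "qd A B = 0"
      then have "qd (orb x) (orb y) < r0 / 2" using xy r0(1) by simp
      then obtain g where g: "g \<in> \<Gamma>" "hyp3_dist x (mob g y) < r0 / 2" using qd_less xy by blast
      have "hyp3_dist x (mob g y) = qd (orb x) (orb (mob g y))" using qd_local g xy by simp
      also have "\<dots> = 0" using \<open>qd A B = 0\<close> xy g by (simp add: orb_mob)
      finally have "x = mob g y" using hyp3_dist_0_iff g xy by simp
      then show "A = B" using xy g by (simp add: orb_mob)
    next
      assume "A = B"
      then show "qd A B = 0" using qd_le1[OF xy(1,1)] nn[OF xy(1,1)] hyp3_dist_0_iff[OF xy(1,1)] xy by simp
    qed
  qed
  show "qd A C \<le> qd A B + qd B C" if ABC: "A \<in> orb ` hyp3" "B \<in> orb ` hyp3" "C \<in> orb ` hyp3"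
  proof (rule field_le_epsilon)
    fix e :: real assume e: "e > 0"
    obtain x y z where xyz: "x \<in> hyp3" "y \<in> hyp3" "z \<in> hyp3" "A = orb x" "B = orb y" "C = orb z" using ABC by blast
    obtain g where g: "g \<in> \<Gamma>" "hyp3_dist x (mob g y) < qd A B + e / 2" 
      using qd_less[OF xyz(1,2), of "qd A B + e/2"] e xyz by auto
    obtain h where h: "h \<in> \<Gamma>" "hyp3_dist y (mob h z) < qd B C + e / 2" 
      using qd_less[OF xyz(2,3), of "qd B C + e/2"] e xyz by auto
    have "qd A C \<le> hyp3_dist x (mob (g * h) z)" unfolding xyz using xyz g h by (intro qd_le mult)
    also have "mob (g * h) z = mob g (mob h z)" using xyz g h by (simp add: mob_mult)
    also have "hyp3_dist x \<dots> \<le> hyp3_dist x (mob g y) + hyp3_dist (mob g y) (mob g (mob h z))"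
      using xyz g h by (intro hyp3_dist_triangle) auto
    also have "hyp3_dist (mob g y) (mob g (mob h z)) = hyp3_dist y (mob h z)" 
      using xyz g h by (simp add: hyp3_dist_mob)
    finally show "qd A C \<le> qd A B + qd B C + e" using g h by simp
  qed
qed

definition QM :: "(complex \<times> real) set metric" where "QM = metric (orb ` hyp3, qd)"

lemma QM [simp]: "mspace QM = orb ` hyp3" "mdist QM = qd" "mtopology_of QM = Q.mtopology" "mball_of QM = Q.mball"
  by (simp_all add: QM_def)

lemma continuous_orb: "continuous_map (top_of_set hyp3) Q.mtopology orb"
  unfolding Q.continuous_map_to_metric
proof (intro ballI allI impI)
  fix x and e :: real assume "x \<in> topspace (top_of_set hyp3)" and e: "e > 0"
  then have x: "x \<in> hyp3" by simp
  obtain d where d: "d > 0" "\<And>q. q \<in> hyp3 \<Longrightarrow> dist x q < d \<Longrightarrow> hyp3_dist x q < e"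
    using hyp3_dist_small[OF x e] by blast
  show "\<exists>U. openin (top_of_set hyp3) U \<and> x \<in> U \<and> (\<forall>y\<in>U. orb y \<in> Q.mball (orb x) e)"
  proof (intro exI[of _ "hyp3 \<inter> ball x d"] conjI ballI)
    fix y assume y: "y \<in> hyp3 \<inter> ball x d"
    then have "qd (orb x) (orb y) < e" using qd_le1[OF x, of y] d(2)[of y] by auto
    then show "orb y \<in> Q.mball (orb x) e" using x y by auto
  qed (use x d in \<open>auto simp: openin_open_Int\<close>)
qed

text \<open>Two points of a ball of radius \<open>r0 / 4\<close> are less than \<open>r0 / 2\<close>
  apart, which is the range of \<open>qd_local\<close>.\<close>

lemma local_chart:
  assumes x: "x \<in> hyp3"
  shows "bij_betw orb (hyp3_ball x (r0 / 4)) (Q.mball (orb x) (r0 / 4))"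
    and "\<And>p q. p \<in> hyp3_ball x (r0 / 4) \<Longrightarrow> q \<in> hyp3_ball x (r0 / 4) \<Longrightarrow> qd (orb p) (orb q) = hyp3_dist p q"
proof -
  show iso: "qd (orb p) (orb q) = hyp3_dist p q" if "p \<in> hyp3_ball x (r0 / 4)" "q \<in> hyp3_ball x (r0 / 4)" for p q
  proof (rule qd_local)
    show pq: "p \<in> hyp3" "q \<in> hyp3" using that by (auto simp: hyp3_ball_def)
    have "hyp3_dist p q \<le> hyp3_dist p x + hyp3_dist x q" using pq x by (intro hyp3_dist_triangle)
    then show "hyp3_dist p q \<le> r0 / 2" using that by (simp add: hyp3_ball_def hyp3_dist_sym[of p x])
  qed
  show "bij_betw orb (hyp3_ball x (r0 / 4)) (Q.mball (orb x) (r0 / 4))"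
    unfolding bij_betw_def
  proof
    show "inj_on orb (hyp3_ball x (r0 / 4))"
    proof (rule inj_onI)
      fix p q assume pq: "p \<in> hyp3_ball x (r0 / 4)" "q \<in> hyp3_ball x (r0 / 4)" "orb p = orb q"
      have h: "p \<in> hyp3" "q \<in> hyp3" using pq by (auto simp: hyp3_ball_def)
      have "hyp3_dist p q = 0" using iso[OF pq(1,2)] pq(3) h by simp
      then show "p = q" using hyp3_dist_0_iff h by blast
    qed
    show "orb ` hyp3_ball x (r0 / 4) = Q.mball (orb x) (r0 / 4)"
    proof (intro equalityI subsetI)
      fix c assume "c \<in> orb ` hyp3_ball x (r0 / 4)"
      then show "c \<in> Q.mball (orb x) (r0 / 4)" using qd_le1[OF x] x by (force simp: hyp3_ball_def)
    next
      fix c assume "c \<in> Q.mball (orb x) (r0 / 4)"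
      then obtain q where q: "q \<in> hyp3" "c = orb q" "qd (orb x) (orb q) < r0 / 4" by auto
      obtain g where g: "g \<in> \<Gamma>" "hyp3_dist x (mob g q) < r0 / 4" using qd_less[OF x q(1,3)] by blast
      then have "mob g q \<in> hyp3_ball x (r0 / 4)" using q by (simp add: hyp3_ball_def)
      then show "c \<in> orb ` hyp3_ball x (r0 / 4)" using q g by (auto simp: orb_mob intro!: image_eqI[of _ _ "mob g q"])
    qed
  qed
qed

theorem closed_hyperbolic_QM: "closed_hyperbolic_3_manifold QM"
  unfolding closed_hyperbolic_3_manifold_def hyperbolic_3_manifold_def
proof (intro conjI ballI)
  show "mspace QM \<noteq> {}" using convex_hyp3 by (auto simp: hyp3_def intro!: exI[of _ 1])
  have "connectedin Q.mtopology (orb ` hyp3)"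
    using continuous_orb by (rule connectedin_continuous_map_image) (simp add: connectedin_topspace convex_connected[OF convex_hyp3] connectedin_subtopology)
  then show "connected_space (mtopology_of QM)" by (simp add: connectedin_def subtopology_topspace[of Q.mtopology, simplified])
  obtain K where K: "compact K" "K \<subseteq> hyp3" "\<And>x. x \<in> hyp3 \<Longrightarrow> \<exists>g\<in>\<Gamma>. mob g x \<in> K" using cocompact by blast
  have "compactin Q.mtopology (orb ` K)"
    using K by (intro image_compactin[OF _ continuous_orb]) (simp add: compactin_subtopology)
  moreover have "orb ` K = orb ` hyp3"
  proof
    show "orb ` K \<subseteq> orb ` hyp3" using K(2) by blast
    show "orb ` hyp3 \<subseteq> orb ` K"
    proof
      fix c assume "c \<in> orb ` hyp3"
      then obtain x where x: "x \<in> hyp3" "c = orb x" by blast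
      then obtain g where "g \<in> \<Gamma>" "mob g x \<in> K" using K(3) by blast
      then show "c \<in> orb ` K" using x orb_mob by (intro image_eqI[of _ _ "mob g x"]) auto
    qed
  qed
  ultimately show "compact_space (mtopology_of QM)" by (simp add: compact_space_def)
  fix c assume "c \<in> mspace QM"
  then obtain x where x: "x \<in> hyp3" "c = orb x" by auto
  define B where "B = hyp3_ball x (r0 / 4)"
  note lc = local_chart[OF x(1), folded B_def]
  have bij: "bij_betw (inv_into B orb) (mball_of QM c (r0 / 4)) B"
    using bij_betw_inv_into[OF lc(1)] x by simp
  show "\<exists>r>0. \<exists>p\<in>hyp3. \<exists>f. bij_betw f (mball_of QM c r) (hyp3_ball p r) \<and>
        (\<forall>y\<in>mball_of QM c r. \<forall>z\<in>mball_of QM c r. hyp3_dist (f y) (f z) = mdist QM y z)"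
  proof (intro exI[of _ "r0 / 4"] conjI bexI[of _ x] exI[of _ "inv_into B orb"] ballI)
    fix y z assume yz: "y \<in> mball_of QM c (r0 / 4)" "z \<in> mball_of QM c (r0 / 4)"
    have "inv_into B orb y \<in> B" "inv_into B orb z \<in> B" using bij yz by (auto dest: bij_betwE)
    moreover have "orb (inv_into B orb y) = y" "orb (inv_into B orb z) = z"
      using yz lc(1) x by (auto intro!: f_inv_into_f simp: bij_betw_def simp del: Q.in_mball)
    ultimately show "hyp3_dist (inv_into B orb y) (inv_into B orb z) = mdist QM y z"
      using lc(2)[of "inv_into B orb y" "inv_into B orb z"] by simp
  qed (use bij x r0 in \<open>auto simp: B_def\<close>)
qed

end


section \<open>The fundamental group of the quotient\<close>

context kleinian
begin

definition lift :: "real set \<Rightarrow> (real \<Rightarrow> (complex \<times> real) set) \<Rightarrow> (real \<Rightarrow> complex \<times> real) \<Rightarrow> bool" where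
  "lift I p q \<longleftrightarrow> continuous_on I q \<and> (\<forall>t\<in>I. q t \<in> hyp3 \<and> orb (q t) = p t)"

lemma liftD:
  assumes "lift I p q" 
  shows "continuous_on I q" "t \<in> I \<Longrightarrow> q t \<in> hyp3" "t \<in> I \<Longrightarrow> orb (q t) = p t"
  using assms by (auto simp: lift_def)

lemma near_rep:
  assumes "z \<in> hyp3" "C \<in> orb ` hyp3" "qd (orb z) C < e"
  obtains c where "c \<in> hyp3" "orb c = C" "hyp3_dist z c < e"
proof -
  obtain w where w: "w \<in> hyp3" "C = orb w" using assms(2) by blast
  obtain g where g: "g \<in> \<Gamma>" "hyp3_dist z (mob g w) < e" using qd_less[OF assms(1) w(1)] assms(3) w(2) by blast
  show thesis using that[of "mob g w"] g w by (simp add: orb_mob)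
qed

lemma local_lift:
  assumes c: "c \<in> hyp3" and p: "continuous_map (top_of_set I) Q.mtopology p"
    and near: "\<And>t. t \<in> I \<Longrightarrow> p t \<in> Q.mball (orb c) (r0 / 4)"
  obtains q where "lift I p q" "\<And>t. t \<in> I \<Longrightarrow> q t \<in> hyp3_ball c (r0 / 4)"
proof -
  define B where "B = hyp3_ball c (r0 / 4)"
  note lc = local_chart[OF c, folded B_def]
  define q where "q = inv_into B orb \<circ> p"
  have img: "orb ` B = Q.mball (orb c) (r0 / 4)" using lc(1) by (simp add: bij_betw_def)
  have q: "q t \<in> B" "orb (q t) = p t" if "t \<in> I" for t
  proof -
    have "p t \<in> orb ` B" using near[OF that] img by metis
    then show "q t \<in> B" "orb (q t) = p t" unfolding q_def by (simp_all add: inv_into_into f_inv_into_f)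
  qed
  have qh: "q t \<in> hyp3" if "t \<in> I" for t using q(1)[OF that] by (simp add: B_def hyp3_ball_def)
  have "continuous_on I q"
    unfolding continuous_on_iff
  proof (intro ballI allI impI)
    fix t and e :: real assume t: "t \<in> I" and e: "e > 0"
    obtain d where d: "d > 0" "\<And>w. w \<in> hyp3 \<Longrightarrow> hyp3_dist (q t) w < d \<Longrightarrow> dist (q t) w < e"
      using hyp3_dist_large[OF qh[OF t] e] by blast
    obtain U where U: "openin (top_of_set I) U" "t \<in> U" "\<And>s. s \<in> U \<Longrightarrow> p s \<in> Q.mball (p t) d"
      using p t d(1) unfolding Q.continuous_map_to_metric by (metis topspace_euclidean_subtopology)
    obtain d' where d': "d' > 0" "\<And>s. s \<in> I \<Longrightarrow> dist s t < d' \<Longrightarrow> s \<in> U"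
      using U(1,2) unfolding openin_euclidean_subtopology_iff by blast
    show "\<exists>d>0. \<forall>s\<in>I. dist s t < d \<longrightarrow> dist (q s) (q t) < e"
    proof (intro exI[of _ d'] conjI ballI impI)
      fix s assume s: "s \<in> I" "dist s t < d'"
      have "hyp3_dist (q t) (q s) = qd (orb (q t)) (orb (q s))" using lc(2) q(1) s t by simp
      also have "\<dots> < d" using U(3)[OF d'(2)[OF s]] q(2) s t by simp
      finally show "dist (q s) (q t) < e" using d(2)[OF qh[OF s(1)]] by (simp add: dist_commute)
    qed (rule d')
  qed
  then show thesis using that[of q] q qh by (auto simp: lift_def B_def)
qed

text \<open>Charts of uniform size extend a lift across a neighbourhood of every time, so
  connectedness of the interval gives the full lift.\<close>

lemma lift_exists:
  assumes p: "pathin Q.mtopology p" and y: "y \<in> hyp3" "orb y = p 0"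
  obtains q where "lift {0..1} p q" "q 0 = y"
proof -
  have pc: "continuous_map (top_of_set {0..1}) Q.mtopology p" using p by (simp add: pathin_def)
  have pQ: "p t \<in> orb ` hyp3" if "t \<in> {0..1}" for t
    using continuous_map_image_subset_topspace[OF pc] that by auto
  have "\<exists>q. lift {0..1} p q \<and> q 0 = y"
  proof (rule connected_induction_simple[where S = "{0..1::real}" and a = 0 and P = "\<lambda>t. \<exists>q. lift {0..t} p q \<and> q 0 = y"])
    show "\<exists>q. lift {0..0} p q \<and> q 0 = y" using y by (intro exI[of _ "\<lambda>_. y"]) (auto simp: lift_def)
    fix a :: real assume a: "a \<in> {0..1}"
    obtain U where U: "openin (top_of_set {0..1}) U" "a \<in> U" "\<And>s. s \<in> U \<Longrightarrow> p s \<in> Q.mball (p a) (r0 / 4)"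
      using pc a r0(1) unfolding Q.continuous_map_to_metric
      by (metis topspace_euclidean_subtopology zero_less_divide_iff zero_less_numeral)
    obtain d where d: "d > 0" "\<And>s. s \<in> {0..1} \<Longrightarrow> dist s a < d \<Longrightarrow> s \<in> U"
      using U(1,2) unfolding openin_euclidean_subtopology_iff by blast
    let ?T = "{0..1} \<inter> ball a d"
    have "\<exists>q. lift {0..w} p q \<and> q 0 = y" 
      if u: "u \<in> ?T" and w: "w \<in> ?T" and Pu: "\<exists>q. lift {0..u} p q \<and> q 0 = y" for u w
    proof -
      obtain q where q: "lift {0..u} p q" "q 0 = y" using Pu by blast
      show ?thesis
      proof (cases "w \<le> u")
        case True
        then have "lift {0..w} p q" using q(1) unfolding lift_def by (auto intro: continuous_on_subset)
        then show ?thesis using q by blast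
      next
        case False
        have I: "{u..w} \<subseteq> {0..1}" using u w by auto
        have near: "p t \<in> Q.mball (p a) (r0 / 4)" if "t \<in> {u..w}" for t
          using U(3) d(2)[of t] u w that by (auto simp: dist_real_def simp del: Q.in_mball)
        have zu: "q u \<in> hyp3" "orb (q u) = p u" using liftD(2,3)[OF q(1), of u] u by auto
        have "qd (orb (q u)) (p a) < r0 / 4" using near[of u] False zu by (simp add: Q.commute)
        \<comment> \<open>The centre is the point over \<open>p a\<close> next to the old lift.
          Hence both lifts lie in one injective chart at time \<open>u\<close> and agree
          there.\<close>
        then obtain c where c: "c \<in> hyp3" "orb c = p a" "hyp3_dist (q u) c < r0 / 4"
          using near_rep[OF zu(1) pQ[OF a]] by blast
        obtain q2 where q2: "lift {u..w} p q2" "\<And>t. t \<in> {u..w} \<Longrightarrow> q2 t \<in> hyp3_ball c (r0 / 4)"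
          using local_lift[OF c(1) continuous_map_from_subtopology_mono[OF pc I]] near c(2) by metis
        have "q u \<in> hyp3_ball c (r0 / 4)" using c zu by (simp add: hyp3_ball_def hyp3_dist_sym)
        moreover have "q2 u \<in> hyp3_ball c (r0 / 4)" "orb (q2 u) = p u" using q2(2) liftD(3)[OF q2(1), of u] False by auto
        ultimately have qu: "q u = q2 u"
          using local_chart(1)[OF c(1)] zu unfolding bij_betw_def inj_on_def by metis
        define q3 where "q3 = (\<lambda>t. if t \<le> u then q t else q2 t)"
        have "continuous_on {0..w} q3" unfolding q3_def
        proof (rule continuous_on_cases_le)
          have "{t \<in> {0..w}. t \<le> u} = {0..u}" "{t \<in> {0..w}. u \<le> t} = {u..w}" using u False by auto
          then show "continuous_on {t \<in> {0..w}. t \<le> u} q" "continuous_on {t \<in> {0..w}. u \<le> t} q2"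
            using liftD(1)[OF q(1)] liftD(1)[OF q2(1)] by simp_all
        qed (use qu in \<open>auto intro: continuous_on_id\<close>)
        moreover have "q3 t \<in> hyp3 \<and> orb (q3 t) = p t" if "t \<in> {0..w}" for t
          using liftD(2,3)[OF q(1), of t] liftD(2,3)[OF q2(1), of t] that by (simp add: q3_def)
        ultimately show ?thesis using q(2) u by (intro exI[of _ q3]) (auto simp: lift_def q3_def)
      qed
    qed
    moreover have "openin (top_of_set {0..1}) ?T" "a \<in> ?T" using a d(1) by (auto simp: openin_open_Int)
    ultimately show "\<exists>T. openin (top_of_set {0..1}) T \<and> a \<in> T \<and> 
      (\<forall>x\<in>T. \<forall>w\<in>T. (\<exists>q. lift {0..x} p q \<and> q 0 = y) \<longrightarrow> (\<exists>q. lift {0..w} p q \<and> q 0 = y))"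
      by blast
  qed auto
  then show thesis using that by blast
qed

text \<open>As long as the lifts are within \<open>r0 / 2\<close>, their distance equals that of the
  projections, which is below \<open>r0 / 4\<close>. By the intermediate value theorem it cannot
  cross this gap.\<close>

lemma lifts_close:
  assumes q: "lift {0..1} p q" and q': "lift {0..1} p' q'" 
    and near: "\<And>t. t \<in> {0..1} \<Longrightarrow> qd (p t) (p' t) < r0 / 4" and start: "hyp3_dist (q 0) (q' 0) < r0 / 4"
    and t: "t \<in> {0..1}"
  shows "hyp3_dist (q t) (q' t) = qd (p t) (p' t)"
proof -
  define F where "F = (\<lambda>t. hyp3_dist (q t) (q' t))"
  have F: "F t = qd (p t) (p' t)" if "t \<in> {0..1}" "F t \<le> r0 / 2" for t
    using qd_local[of "q t" "q' t"] that liftD(2,3)[OF q that(1)] liftD(2,3)[OF q' that(1)] by (simp add: F_def)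
  have cont: "continuous_on {0..1} F"
  proof -
    have "continuous_on {0..1} (\<lambda>t. (case (q t, q' t) of (p, q) \<Rightarrow> hyp3_dist p q))"
      by (rule continuous_on_compose2[OF continuous_on_hyp3_dist])
         (use liftD(1,2)[OF q] liftD(1,2)[OF q'] in \<open>auto intro: continuous_on_Pair\<close>)
    then show ?thesis by (simp add: F_def)
  qed
  have "F t \<le> r0 / 2"
  proof (rule ccontr)
    assume "\<not> F t \<le> r0 / 2"
    then have "\<exists>s\<ge>0. s \<le> t \<and> F s = r0 / 4" using start t r0(1)
      by (intro IVT' continuous_on_subset[OF cont]) (auto simp: F_def)
    then obtain s where "s \<ge> 0" "s \<le> t" and s: "F s = r0 / 4" by blast
    then have s: "s \<in> {0..1}" "F s = r0 / 4" using t by auto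
    have "F s < r0 / 4" using F[OF s(1)] near[OF s(1)] s(2) r0(1) by linarith
    then show False using s by simp
  qed
  then show ?thesis using F[OF t] by (simp add: F_def)
qed

lemma lift_unique:
  assumes "lift {0..1} p q" "lift {0..1} p q'" "q 0 = q' 0" "t \<in> {0..1}"
  shows "q t = q' t"
proof -
  have z: "q s \<in> hyp3" "q' s \<in> hyp3" "qd (p s) (p s) = 0" if "s \<in> {0..1}" for s
  proof -
    show h: "q s \<in> hyp3" "q' s \<in> hyp3" using liftD(2)[OF _ that] assms by blast+
    have "p s \<in> orb ` hyp3" using liftD(3)[OF assms(1) that] h by blast
    then show "qd (p s) (p s) = 0" by simp
  qed
  have "hyp3_dist (q 0) (q' 0) = 0" using hyp3_dist_0_iff z[of 0] assms(3) by simp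
  then have "hyp3_dist (q t) (q' t) = qd (p t) (p t)"
    using assms r0(1) by (intro lifts_close) (use z in auto)
  then show ?thesis using z[OF assms(4)] hyp3_dist_0_iff by simp
qed

text \<open>Uniform continuity and \<open>lifts_close\<close> keep the lifts of neighbouring paths
  close, so the end of the lift is locally constant in the homotopy parameter.\<close>

lemma homotopy_lift_end:
  fixes h :: "real \<times> real \<Rightarrow> (complex \<times> real) set"
  assumes h: "continuous_map (top_of_set ({0..1} \<times> {0..1})) Q.mtopology h" and y: "y \<in> hyp3"
    and ends: "\<And>s. s \<in> {0..1} \<Longrightarrow> h (s, 0) = orb y" "\<And>s. s \<in> {0..1} \<Longrightarrow> h (s, 1) = x"
    and q0: "lift {0..1} (\<lambda>t. h (0, t)) q0" "q0 0 = y" and q1: "lift {0..1} (\<lambda>t. h (1, t)) q1" "q1 0 = y"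
  shows "q0 1 = q1 1"
proof -
  have "\<exists>q. lift {0..1} (\<lambda>t. h (s, t)) q \<and> q 0 = y" if s: "s \<in> {0..1}" for s :: real
  proof -
    have "pathin Q.mtopology (h \<circ> (\<lambda>t. (s, t)))" unfolding pathin_def
      using s by (intro continuous_map_compose[OF _ h]) (auto simp: continuous_map_in_subtopology intro!: continuous_intros)
    then show ?thesis using lift_exists[of "\<lambda>t. h (s, t)" y] y ends(1)[OF s] by (auto simp: o_def)
  qed
  then obtain q :: "real \<Rightarrow> real \<Rightarrow> complex \<times> real" where q: "\<And>s. s \<in> {0..1} \<Longrightarrow> lift {0..1} (\<lambda>t. h (s, t)) (q s)" "\<And>s. s \<in> {0..1} \<Longrightarrow> q s 0 = y"
    by metis
  have step: "\<exists>T. openin (top_of_set {0..1}) T \<and> a \<in> T \<and> (\<forall>s\<in>T. q s 1 = q a 1)" if a: "a \<in> {0..1::real}" for a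
  proof -
    define F where "F = (\<lambda>z. mdist QM (h z) ((h \<circ> (\<lambda>z. (a, snd z))) z))"
    have "continuous_map (top_of_set ({0..1} \<times> {0..1})) (top_of_set ({0..1} \<times> {0..1})) (\<lambda>z::real\<times>real. (a, snd z))"
      using a by (auto simp: continuous_map_in_subtopology intro!: continuous_intros)
    then have "continuous_map (top_of_set ({0..1} \<times> {0..1})) euclidean F"
      unfolding F_def using h by (intro continuous_map_mdist continuous_map_compose[OF _ h[folded QM]]) auto
    then have "continuous_on ({0..1} \<times> {0..1}) F" by simp
    then have "uniformly_continuous_on ({0..1} \<times> {0..1}) F"
      by (intro compact_uniformly_continuous) (auto intro: compact_Times)
    then obtain d where d: "d > 0"
      "\<And>z z'. z \<in> {0..1} \<times> {0..1} \<Longrightarrow> z' \<in> {0..1} \<times> {0..1} \<Longrightarrow> dist z' z < d \<Longrightarrow> dist (F z') (F z) < r0 / 4"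
      unfolding uniformly_continuous_on_def using r0(1) by (metis zero_less_divide_iff zero_less_numeral)
    have "q s 1 = q a 1" if s: "s \<in> {0..1}" "dist s a < d" for s
    proof -
      have near: "qd (h (s, t)) (h (a, t)) < r0 / 4" if t: "t \<in> {0..1}" for t
      proof -
        have "dist (F (s, t)) (F (a, t)) < r0 / 4" using s a t by (intro d(2)) (auto simp: dist_Pair_Pair)
        moreover have "h (a, t) \<in> orb ` hyp3" using liftD(2,3)[OF q(1)[OF a] t] by force
        ultimately show ?thesis by (simp add: F_def dist_real_def)
      qed
      have "hyp3_dist (q s 1) (q a 1) = qd (h (s, 1)) (h (a, 1))"
      proof (rule lifts_close[OF q(1) q(1)])
        show "hyp3_dist (q s 0) (q a 0) < r0 / 4" using q(2)[OF s(1)] q(2)[OF a] hyp3_dist_0_iff[OF y y] r0(1) by simp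
      qed (use s a near in auto)
      also have "h (s, 1) = h (a, 1)" using ends(2)[OF s(1)] ends(2)[OF a] by simp
      also have "qd (h (a, 1)) (h (a, 1)) = 0"
      proof -
        have "h (a, 1) \<in> orb ` hyp3" using liftD(2,3)[OF q(1)[OF a], of 1] by force
        then show ?thesis by simp
      qed
      finally show ?thesis using hyp3_dist_0_iff liftD(2)[OF q(1)[OF s(1)], of 1] liftD(2)[OF q(1)[OF a], of 1] by simp
    qed
    then have "\<forall>s\<in>{0..1} \<inter> ball a d. q s 1 = q a 1" by (metis IntE dist_commute mem_ball)
    moreover have "openin (top_of_set {0..1}) ({0..1} \<inter> ball a d)" "a \<in> {0..1} \<inter> ball a d"
      using a d(1) by (auto simp: openin_open_Int)
    ultimately show ?thesis by blast
  qed
  have "q 1 1 = q 0 1"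
  proof (rule connected_induction_simple[where S = "{0..1::real}" and a = 0 and P = "\<lambda>s. q s 1 = q 0 1"])
    fix a :: real assume "a \<in> {0..1}"
    then obtain T where "openin (top_of_set {0..1}) T" "a \<in> T" "\<forall>s\<in>T. q s 1 = q a 1" using step by blast
    then show "\<exists>T. openin (top_of_set {0..1}) T \<and> a \<in> T \<and> (\<forall>x\<in>T. \<forall>y\<in>T. q x 1 = q 0 1 \<longrightarrow> q y 1 = q 0 1)" by metis
  qed auto
  moreover have "q0 1 = q 0 1" using q0(2) q(2)[of 0] by (simp add: lift_unique[OF q0(1) q(1)])
  moreover have "q1 1 = q 1 1" using q1(2) q(2)[of 1] by (simp add: lift_unique[OF q1(1) q(1)])
  ultimately show ?thesis by simp
qed

lemma pathin_lift:
  assumes "lift {0..1} p q" shows "pathin Q.mtopology p"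
proof -
  have "continuous_map (top_of_set {0..1}) (top_of_set hyp3) q" using liftD[OF assms] by auto
  then have "continuous_map (top_of_set {0..1}) Q.mtopology (orb \<circ> q)" using continuous_orb by (rule continuous_map_compose)
  then show ?thesis unfolding pathin_def by (rule continuous_map_eq) (use liftD(3)[OF assms] in auto)
qed

text \<open>By \<open>loops_to_class\<close> this is a full homotopy class, so
  \<open>loops_to y\<close> itself is the isomorphism onto the fundamental group.\<close>

definition loops_to :: "complex \<times> real \<Rightarrow> m2 \<Rightarrow> (real \<Rightarrow> (complex \<times> real) set) set" where
  "loops_to y g = {p \<in> loops Q.mtopology (orb y). \<exists>q. lift {0..1} p q \<and> q 0 = y \<and> q 1 = mob g y}"

lemma mob_inj:
  assumes "g \<in> \<Gamma>" "h \<in> \<Gamma>" "y \<in> hyp3" "mob g y = mob h y" shows "g = h"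
proof -
  have "mob (adj2 h * g) y = y" using assms by (simp add: mob_mult)
  then have "hyp3_dist y (mob (adj2 h * g) y) = 0" using assms hyp3_dist_0_iff by simp
  then have "adj2 h * g = 1" using r0(2)[OF assms(3), of "adj2 h * g"] assms r0(1) by (force intro: mult adj)
  then have "h * (adj2 h * g) = h" by simp
  then show ?thesis using assms by (simp add: mult.assoc[symmetric] adj2_right)
qed

lemma loops_to_I:
  assumes "lift {0..1} p q" "q 0 = y" "q 1 = mob g y" "g \<in> \<Gamma>"
  shows "p \<in> loops_to y g"
proof -
  have "y \<in> hyp3" using liftD(2)[OF assms(1), of 0] assms(2) by simp
  then have "p 0 = orb y" "p 1 = orb y" using liftD(3)[OF assms(1), of 0] liftD(3)[OF assms(1), of 1] assms
    by (auto simp: orb_mob)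
  then show ?thesis using pathin_lift[OF assms(1)] assms by (auto simp: loops_to_def loops_def)
qed

lemma loops_to_exists:
  assumes y: "y \<in> hyp3" and p: "p \<in> loops Q.mtopology (orb y)"
  obtains g where "g \<in> \<Gamma>" "p \<in> loops_to y g"
proof -
  obtain q where q: "lift {0..1} p q" "q 0 = y" using lift_exists[of p y] p y by (auto simp: loops_def)
  then have "q 1 \<in> hyp3" "orb (q 1) = orb y" using liftD(2,3)[OF q(1), of 1] p by (auto simp: loops_def)
  then obtain g where "g \<in> \<Gamma>" "q 1 = mob g y" using orb_eq[OF y] by blast
  then show thesis using that loops_to_I[OF q] by blast
qed

lemma loops_to_class:
  assumes y: "y \<in> hyp3" and g: "g \<in> \<Gamma>" and p: "p \<in> loops_to y g"
  shows "loop_class Q.mtopology (orb y) p = loops_to y g"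
proof (intro equalityI subsetI)
  obtain q where q: "lift {0..1} p q" "q 0 = y" "q 1 = mob g y" and pl: "p \<in> loops Q.mtopology (orb y)" 
    using p by (auto simp: loops_to_def)
  fix p'
  {
    assume "p' \<in> loop_class Q.mtopology (orb y) p"
    then have p': "p' \<in> loops Q.mtopology (orb y)" and "homotopic_loops_at Q.mtopology (orb y) p p'"
      by (auto simp: loop_class_def)
    then have "\<exists>h :: real \<times> real \<Rightarrow> (complex \<times> real) set. continuous_map (top_of_set ({0..1} \<times> {0..1})) Q.mtopology h \<and>
      (\<forall>t. h (0, t) = p t) \<and> (\<forall>t. h (1, t) = p' t) \<and> (\<forall>s\<in>{0..1}. h (s, 0) = orb y \<and> h (s, 1) = orb y)"
      by (simp only: homotopic_loops_at_def homotopic_with_def prod_topology_subtopology_eu)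
    then obtain h :: "real \<times> real \<Rightarrow> (complex \<times> real) set" where h: "continuous_map (top_of_set ({0..1} \<times> {0..1})) Q.mtopology h"
      and h0: "\<forall>t. h (0, t) = p t" and h1: "\<forall>t. h (1, t) = p' t"
      and he: "\<forall>s\<in>{0..1}. h (s, 0) = orb y \<and> h (s, 1) = orb y"
      by (elim exE conjE) (rule that)
    obtain q' where q': "lift {0..1} p' q'" "q' 0 = y" using lift_exists[of p' y] p' y by (auto simp: loops_def)
    have "q 1 = q' 1"
      by (rule homotopy_lift_end[OF h y, where x = "orb y"]) (use he q q' in \<open>simp_all add: h0 h1\<close>)
    then show "p' \<in> loops_to y g" using loops_to_I[OF q'] q(3) g by simp
  next
    assume "p' \<in> loops_to y g"
    then obtain q' where q': "lift {0..1} p' q'" "q' 0 = y" "q' 1 = mob g y" and p'l: "p' \<in> loops Q.mtopology (orb y)" 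
      by (auto simp: loops_to_def)
    \<comment> \<open>The half-space is convex in the Euclidean sense, so lifts with common ends are
      joined by the straight-line homotopy.\<close>
    have "homotopic_paths hyp3 q q'"
    proof (rule homotopic_paths_linear)
      show "closed_segment (q t) (q' t) \<subseteq> hyp3" if "t \<in> {0..1}" for t
        using liftD(2)[OF q(1) that] liftD(2)[OF q'(1) that] convex_hyp3 by (simp add: closed_segment_subset)
    qed (use q q' liftD(1) in \<open>auto simp: path_def pathstart_def pathfinish_def\<close>)
    then have "homotopic_with (\<lambda>r. r 0 = y \<and> r 1 = mob g y) (top_of_set {0..1}) (top_of_set hyp3) q q'"
      unfolding homotopic_paths_def using q by (simp add: pathstart_def pathfinish_def)
    then have hom: "homotopic_with (\<lambda>r. r 0 = orb y \<and> r 1 = orb y) (top_of_set {0..1}) Q.mtopology (orb \<circ> q) (orb \<circ> q')"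
      by (rule homotopic_with_compose_continuous_map_left[OF _ continuous_orb]) (use g y in \<open>auto simp: orb_mob\<close>)
    have "homotopic_with (\<lambda>r. r 0 = orb y \<and> r 1 = orb y) (top_of_set {0..1}) Q.mtopology p p'"
    proof (rule homotopic_with_eq[OF hom])
      fix h k :: "real \<Rightarrow> (complex \<times> real) set"
      assume "\<And>x. x \<in> topspace (top_of_set {0..1}) \<Longrightarrow> h x = k x"
      then show "(h 0 = orb y \<and> h 1 = orb y) = (k 0 = orb y \<and> k 1 = orb y)" by simp
    qed (use liftD(3)[OF q(1)] liftD(3)[OF q'(1)] in auto)
    then show "p' \<in> loop_class Q.mtopology (orb y) p" using p'l by (simp add: loop_class_def homotopic_loops_at_def)
  }
qed

lemma loops_to_nonempty:
  assumes "y \<in> hyp3" "g \<in> \<Gamma>" shows "loops_to y g \<noteq> {}"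
proof -
  define q where "q = linepath y (mob g y)"
  have "q t \<in> hyp3" if "t \<in> {0..1}" for t
  proof -
    have "q t \<in> closed_segment y (mob g y)" using that by (auto simp: q_def linepath_image_01[symmetric])
    also have "\<dots> \<subseteq> hyp3" using assms convex_hyp3 by (simp add: closed_segment_subset)
    finally show ?thesis .
  qed
  then have "lift {0..1} (orb \<circ> q) q" by (auto simp: lift_def q_def)
  then have "orb \<circ> q \<in> loops_to y g" by (rule loops_to_I) (use assms in \<open>auto simp: q_def linepath_def\<close>)
  then show ?thesis by blast
qed

lemma loops_to_unique:
  assumes "y \<in> hyp3" "g \<in> \<Gamma>" "h \<in> \<Gamma>" "p \<in> loops_to y g" "p \<in> loops_to y h" shows "g = h"
proof -
  obtain q q' where "lift {0..1} p q" "q 0 = y" "q 1 = mob g y" "lift {0..1} p q'" "q' 0 = y" "q' 1 = mob h y"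
    using assms by (auto simp: loops_to_def)
  then have "mob g y = mob h y" using lift_unique[of p q q' 1] by simp
  then show ?thesis using mob_inj assms by blast
qed

text \<open>The second lift is moved by \<open>g\<close> to start where the first one stops, and
  then it ends at the image of \<open>y\<close> under \<open>g * h\<close>; so the order of the
  factors is preserved.\<close>

lemma loops_to_join:
  assumes y: "y \<in> hyp3" and gh: "g \<in> \<Gamma>" "h \<in> \<Gamma>" and p: "p \<in> loops_to y g" "p' \<in> loops_to y h"
  shows "join_loops p p' \<in> loops_to y (g * h)"
proof -
  obtain q q' where q: "lift {0..1} p q" "q 0 = y" "q 1 = mob g y" and q': "lift {0..1} p' q'" "q' 0 = y" "q' 1 = mob h y"
    using p by (auto simp: loops_to_def)
  define r where "r = (\<lambda>t. if t \<le> 1/2 then q (2 * t) else mob g (q' (2 * t - 1)))"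
  have "continuous_on {0..1} r" unfolding r_def
  proof (rule continuous_on_cases_le)
    have eq: "{t \<in> {0..1}. t \<le> 1/2} = {0..1/2::real}" "{t \<in> {0..1}. 1/2 \<le> t} = {1/2..1::real}" by auto
    show "continuous_on {t \<in> {0..1}. t \<le> 1/2} (\<lambda>t. q (2 * t))" unfolding eq
      by (rule continuous_on_compose2[OF liftD(1)[OF q(1)]]) (auto intro!: continuous_intros)
    show "continuous_on {t \<in> {0..1}. 1/2 \<le> t} (\<lambda>t. mob g (q' (2 * t - 1)))" unfolding eq
    proof (rule continuous_on_compose2[OF continuous_on_mob])
      show "continuous_on {1/2..1} (\<lambda>t. q' (2 * t - 1))"
        by (rule continuous_on_compose2[OF liftD(1)[OF q'(1)]]) (auto intro!: continuous_intros)
    qed (use gh liftD(2)[OF q'(1)] in auto)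
    show "q (2 * t) = mob g (q' (2 * t - 1))" if "t = 1/2" for t
      unfolding that using q(3) q'(2) by simp
  qed (rule continuous_on_id)
  moreover have "r t \<in> hyp3 \<and> orb (r t) = join_loops p p' t" if "t \<in> {0..1}" for t
    using liftD(2,3)[OF q(1), of "2 * t"] liftD(2,3)[OF q'(1), of "2 * t - 1"] that gh 
    by (auto simp: r_def join_loops_def orb_mob)
  ultimately have "lift {0..1} (join_loops p p') r" by (simp add: lift_def)
  then show ?thesis
    by (rule loops_to_I) (use q q' gh y in \<open>auto simp: r_def mob_mult intro: mult\<close>)
qed

abbreviation grp :: "m2 monoid" where "grp \<equiv> \<lparr>carrier = \<Gamma>, mult = times, one = 1\<rparr>"

lemma group_grp: "group grp"
  by (rule groupI) (auto simp: one mult mult.assoc intro!: bexI[of _ "adj2 _"] adj adj2_left)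

lemma inv_grp: "g \<in> \<Gamma> \<Longrightarrow> inv\<^bsub>grp\<^esub> g = adj2 g"
  using group_grp by (intro group.inv_equality) (auto simp: adj adj2_left)

theorem fundamental_group_iso:
  assumes y: "y \<in> hyp3"
  shows "loops_to y \<in> iso grp (fundamental_group Q.mtopology (orb y))" 
    and "group (fundamental_group Q.mtopology (orb y))"
proof -
  let ?P = "fundamental_group Q.mtopology (orb y)"
  have car: "carrier ?P = loops_to y ` \<Gamma>"
  proof (intro equalityI subsetI)
    fix c assume "c \<in> carrier ?P"
    then obtain p where p: "p \<in> loops Q.mtopology (orb y)" "c = loop_class Q.mtopology (orb y) p" 
      by (auto simp: fundamental_group_def)
    obtain g where "g \<in> \<Gamma>" "p \<in> loops_to y g" using loops_to_exists[OF y p(1)] by blast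
    then show "c \<in> loops_to y ` \<Gamma>" using loops_to_class[OF y] p(2) by simp
  next
    fix c assume "c \<in> loops_to y ` \<Gamma>"
    then obtain g where g: "g \<in> \<Gamma>" "c = loops_to y g" by blast
    then obtain p where p: "p \<in> c" using loops_to_nonempty[OF y g(1)] by auto
    then have "p \<in> loops Q.mtopology (orb y)" using g by (simp add: loops_to_def)
    moreover have "c = loop_class Q.mtopology (orb y) p" using loops_to_class[OF y g(1)] p g by simp
    ultimately show "c \<in> carrier ?P" by (auto simp: fundamental_group_def)
  qed
  have mul: "loops_to y (g * h) = loops_to y g \<otimes>\<^bsub>?P\<^esub> loops_to y h" if "g \<in> \<Gamma>" "h \<in> \<Gamma>" for g h
  proof -
    have "loop_class Q.mtopology (orb y) (join_loops p q) = loops_to y (g * h)" if "p \<in> loops_to y g" "q \<in> loops_to y h" for p q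
      using that \<open>g \<in> \<Gamma>\<close> \<open>h \<in> \<Gamma>\<close> y by (intro loops_to_class loops_to_join mult)
    then show ?thesis using loops_to_nonempty[OF y] that by (simp add: fundamental_group_def)
  qed
  have on: "loops_to y 1 = \<one>\<^bsub>?P\<^esub>"
  proof -
    have "lift {0..1} (\<lambda>_. orb y) (\<lambda>_. y)" using y by (simp add: lift_def)
    then have "(\<lambda>_. orb y) \<in> loops_to y 1" by (rule loops_to_I) (auto simp: one)
    then show ?thesis using loops_to_class[OF y one] by (simp add: fundamental_group_def)
  qed
  have hom: "loops_to y \<in> hom grp ?P" using car mul by (auto simp: hom_def)
  have "inj_on (loops_to y) \<Gamma>"
  proof (rule inj_onI)
    fix g h assume gh: "g \<in> \<Gamma>" "h \<in> \<Gamma>" "loops_to y g = loops_to y h"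
    then obtain p where "p \<in> loops_to y g" using loops_to_nonempty[OF y] by blast
    then show "g = h" using gh loops_to_unique[OF y] by simp
  qed
  then show "loops_to y \<in> iso grp ?P" using hom car by (simp add: iso_def bij_betw_def)
  \<comment> \<open>As the image of a group under a homomorphism, the fundamental group inherits the
    group axioms.\<close>
  have "?P\<lparr>carrier := loops_to y ` \<Gamma>, one := loops_to y 1\<rparr> = ?P"
    using car on by (simp add: fundamental_group_def)
  then show "group ?P" using group.hom_imp_img_group[OF group_grp hom] by simp
qed

end


section \<open>Commutator traces and Nielsen classes\<close>

text \<open>Nielsen moves replace the commutator of a pair by a conjugate of it or of its inverse,
  and in SL(2,C) these have the same trace.\<close>

definition ctr :: "m2 \<Rightarrow> m2 \<Rightarrow> complex" where "ctr A B = tr2 (A * B * adj2 A * adj2 B)"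

lemma ctr_commute: "ctr A B = ctr B A"
proof -
  have "ctr A B = tr2 (adj2 (A * B * adj2 A * adj2 B))" by (simp add: ctr_def)
  also have "adj2 (A * B * adj2 A * adj2 B) = B * A * adj2 B * adj2 A" by (simp add: adj2_mult mult.assoc)
  finally show ?thesis by (simp add: ctr_def)
qed

lemma ctr_adj2_right:
  assumes "det2 B = 1" shows "ctr A (adj2 B) = ctr A B"
proof -
  have "ctr A (adj2 B) = tr2 ((A * adj2 B * adj2 A) * B)" by (simp add: ctr_def)
  also have "\<dots> = tr2 (B * A * adj2 B * adj2 A)" unfolding tr2_mult_commute[of _ B] by (simp add: mult.assoc)
  also have "\<dots> = ctr A B" unfolding ctr_commute[of A] by (simp add: ctr_def)
  finally show ?thesis .
qed

lemma ctr_adj2_left: "det2 A = 1 \<Longrightarrow> ctr (adj2 A) B = ctr A B"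
  using ctr_adj2_right ctr_commute by metis

lemma ctr_mult_left: "det2 B = 1 \<Longrightarrow> ctr (A * B) B = ctr A B"
  by (simp add: ctr_def adj2_mult mult.assoc adj2_right_assoc)

lemma ctr_mult_left':
  assumes "det2 B = 1" shows "ctr (A * adj2 B) B = ctr A B"
proof -
  have "ctr (A * adj2 B) (adj2 B) = ctr A (adj2 B)" using assms by (intro ctr_mult_left) simp
  then show ?thesis using assms by (simp add: ctr_adj2_right)
qed

context kleinian
begin

lemma elementary_ctr:
  assumes G: "group G" and f: "f \<in> hom G grp" and ab: "a \<in> carrier G" "b \<in> carrier G"
    and e: "elementary_equivalent G [a, b] h"
  shows "\<exists>c\<in>carrier G. \<exists>d\<in>carrier G. h = [c, d] \<and> ctr (f c) (f d) = ctr (f a) (f b)"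
proof -
  interpret f: group_hom G grp f
    using G f group_grp by (simp add: group_hom_def group_hom_axioms_def)
  have fc: "f c \<in> \<Gamma>" if "c \<in> carrier G" for c using f.hom_closed[OF that] by simp
  have fm: "f (c \<otimes>\<^bsub>G\<^esub> d) = f c * f d" if "c \<in> carrier G" "d \<in> carrier G" for c d using f.hom_mult[OF that] by simp
  have fi: "inv\<^bsub>grp\<^esub> (f c) = adj2 (f c)" if "c \<in> carrier G" for c by (rule inv_grp[OF fc[OF that]])
  have fd [simp]: "det2 (f c) = 1" if "c \<in> carrier G" for c using fc[OF that] by simp
  have two: "i = 0 \<or> i = Suc 0" if "i < length [a, b]" for i using that by auto
  from e show ?thesis
  proof (cases rule: elementary_equivalent.cases)
    case (permute \<sigma>)
    have s: "\<sigma> 0 \<in> {0, 1}" "\<sigma> 1 \<in> {0, 1}" "\<sigma> 0 \<noteq> \<sigma> 1"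
    proof -
      have p: "\<sigma> permutes {..<2}" using permute by (simp add: numeral_2_eq_2)
      have "\<sigma> 0 < 2" "\<sigma> 1 < 2" using permutes_in_image[OF p, of 0] permutes_in_image[OF p, of 1] by simp_all
      then show "\<sigma> 0 \<in> {0, 1}" "\<sigma> 1 \<in> {0, 1}" by (simp_all add: less_2_cases_iff One_nat_def)
      show "\<sigma> 0 \<noteq> \<sigma> 1" using permutes_inj[OF p] by (simp add: inj_eq)
    qed
    have "h = [[a, b] ! \<sigma> 0, [a, b] ! \<sigma> 1]" using permute by (simp add: upt_rec One_nat_def)
    then have "h = [a, b] \<or> h = [b, a]" using s by (auto simp: One_nat_def)
    then show ?thesis using ab ctr_commute by auto
  next
    case (invert i)
    then have "h = [inv\<^bsub>G\<^esub> a, b] \<or> h = [a, inv\<^bsub>G\<^esub> b]" using two[of i] by auto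
    then show ?thesis using ab by (auto simp: fi ctr_adj2_left ctr_adj2_right)
  next
    case (multiply i j \<epsilon>)
    have pw: "c [^]\<^bsub>G\<^esub> \<epsilon> = c \<or> c [^]\<^bsub>G\<^esub> \<epsilon> = inv\<^bsub>G\<^esub> c" if "c \<in> carrier G" for c
      using multiply(5) group.int_pow_neg[OF G that, of 1] group.int_pow_1[OF G that] by auto
    have "\<exists>c. (c = a \<and> h = [a, b \<otimes>\<^bsub>G\<^esub> c [^]\<^bsub>G\<^esub> \<epsilon>]) \<or> (c = b \<and> h = [a \<otimes>\<^bsub>G\<^esub> c [^]\<^bsub>G\<^esub> \<epsilon>, b])"
      using multiply two[of i] two[of j] by auto
    then have "h = [a, b \<otimes>\<^bsub>G\<^esub> a] \<or> h = [a, b \<otimes>\<^bsub>G\<^esub> inv\<^bsub>G\<^esub> a] \<or> h = [a \<otimes>\<^bsub>G\<^esub> b, b] \<or> h = [a \<otimes>\<^bsub>G\<^esub> inv\<^bsub>G\<^esub> b, b]"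
      using pw ab by metis
    then show ?thesis
      using ab by (auto simp: fm fi ctr_mult_left ctr_mult_left' ctr_commute[of "f a"])
  qed
qed

lemma nielsen_ctr:
  assumes G: "group G" and f: "f \<in> hom G grp" and ab: "a \<in> carrier G" "b \<in> carrier G"
    and e: "nielsen_equivalent G [a, b] h"
  shows "\<exists>c\<in>carrier G. \<exists>d\<in>carrier G. h = [c, d] \<and> ctr (f c) (f d) = ctr (f a) (f b)"
proof -
  have "(elementary_equivalent G)\<^sup>*\<^sup>* [a, b] h" using e by (simp add: nielsen_equivalent_def)
  then show ?thesis
  proof (induction rule: rtranclp_induct)
    case base
    then show ?case using ab by auto
  next
    case (step h h')
    then obtain c d where "c \<in> carrier G" "d \<in> carrier G" "h = [c, d]" "ctr (f c) (f d) = ctr (f a) (f b)" by blast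
    then show ?case using elementary_ctr[OF G f, of c d h'] step(2) by metis
  qed
qed

theorem nielsen_classes_exist:
  fixes n :: nat
  assumes z: "z \<in> hyp3" and c: "\<And>i. i < n \<Longrightarrow> c i \<in> \<Gamma>" and b: "b \<in> \<Gamma>"
    and gen: "\<And>i. i < n \<Longrightarrow> generate grp {c i, b} = \<Gamma>"
    and inj: "inj_on (\<lambda>i. ctr (c i) b) {..<n}"
  shows "\<exists>C \<subseteq> nielsen_classes_of_generating_pairs (fundamental_group Q.mtopology (orb z)). finite C \<and> card C = n"
proof -
  define P where "P = fundamental_group Q.mtopology (orb z)"
  define \<phi> where "\<phi> = loops_to z"
  have iso: "\<phi> \<in> iso grp P" and grP: "group P" using fundamental_group_iso[OF z] by (auto simp: P_def \<phi>_def)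
  define f where "f = inv_into \<Gamma> \<phi>"
  have "f \<in> iso P grp" using group.iso_set_sym[OF group_grp iso] by (simp add: f_def)
  then have f: "f \<in> hom P grp" by (simp add: iso_def)
  have bij: "bij_betw \<phi> \<Gamma> (carrier P)" and hom: "\<phi> \<in> hom grp P" using iso by (auto simp: iso_def)
  have f\<phi>: "f (\<phi> g) = g" if "g \<in> \<Gamma>" for g using bij that by (simp add: f_def bij_betw_def)
  have \<phi>c: "\<phi> g \<in> carrier P" if "g \<in> \<Gamma>" for g using bij that by (auto dest: bij_betwE)
  interpret \<phi>: group_hom grp P \<phi> using grP hom group_grp by (simp add: group_hom_def group_hom_axioms_def)
  define K where "K = (\<lambda>i. {h. nielsen_equivalent P [\<phi> (c i), \<phi> b] h})"
  have gp: "[\<phi> (c i), \<phi> b] \<in> generating_pairs P" if i: "i < n" for i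
  proof -
    have "generate P (\<phi> ` {c i, b}) = \<phi> ` generate grp {c i, b}" using c[OF i] b by (intro \<phi>.generate_img) auto
    also have "\<dots> = carrier P" using gen[OF i] bij by (simp add: bij_betw_def)
    finally show ?thesis using \<phi>c c[OF i] b by (auto simp: generating_pairs_def)
  qed
  have "inj_on K {..<n}"
  proof (rule inj_onI)
    fix i j assume ij: "i \<in> {..<n}" "j \<in> {..<n}" "K i = K j"
    have "[\<phi> (c j), \<phi> b] \<in> K j" by (simp add: K_def nielsen_equivalent_def)
    then have "nielsen_equivalent P [\<phi> (c i), \<phi> b] [\<phi> (c j), \<phi> b]" using ij(3) by (auto simp: K_def)
    then have "ctr (f (\<phi> (c j))) (f (\<phi> b)) = ctr (f (\<phi> (c i))) (f (\<phi> b))"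
      using nielsen_ctr[OF grP f, of "\<phi> (c i)" "\<phi> b"] \<phi>c c b ij by auto
    then have "ctr (c j) b = ctr (c i) b" using f\<phi> c b ij by simp
    then show "i = j" using inj ij by (auto dest: inj_onD)
  qed
  then have "card (K ` {..<n}) = n" by (simp add: card_image)
  moreover have "K ` {..<n} \<subseteq> nielsen_classes_of_generating_pairs P"
    using gp by (auto simp: nielsen_classes_of_generating_pairs_def K_def)
  ultimately show ?thesis unfolding P_def by (intro exI[of _ "K ` {..<n}"]) auto
qed

end

section \<open>Generating pairs of the filled knot groups\<close>

context fig8
begin

sublocale K: kleinian "mgen S"
proof
  show "det2 g = 1" if "g \<in> mgen S" for g
    using that by (rule mgen_det) (auto simp: S_def det_dg Hs_nz)
  show "adj2 g \<in> mgen S" if "g \<in> mgen S" for g using that by (rule til.adj_Gamma)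
  show "g * h \<in> mgen S" if "g \<in> mgen S" "h \<in> mgen S" for g h using that by (simp add: mgen_mult)
  show "\<exists>K. compact K \<and> K \<subseteq> hyp3 \<and> (\<forall>x\<in>hyp3. \<exists>g\<in>mgen S. mob g x \<in> K)" using cocompact by metis
qed (use mgen.one displacement in blast)+

lemma ctr_dg_y:
  assumes "h \<noteq> 0" shows "ctr (dg h) y = 2 - (h - 1 / h)\<^sup>2 * (a * b')"
proof -
  have "ctr (dg h) y = 2 * (a * d - b' * a) - (h - 1 / h)\<^sup>2 * (a * b')"
    using assms by (simp add: ctr_def y_def dg_def power2_eq_square field_simps)
  then show ?thesis by (simp add: det)
qed

text \<open>Equal traces give A + 1/A = B + 1/B, so the moduli of A and B are equal or inverse.
  Their logarithms are positive multiples, with factors 2^i and 2^j, of the same nonzero number;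
  this excludes the inverse case and yields i = j.\<close>

lemma ctr_inj: "inj_on (\<lambda>i. ctr (dg (L ^ 2 ^ i)) y) UNIV"
proof (rule inj_onI)
  fix i j :: nat
  define A B where "A = (L ^ 2 ^ i)\<^sup>2" and "B = (L ^ 2 ^ j)\<^sup>2"
  have nz: "A \<noteq> 0" "B \<noteq> 0" by (simp_all add: A_def B_def)
  have ab: "a * b' \<noteq> 0" using m12_s[of 1] by (simp add: s_def y_def)
  assume "ctr (dg (L ^ 2 ^ i)) y = ctr (dg (L ^ 2 ^ j)) y"
  then have "(L ^ 2 ^ i - 1 / L ^ 2 ^ i)\<^sup>2 = (L ^ 2 ^ j - 1 / L ^ 2 ^ j)\<^sup>2" using ab by (simp add: ctr_dg_y)
  then have "A + 1 / A = B + 1 / B" by (simp add: power2_diff A_def B_def power_divide)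
  then have "(A - B) * (A * B - 1) = 0" using nz by (simp add: field_simps)
  then have "cmod A = cmod B \<or> cmod A * cmod B = 1" using nz by (metis eq_iff_diff_eq_0 mult_eq_0_iff norm_mult norm_one)
  then have "ln (cmod A) = ln (cmod B) \<or> ln (cmod A) + ln (cmod B) = 0"
    using nz by (metis ln_mult ln_one norm_eq_zero zero_less_norm_iff)
  moreover have "ln (cmod A) = 2 * (2 ^ i * ln (cmod L))" "ln (cmod B) = 2 * (2 ^ j * ln (cmod L))"
    by (simp_all add: A_def B_def norm_power ln_realpow)
  moreover have "ln (cmod L) \<noteq> 0" using cmod_L by simp
  ultimately have "(2::real) ^ i = 2 ^ j \<or> (2::real) ^ i + 2 ^ j = 0" by (auto simp flip: distrib_right distrib_left)
  moreover have "(2::real) ^ i + 2 ^ j > 0" by (simp add: add_pos_pos)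
  ultimately show "i = j" by auto
qed

text \<open>A power of \<open>L ^ k\<close> is \<open>L ^ N = 1 / M\<close>, the inverse meridian
  eigenvalue. The meridian and \<open>y\<close> give all \<open>s j\<close>, and the longitude is
  then recovered from \<open>rel2'\<close>.\<close>

lemma generate_pair:
  assumes k: "k dvd N"
  shows "generate K.grp {dg (L ^ k), y} = mgen S"
proof
  have dgHs: "dg h \<in> mgen S" if "h \<in> Hs" for h using that by (intro mgen_base) (simp add: S_def)
  have sG: "s j \<in> mgen S" if "j < 4" for j using that by (intro mgen_base) (simp add: S_def)
  have Lk: "L ^ k \<in> Hs" using Hs_powi[OF Hs_L, of "int k"] by simp
  have yG: "y \<in> mgen S" using sG[of 1] by (simp add: s_def)
  have sub: "{dg (L ^ k), y} \<subseteq> carrier K.grp" using dgHs[OF Lk] yG by simp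
  show "generate K.grp {dg (L ^ k), y} \<subseteq> mgen S" using group.generate_incl[OF K.group_grp sub] by simp
  define R where "R = generate K.grp {dg (L ^ k), y}"
  have R1: "1 \<in> R" using generate.one[of K.grp] by (simp add: R_def)
  have Rm: "g * h \<in> R" if "g \<in> R" "h \<in> R" for g h using generate.eng[of _ K.grp] that by (simp add: R_def)
  have Rsub: "R \<subseteq> mgen S" using group.generate_incl[OF K.group_grp sub] by (simp add: R_def)
  have Ri: "adj2 g \<in> R" if "g \<in> R" for g
    using group.generate_m_inv_closed[OF K.group_grp sub, of g] that K.inv_grp[of g] Rsub by (auto simp: R_def)
  have Rk: "dg (L ^ k) \<in> R" and Ry: "y \<in> R" unfolding R_def by (auto intro: generate.incl)
  have Rpow: "dg (h ^ m) \<in> R" if "dg h \<in> R" for h m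
    by (induction m) (use that R1 Rm in \<open>auto simp flip: dg_mult\<close>)
  obtain q where q: "N = k * q" using k by blast
  have "(L ^ k) ^ q = 1 / M" using LN' by (simp add: q power_mult[symmetric] field_simps)
  then have "dg (1 / M) = dg ((L ^ k) ^ q)" by simp
  then have W: "dg W \<in> R" using Rpow[OF Rk] by (simp add: W_def)
  then have MR: "dg M \<in> R" using Ri[OF W] by simp
  have s: "s j \<in> R" if "j < 4" for j using Ry W MR Rm Ri by (auto simp: s_def)
  have "dg L = s 2 * (dg M * (dg M * (s 3 * (dg W * s 1))))" unfolding rel2' by simp
  then have LR: "dg L \<in> R" using s W MR Rm by simp
  have LR': "dg (1 / L) \<in> R" using Ri[OF LR] by (simp add: adj_dg)
  have H: "dg h \<in> R" if "h \<in> Hs" for h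
  proof -
    obtain i :: int where i: "h = L powi i" using \<open>h \<in> Hs\<close> by (auto simp: Hs_def)
    have "h = L ^ nat i \<or> h = (1 / L) ^ nat (- i)"
      by (cases "i \<ge> 0") (auto simp: i power_int_def inverse_eq_divide)
    then show ?thesis using Rpow LR LR' by auto
  qed
  have "S \<subseteq> R" using H s by (auto simp: S_def)
  show "mgen S \<subseteq> generate K.grp {dg (L ^ k), y}" unfolding R_def[symmetric]
  proof
    fix g assume "g \<in> mgen S" then show "g \<in> R"
      by (induction rule: mgen.induct) (use R1 Rm \<open>S \<subseteq> R\<close> in auto)
  qed
qed

end

theorem theorem0p2:
  fixes n :: nat
  shows "\<exists>M :: (complex \<times> real) set metric.
    closed_hyperbolic_3_manifold M \<and>
    (\<forall>x \<in> mspace M. \<exists>C.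
       C \<subseteq> nielsen_classes_of_generating_pairs (fundamental_group (mtopology_of M) x) \<and>
       finite C \<and> card C = n)"
proof -
  obtain N0 where "\<And>N. N \<ge> N0 \<Longrightarrow> \<exists>M \<zeta> u v b. fig8 M \<zeta> u v b N" using fig8_exists by blast
  \<comment> \<open>The exponent \<open>n + N0\<close> makes \<open>N\<close> at least
    \<open>N0\<close> and divisible by \<open>2 ^ i\<close> for every \<open>i < n\<close>.\<close>
  moreover have "N0 \<le> 2 ^ (n + N0)" using less_exp[of "n + N0"] by linarith
  ultimately obtain M \<zeta> u v b where "fig8 M \<zeta> u v b (2 ^ (n + N0))" by metis
  then interpret fig8 M \<zeta> u v b "2 ^ (n + N0)" .
  show ?thesis
  proof (intro exI[of _ K.QM] conjI ballI)
    show "closed_hyperbolic_3_manifold K.QM" by (rule K.closed_hyperbolic_QM)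
    fix x assume "x \<in> mspace K.QM"
    then obtain z where z: "z \<in> hyp3" "x = K.orb z" by auto
    have c: "dg (L ^ k) \<in> mgen S" for k
      using Hs_powi[OF Hs_L, of "int k"] by (intro mgen_base) (simp add: S_def)
    have y: "y \<in> mgen S" by (intro mgen_base) (auto simp: S_def s_def intro!: image_eqI[of _ _ 1])
    show "\<exists>C. C \<subseteq> nielsen_classes_of_generating_pairs (fundamental_group (mtopology_of K.QM) x) \<and>
       finite C \<and> card C = n"
      using K.nielsen_classes_exist[OF z(1), of n "\<lambda>i. dg (L ^ 2 ^ i)" y] c y z(2)
        generate_pair[OF le_imp_power_dvd] inj_on_subset[OF ctr_inj] by auto
  qed
qed

end
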